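(* Let $\nabla$ be a $\Gamma$-linear connection on $E=J^1(T,M)$ with local components $(\bar G^\alpha_{\beta\gamma},G^k_{i\gamma},G^{(i)(\beta)}_{(\alpha)(j)\gamma},\bar L^\alpha_{\beta j},L^k_{ij},L^{(i)(\beta)}_{(\alpha)(j)k},\bar C^{\alpha(\gamma)}_{\beta(k)},C^{j(\gamma)}_{i(k)},C^{(i)(\beta)(\gamma)}_{(\alpha)(j)(k)})$. Its torsion $\mathbf T(X,Y)=\nabla_XY-\nabla_YX-[X,Y]$ is determined by the following local expressions: $$h_T\mathbf T\Big(\frac{\delta}{\delta t^\beta},\frac{\delta}{\delta t^\alpha}\Big)=\bar T^\mu_{\alpha\beta}\frac{\delta}{\delta t^\mu},\quad h_M\mathbf T\Big(\frac{\delta}{\delta t^\beta},\frac{\delta}{\delta t^\alpha}\Big)=0,\quad v\mathbf T\Big(\frac{\delta}{\delta t^\beta},\frac{\delta}{\delta t^\alpha}\Big)=R^{(m)}_{(\mu)\alpha\beta}\frac{\partial}{\partial x^m_\mu},$$ $$h_T\mathbf T\Big(\frac{\delta}{\delta x^j},\frac{\delta}{\delta t^\alpha}\Big)=\bar T^\mu_{\alpha j}\frac{\delta}{\delta t^\mu},\quad h_M\mathbf T\Big(\frac{\delta}{\delta x^j},\frac{\delta}{\delta t^\alpha}\Big)=T^m_{\alpha j}\frac{\delta}{\delta x^m},\quad v\mathbf T\Big(\frac{\delta}{\delta x^j},\frac{\delta}{\delta t^\alpha}\Big)=R^{(m)}_{(\mu)\alpha j}\frac{\partial}{\partial x^m_\mu},$$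 $$h_T\mathbf T\Big(\frac{\delta}{\delta x^j},\frac{\delta}{\delta x^i}\Big)=0,\quad h_M\mathbf T\Big(\frac{\delta}{\delta x^j},\frac{\delta}{\delta x^i}\Big)=T^m_{ij}\frac{\delta}{\delta x^m},\quad v\mathbf T\Big(\frac{\delta}{\delta x^j},\frac{\delta}{\delta x^i}\Big)=R^{(m)}_{(\mu)ij}\frac{\partial}{\partial x^m_\mu},$$ $$h_T\mathbf T\Big(\frac{\partial}{\partial x^j_\beta},\frac{\delta}{\delta t^\alpha}\Big)=\bar P^{\mu(\beta)}_{\alpha(j)}\frac{\delta}{\delta t^\mu},\quad h_M\mathbf T\Big(\frac{\partial}{\partial x^j_\beta},\frac{\delta}{\delta t^\alpha}\Big)=0,\quad v\mathbf T\Big(\frac{\partial}{\partial x^j_\beta},\frac{\delta}{\delta t^\alpha}\Big)=P^{(m)\,(\beta)}_{(\mu)\alpha(j)}\frac{\partial}{\partial x^m_\mu},$$ $$h_T\mathbf T\Big(\frac{\partial}{\partial x^j_\beta},\frac{\delta}{\delta x^i}\Big)=0,\quad h_M\mathbf T\Big(\frac{\partial}{\partial x^j_\beta},\frac{\delta}{\delta x^i}\Big)=P^{m(\beta)}_{i(j)}\frac{\delta}{\delta x^m},\quad v\mathbf T\Big(\frac{\partial}{\partial x^j_\beta},\frac{\delta}{\delta x^i}\Big)=P^{(m)\,(\beta)}_{(\mu)i(j)}\frac{\partial}{\partial x^m_\mu},$$ $$h_T\mathbf T\Big(\frac{\partial}{\partial x^j_\beta},\frac{\partial}{\partial x^i_\alpha}\Big)=0,\quad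 h_M\mathbf T\Big(\frac{\partial}{\partial x^j_\beta},\frac{\partial}{\partial x^i_\alpha}\Big)=0,\quad v\mathbf T\Big(\frac{\partial}{\partial x^j_\beta},\frac{\partial}{\partial x^i_\alpha}\Big)=S^{(m)(\alpha)(\beta)}_{(\mu)(i)(j)}\frac{\partial}{\partial x^m_\mu},$$ where $$R^{(m)}_{(\mu)\alpha\beta}=\frac{\delta M^{(m)}_{(\mu)\alpha}}{\delta t^\beta}-\frac{\delta M^{(m)}_{(\mu)\beta}}{\delta t^\alpha},\quad R^{(m)}_{(\mu)\alpha j}=\frac{\delta M^{(m)}_{(\mu)\alpha}}{\delta x^j}-\frac{\delta N^{(m)}_{(\mu)j}}{\delta t^\alpha},\quad R^{(m)}_{(\mu)ij}=\frac{\delta N^{(m)}_{(\mu)i}}{\delta x^j}-\frac{\delta N^{(m)}_{(\mu)j}}{\delta x^i},$$ $$\bar T^\mu_{\alpha\beta}=\bar G^\mu_{\alpha\beta}-\bar G^\mu_{\beta\alpha},\quad \bar T^\mu_{\alpha j}=\bar L^\mu_{\alpha j},\quad \bar P^{\mu(\beta)}_{\alpha(j)}=\bar C^{\mu(\beta)}_{\alpha(j)},\quad T^m_{\alpha j}=-G^m_{j\alpha},$$ $$T^m_{ij}=L^m_{ij}-L^m_{ji},\quad P^{m(\beta)}_{i(j)}=C^{m(\beta)}_{i(j)},\quad S^{(m)(\alpha)(\beta)}_{(\mu)(i)(j)}=C^{(m)(\alpha)(\beta)}_{(\mu)(i)(j)}-C^{(m)(\beta)(\alpha)}_{(\mu)(j)(i)},$$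 $$P^{(m)\,(\beta)}_{(\mu)\alpha(j)}=\frac{\partial M^{(m)}_{(\mu)\alpha}}{\partial x^j_\beta}-G^{(m)(\beta)}_{(\mu)(j)\alpha},\quad P^{(m)\,(\beta)}_{(\mu)i(j)}=\frac{\partial N^{(m)}_{(\mu)i}}{\partial x^j_\beta}-L^{(m)(\beta)}_{(\mu)(j)i}.$$
   Context: $T$ and $M$ are smooth manifolds of dimensions $p$ and $n$, with local coordinates $(t^\alpha)$ and $(x^i)$; Greek indices run from $1$ to $p$, Latin indices from $1$ to $n$, and repeated indices are summed. $E=J^1(T,M)\to T\times M$ is the first-order jet bundle, with coordinates $(t^\alpha,x^i,x^i_\alpha)$; coordinate changes have the form $\tilde t^\alpha=\tilde t^\alpha(t)$, $\tilde x^i=\tilde x^i(x)$, $\tilde x^j_\beta=\frac{\partial\tilde x^j}{\partial x^i}\frac{\partial t^\alpha}{\partial\tilde t^\beta}x^i_\alpha$. $\mathcal X(E)$ denotes the vector fields on $E$. A fixed nonlinear connection $\Gamma$ on $E$ is given by local functions $M^{(i)}_{(\alpha)\beta},N^{(i)}_{(\alpha)j}$ on $E$ with transformation rules $$\tilde M^{(j)}_{(\beta)\mu}\frac{\partial\tilde t^\mu}{\partial t^\alpha}=M^{(k)}_{(\gamma)\alpha}\frac{\partial\tilde x^j}{\partial x^k}\frac{\partial t^\gamma}{\partial\tilde t^\beta}-\frac{\partial\tilde x^j_\beta}{\partial t^\alpha},\qquad \tilde N^{(j)}_{(\beta)k}\frac{\partial\tilde x^k}{\partial x^i}=N^{(k)}_{(\gamma)i}\frac{\partial\tilde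 x^j}{\partial x^k}\frac{\partial t^\gamma}{\partial\tilde t^\beta}-\frac{\partial\tilde x^j_\beta}{\partial x^i}.$$ Its adapted basis of vector fields is $\frac{\delta}{\delta t^\alpha}=\frac{\partial}{\partial t^\alpha}-M^{(j)}_{(\beta)\alpha}\frac{\partial}{\partial x^j_\beta}$, $\frac{\delta}{\delta x^i}=\frac{\partial}{\partial x^i}-N^{(j)}_{(\beta)i}\frac{\partial}{\partial x^j_\beta}$, $\frac{\partial}{\partial x^i_\alpha}$. These span, respectively, three distributions whose direct sum is $TE$; $h_T,h_M,v$ denote the corresponding projections. For a function $f$, $\frac{\delta f}{\delta t^\alpha}$ and $\frac{\delta f}{\delta x^i}$ denote the derivatives of $f$ along these vector fields. A $\Gamma$-linear connection is a linear connection $\nabla:\mathcal X(E)\times\mathcal X(E)\to\mathcal X(E)$ with $\nabla h_T=0$, $\nabla h_M=0$, $\nabla v=0$ (i.e. $\nabla_X(h_TY)=h_T(\nabla_XY)$, and similarly for $h_M,v$). Its nine local components are defined by $$\nabla_{\frac{\delta}{\delta t^\gamma}}\frac{\delta}{\delta t^\beta}=\bar G^\alpha_{\beta\gamma}\frac{\delta}{\delta t^\alpha},\quad \nabla_{\frac{\delta}{\delta t^\gamma}}\frac{\delta}{\delta x^i}=G^k_{i\gamma}\frac{\delta}{\delta x^k},\quad \nabla_{\frac{\delta}{\delta t^\gamma}}\frac{\partial}{\partial x^i_\beta}=G^{(k)(\beta)}_{(\alpha)(i)\gamma}\frac{\partial}{\partial x^k_\alpha},$$ $$\nabla_{\frac{\delta}{\delta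 x^j}}\frac{\delta}{\delta t^\beta}=\bar L^\alpha_{\beta j}\frac{\delta}{\delta t^\alpha},\quad \nabla_{\frac{\delta}{\delta x^j}}\frac{\delta}{\delta x^i}=L^k_{ij}\frac{\delta}{\delta x^k},\quad \nabla_{\frac{\delta}{\delta x^j}}\frac{\partial}{\partial x^i_\beta}=L^{(k)(\beta)}_{(\alpha)(i)j}\frac{\partial}{\partial x^k_\alpha},$$ $$\nabla_{\frac{\partial}{\partial x^j_\gamma}}\frac{\delta}{\delta t^\beta}=\bar C^{\alpha(\gamma)}_{\beta(j)}\frac{\delta}{\delta t^\alpha},\quad \nabla_{\frac{\partial}{\partial x^j_\gamma}}\frac{\delta}{\delta x^i}=C^{k(\gamma)}_{i(j)}\frac{\delta}{\delta x^k},\quad \nabla_{\frac{\partial}{\partial x^j_\gamma}}\frac{\partial}{\partial x^i_\beta}=C^{(k)(\beta)(\gamma)}_{(\alpha)(i)(j)}\frac{\partial}{\partial x^k_\alpha}.$$ *)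

theory Defs
  imports "HOL-Analysis.Analysis"
begin

section \<open>Smooth maps between Euclidean spaces\<close>

text \<open>Only used for open \<open>S\<close>; for a finite-dimensional domain the directional derivatives
  in the second equation determine the total derivative, so this is the class \<open>C\<^sup>k\<close>.\<close>

primrec Ck_on :: "nat \<Rightarrow> 'v::real_normed_vector set \<Rightarrow> ('v \<Rightarrow> 'w::real_normed_vector) \<Rightarrow> bool" where
  "Ck_on 0 S f \<longleftrightarrow> continuous_on S f"
| "Ck_on (Suc k) S f \<longleftrightarrow>
     (\<forall>x\<in>S. f differentiable (at x)) \<and> (\<forall>v. Ck_on k S (\<lambda>x. frechet_derivative f (at x) v))"

definition smooth_on :: "'v::real_normed_vector set \<Rightarrow> ('v \<Rightarrow> 'w::real_normed_vector) \<Rightarrow> bool" where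
  "smooth_on S f \<longleftrightarrow> (\<forall>k. Ck_on k S f)"

section \<open>Smooth manifolds\<close>

text \<open>A chart is a pair of a domain and a coordinate map (arbitrary outside the domain).
  A manifold is given by an atlas; its underlying set is the union of the chart domains and its
  topology is the one for which all charts are homeomorphisms onto open subsets of the model space.\<close>

type_synonym ('m, 'v) chart = "'m set \<times> ('m \<Rightarrow> 'v)"

definition carrier :: "('m, 'v) chart set \<Rightarrow> 'm set" where
  "carrier A = (\<Union>c\<in>A. fst c)"

definition chart_inv :: "('m, 'v) chart \<Rightarrow> 'v \<Rightarrow> 'm" where
  "chart_inv c = inv_into (fst c) (snd c)"

definition manifold_topology :: "('m, 'v::euclidean_space) chart set \<Rightarrow> 'm topology" where
  "manifold_topology A =
     topology (\<lambda>W. W \<subseteq> carrier A \<and> (\<forall>c\<in>A. open (snd c ` (W \<inter> fst c))))"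

definition smooth_manifold :: "('m, 'v::euclidean_space) chart set \<Rightarrow> bool" where
  "smooth_manifold A \<longleftrightarrow>
     (\<forall>c\<in>A. inj_on (snd c) (fst c) \<and> open (snd c ` fst c)) \<and>
     (\<forall>c\<in>A. \<forall>c'\<in>A. open (snd c ` (fst c \<inter> fst c')) \<and>
        smooth_on (snd c ` (fst c \<inter> fst c')) (snd c' \<circ> chart_inv c)) \<and>
     Hausdorff_space (manifold_topology A) \<and> second_countable (manifold_topology A)"

text \<open>\<open>f\<close> is smooth on some neighbourhood of \<open>x\<close>; nothing is required of \<open>f\<close> elsewhere.\<close>

definition smooth_near :: "('m, 'v::euclidean_space) chart set \<Rightarrow> ('m \<Rightarrow> real) \<Rightarrow> 'm \<Rightarrow> bool" where
  "smooth_near A f x \<longleftrightarrow> x \<in> carrier A \<and>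
     (\<forall>c\<in>A. x \<in> fst c \<longrightarrow>
        (\<exists>W. open W \<and> snd c x \<in> W \<and> W \<subseteq> snd c ` fst c \<and> smooth_on W (f \<circ> chart_inv c)))"

definition smooth_fun :: "('m, 'v::euclidean_space) chart set \<Rightarrow> ('m \<Rightarrow> real) \<Rightarrow> bool" where
  "smooth_fun A f \<longleftrightarrow> (\<forall>x\<in>carrier A. smooth_near A f x)"

definition smooth_map_near ::
  "('a, 'v::euclidean_space) chart set \<Rightarrow> ('b, 'w::euclidean_space) chart set \<Rightarrow> ('a \<Rightarrow> 'b) \<Rightarrow> 'a \<Rightarrow> bool" where
  "smooth_map_near A B f x \<longleftrightarrow> x \<in> carrier A \<and> f x \<in> carrier B \<and>
     (\<forall>c\<in>A. \<forall>d\<in>B. x \<in> fst c \<longrightarrow> f x \<in> fst d \<longrightarrow>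
        (\<exists>W. open W \<and> snd c x \<in> W \<and> W \<subseteq> snd c ` fst c \<and> f ` chart_inv c ` W \<subseteq> fst d \<and>
             smooth_on W (snd d \<circ> f \<circ> chart_inv c)))"

section \<open>Tangent vectors, vector fields and linear connections\<close>

text \<open>A tangent vector at \<open>x\<close> is a directional derivative in some chart, acting on the functions
  that are smooth near \<open>x\<close>. Its value on all other functions is fixed to be \<open>0\<close>, and a vector
  field is the zero operator off the underlying set, so that equality of tangent vectors and of
  vector fields is equality of HOL functions.\<close>

type_synonym 'm tangent = "('m \<Rightarrow> real) \<Rightarrow> real"
type_synonym 'm field = "'m \<Rightarrow> 'm tangent"

definition dir_vec ::
  "('m, 'v::euclidean_space) chart set \<Rightarrow> ('m, 'v) chart \<Rightarrow> 'v \<Rightarrow> 'm field" where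
  "dir_vec A c b x f =
     (if smooth_near A f x then frechet_derivative (f \<circ> chart_inv c) (at (snd c x)) b else 0)"

definition tangent_space :: "('m, 'v::euclidean_space) chart set \<Rightarrow> 'm \<Rightarrow> 'm tangent set" where
  "tangent_space A x = {dir_vec A c b x |c b. c \<in> A \<and> x \<in> fst c}"

definition vector_fields :: "('m, 'v::euclidean_space) chart set \<Rightarrow> 'm field set" where
  "vector_fields A = {X.
     (\<forall>x\<in>carrier A. X x \<in> tangent_space A x) \<and>
     (\<forall>x. x \<notin> carrier A \<longrightarrow> X x = (\<lambda>f. 0)) \<and>
     (\<forall>x f. smooth_near A f x \<longrightarrow> smooth_near A (\<lambda>y. X y f) x)}"

definition lie_bracket ::
  "('m, 'v::euclidean_space) chart set \<Rightarrow> 'm field \<Rightarrow> 'm field \<Rightarrow> 'm field" where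
  "lie_bracket A X Y x f =
     (if smooth_near A f x then X x (\<lambda>y. Y y f) - Y x (\<lambda>y. X y f) else 0)"

definition fadd :: "'m field \<Rightarrow> 'm field \<Rightarrow> 'm field" where
  "fadd X Y = (\<lambda>x f. X x f + Y x f)"

definition fscale :: "('m \<Rightarrow> real) \<Rightarrow> 'm field \<Rightarrow> 'm field" where
  "fscale g X = (\<lambda>x f. g x * X x f)"

definition linear_connection ::
  "('m, 'v::euclidean_space) chart set \<Rightarrow> ('m field \<Rightarrow> 'm field \<Rightarrow> 'm field) \<Rightarrow> bool" where
  "linear_connection A D \<longleftrightarrow>
     (\<forall>X\<in>vector_fields A. \<forall>Y\<in>vector_fields A. D X Y \<in> vector_fields A) \<and>
     (\<forall>X\<in>vector_fields A. \<forall>X'\<in>vector_fields A. \<forall>Y\<in>vector_fields A.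
        D (fadd X X') Y = fadd (D X Y) (D X' Y)) \<and>
     (\<forall>X\<in>vector_fields A. \<forall>Y\<in>vector_fields A. \<forall>Y'\<in>vector_fields A.
        D X (fadd Y Y') = fadd (D X Y) (D X Y')) \<and>
     (\<forall>g. smooth_fun A g \<longrightarrow> (\<forall>X\<in>vector_fields A. \<forall>Y\<in>vector_fields A.
        D (fscale g X) Y = fscale g (D X Y) \<and>
        D X (fscale g Y) = fadd (fscale (\<lambda>x. X x g) Y) (fscale g (D X Y))))"

definition torsion ::
  "('m, 'v::euclidean_space) chart set \<Rightarrow> ('m field \<Rightarrow> 'm field \<Rightarrow> 'm field)
     \<Rightarrow> 'm field \<Rightarrow> 'm field \<Rightarrow> 'm field" where
  "torsion A D X Y = (\<lambda>x f. D X Y x f - D Y X x f - lie_bracket A X Y x f)"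

text \<open>Vector-valued 2-forms, as alternating \<open>C\<^sup>\<infinity>\<close>-bilinear maps on vector fields.\<close>

definition skew_tensor ::
  "('m, 'v::euclidean_space) chart set \<Rightarrow> ('m field \<Rightarrow> 'm field \<Rightarrow> 'm field) \<Rightarrow> bool" where
  "skew_tensor A S \<longleftrightarrow>
     (\<forall>X\<in>vector_fields A. \<forall>Y\<in>vector_fields A.
        S X Y \<in> vector_fields A \<and> S X Y = fscale (\<lambda>_. -1) (S Y X)) \<and>
     (\<forall>X\<in>vector_fields A. \<forall>X'\<in>vector_fields A. \<forall>Y\<in>vector_fields A.
        S (fadd X X') Y = fadd (S X Y) (S X' Y)) \<and>
     (\<forall>g. smooth_fun A g \<longrightarrow> (\<forall>X\<in>vector_fields A. \<forall>Y\<in>vector_fields A.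
        S (fscale g X) Y = fscale g (S X Y)))"

section \<open>The first-order jet bundle\<close>

text \<open>In this and the following sections \<open>AT\<close> and \<open>AM\<close> are the atlases of \<open>T\<close> and \<open>M\<close>.
  The 1-jet of \<open>f\<close> at \<open>t\<close> is the pair of \<open>t\<close> and the class of all maps that are smooth near \<open>t\<close>
  and have the same value and the same first derivatives at \<open>t\<close> as \<open>f\<close>.\<close>

type_synonym ('a, 'b) jet = "'a \<times> ('a \<Rightarrow> 'b) set"

definition jet_equiv ::
  "('a, 'v::euclidean_space) chart set \<Rightarrow> ('b, 'w::euclidean_space) chart set \<Rightarrow> 'a
     \<Rightarrow> ('a \<Rightarrow> 'b) \<Rightarrow> ('a \<Rightarrow> 'b) \<Rightarrow> bool" where
  "jet_equiv AT AM t f g \<longleftrightarrow> f t = g t \<and>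
     (\<forall>c\<in>AT. \<forall>d\<in>AM. t \<in> fst c \<longrightarrow> f t \<in> fst d \<longrightarrow>
        frechet_derivative (snd d \<circ> f \<circ> chart_inv c) (at (snd c t)) =
        frechet_derivative (snd d \<circ> g \<circ> chart_inv c) (at (snd c t)))"

definition jet_of ::
  "('a, 'v::euclidean_space) chart set \<Rightarrow> ('b, 'w::euclidean_space) chart set \<Rightarrow> ('a \<Rightarrow> 'b) \<Rightarrow> 'a
     \<Rightarrow> ('a, 'b) jet" where
  "jet_of AT AM f t = (t, {g. smooth_map_near AT AM g t \<and> jet_equiv AT AM t f g})"

definition jets ::
  "('a, 'v::euclidean_space) chart set \<Rightarrow> ('b, 'w::euclidean_space) chart set \<Rightarrow> ('a, 'b) jet set" where
  "jets AT AM = {jet_of AT AM f t |f t. smooth_map_near AT AM f t}"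

definition jet_rep :: "('a, 'b) jet \<Rightarrow> 'a \<Rightarrow> 'b" where
  "jet_rep e = (SOME f. f \<in> snd e)"

definition jet_target :: "('a, 'b) jet \<Rightarrow> 'b" where
  "jet_target e = jet_rep e (fst e)"

type_synonym ('p, 'n) jet_coords = "(real^'p) \<times> (real^'n) \<times> (real^'p^'n)"

text \<open>The coordinates \<open>(t\<^sup>\<alpha>, x\<^sup>i, x\<^sup>i\<^sub>\<alpha>)\<close> on \<open>E\<close> induced by a chart \<open>c\<close> of \<open>T\<close> and a chart \<open>d\<close> of \<open>M\<close>;
  the third component \<open>y\<close> has \<open>y $ i $ \<alpha> = x\<^sup>i\<^sub>\<alpha>\<close>.\<close>

definition jet_chart ::
  "('a, real^'p::finite) chart set \<Rightarrow> ('b, real^'n::finite) chart set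
     \<Rightarrow> ('a, real^'p) chart \<Rightarrow> ('b, real^'n) chart \<Rightarrow> (('a, 'b) jet, ('p, 'n) jet_coords) chart" where
  "jet_chart AT AM c d =
     ({e \<in> jets AT AM. fst e \<in> fst c \<and> jet_target e \<in> fst d},
      \<lambda>e. (snd c (fst e), snd d (jet_target e),
           \<chi> i \<alpha>. frechet_derivative (snd d \<circ> jet_rep e \<circ> chart_inv c) (at (snd c (fst e)))
                   (axis \<alpha> 1) $ i))"

definition jet_atlas ::
  "('a, real^'p::finite) chart set \<Rightarrow> ('b, real^'n::finite) chart set
     \<Rightarrow> (('a, 'b) jet, ('p, 'n) jet_coords) chart set" where
  "jet_atlas AT AM = {jet_chart AT AM c d |c d. c \<in> AT \<and> d \<in> AM}"

abbreviation jet_dom ::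
  "('a, real^'p::finite) chart set \<Rightarrow> ('b, real^'n::finite) chart set
     \<Rightarrow> ('a, real^'p) chart \<Rightarrow> ('b, real^'n) chart \<Rightarrow> ('a, 'b) jet set" where
  "jet_dom AT AM c d \<equiv> fst (jet_chart AT AM c d)"

definition coord_t ::
  "('a, real^'p::finite) chart set \<Rightarrow> ('b, real^'n::finite) chart set
     \<Rightarrow> ('a, real^'p) chart \<Rightarrow> ('b, real^'n) chart \<Rightarrow> 'p \<Rightarrow> ('a, 'b) jet \<Rightarrow> real" where
  "coord_t AT AM c d \<alpha> e = fst (snd (jet_chart AT AM c d) e) $ \<alpha>"

definition coord_x ::
  "('a, real^'p::finite) chart set \<Rightarrow> ('b, real^'n::finite) chart set
     \<Rightarrow> ('a, real^'p) chart \<Rightarrow> ('b, real^'n) chart \<Rightarrow> 'n \<Rightarrow> ('a, 'b) jet \<Rightarrow> real" where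
  "coord_x AT AM c d i e = fst (snd (snd (jet_chart AT AM c d) e)) $ i"

definition coord_v ::
  "('a, real^'p::finite) chart set \<Rightarrow> ('b, real^'n::finite) chart set
     \<Rightarrow> ('a, real^'p) chart \<Rightarrow> ('b, real^'n) chart \<Rightarrow> 'n \<Rightarrow> 'p \<Rightarrow> ('a, 'b) jet \<Rightarrow> real" where
  "coord_v AT AM c d i \<alpha> e = snd (snd (snd (jet_chart AT AM c d) e)) $ i $ \<alpha>"

definition partial_t ::
  "('a, real^'p::finite) chart set \<Rightarrow> ('b, real^'n::finite) chart set
     \<Rightarrow> ('a, real^'p) chart \<Rightarrow> ('b, real^'n) chart \<Rightarrow> 'p \<Rightarrow> ('a, 'b) jet field" where
  "partial_t AT AM c d \<alpha> = dir_vec (jet_atlas AT AM) (jet_chart AT AM c d) (axis \<alpha> 1, 0, 0)"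

definition partial_x ::
  "('a, real^'p::finite) chart set \<Rightarrow> ('b, real^'n::finite) chart set
     \<Rightarrow> ('a, real^'p) chart \<Rightarrow> ('b, real^'n) chart \<Rightarrow> 'n \<Rightarrow> ('a, 'b) jet field" where
  "partial_x AT AM c d i = dir_vec (jet_atlas AT AM) (jet_chart AT AM c d) (0, axis i 1, 0)"

definition partial_v ::
  "('a, real^'p::finite) chart set \<Rightarrow> ('b, real^'n::finite) chart set
     \<Rightarrow> ('a, real^'p) chart \<Rightarrow> ('b, real^'n) chart \<Rightarrow> 'n \<Rightarrow> 'p \<Rightarrow> ('a, 'b) jet field" where
  "partial_v AT AM c d i \<alpha> =
     dir_vec (jet_atlas AT AM) (jet_chart AT AM c d) (0, 0, axis i (axis \<alpha> 1))"

section \<open>Nonlinear connections\<close>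

text \<open>Index conventions: \<open>M c d j \<beta> \<alpha>\<close> is \<open>M\<^sup>(\<^sup>j\<^sup>)\<^sub>(\<^sub>\<beta>\<^sub>)\<^sub>\<alpha>\<close> and \<open>N c d j \<beta> i\<close> is \<open>N\<^sup>(\<^sup>j\<^sup>)\<^sub>(\<^sub>\<beta>\<^sub>)\<^sub>i\<close> in the
  coordinates induced by \<open>c\<close> and \<open>d\<close>. In the transformation rules the tilde coordinates are those
  of \<open>c'\<close> and \<open>d'\<close>; the Jacobian entries are partial derivatives of coordinate functions on \<open>E\<close>.\<close>

type_synonym ('a, 'b, 'p, 'n) M_family =
  "('a, real^'p) chart \<Rightarrow> ('b, real^'n) chart \<Rightarrow> 'n \<Rightarrow> 'p \<Rightarrow> 'p \<Rightarrow> ('a, 'b) jet \<Rightarrow> real"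
type_synonym ('a, 'b, 'p, 'n) N_family =
  "('a, real^'p) chart \<Rightarrow> ('b, real^'n) chart \<Rightarrow> 'n \<Rightarrow> 'p \<Rightarrow> 'n \<Rightarrow> ('a, 'b) jet \<Rightarrow> real"

definition nonlinear_connection ::
  "('a, real^'p::finite) chart set \<Rightarrow> ('b, real^'n::finite) chart set
     \<Rightarrow> ('a, 'b, 'p, 'n) M_family \<Rightarrow> ('a, 'b, 'p, 'n) N_family \<Rightarrow> bool" where
  "nonlinear_connection AT AM M N \<longleftrightarrow>
     (\<forall>c\<in>AT. \<forall>d\<in>AM. \<forall>e\<in>jet_dom AT AM c d. \<forall>j \<beta>.
        (\<forall>\<alpha>. smooth_near (jet_atlas AT AM) (M c d j \<beta> \<alpha>) e) \<and>
        (\<forall>i. smooth_near (jet_atlas AT AM) (N c d j \<beta> i) e)) \<and>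
     (\<forall>c\<in>AT. \<forall>d\<in>AM. \<forall>c'\<in>AT. \<forall>d'\<in>AM. \<forall>e \<in> jet_dom AT AM c d \<inter> jet_dom AT AM c' d'. \<forall>j \<beta>.
        (\<forall>\<alpha>. (\<Sum>\<mu>\<in>UNIV. M c' d' j \<beta> \<mu> e * partial_t AT AM c d \<alpha> e (coord_t AT AM c' d' \<mu>)) =
             (\<Sum>k\<in>UNIV. \<Sum>\<gamma>\<in>UNIV. M c d k \<gamma> \<alpha> e
                * partial_x AT AM c d k e (coord_x AT AM c' d' j)
                * partial_t AT AM c' d' \<beta> e (coord_t AT AM c d \<gamma>))
             - partial_t AT AM c d \<alpha> e (coord_v AT AM c' d' j \<beta>)) \<and>
        (\<forall>i. (\<Sum>k\<in>UNIV. N c' d' j \<beta> k e * partial_x AT AM c d i e (coord_x AT AM c' d' k)) =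
             (\<Sum>k\<in>UNIV. \<Sum>\<gamma>\<in>UNIV. N c d k \<gamma> i e
                * partial_x AT AM c d k e (coord_x AT AM c' d' j)
                * partial_t AT AM c' d' \<beta> e (coord_t AT AM c d \<gamma>))
             - partial_x AT AM c d i e (coord_v AT AM c' d' j \<beta>)))"

definition delta_t ::
  "('a, real^'p::finite) chart set \<Rightarrow> ('b, real^'n::finite) chart set \<Rightarrow> ('a, 'b, 'p, 'n) M_family
     \<Rightarrow> ('a, real^'p) chart \<Rightarrow> ('b, real^'n) chart \<Rightarrow> 'p \<Rightarrow> ('a, 'b) jet field" where
  "delta_t AT AM M c d \<alpha> e f = partial_t AT AM c d \<alpha> e f
     - (\<Sum>j\<in>UNIV. \<Sum>\<beta>\<in>UNIV. M c d j \<beta> \<alpha> e * partial_v AT AM c d j \<beta> e f)"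

definition delta_x ::
  "('a, real^'p::finite) chart set \<Rightarrow> ('b, real^'n::finite) chart set \<Rightarrow> ('a, 'b, 'p, 'n) N_family
     \<Rightarrow> ('a, real^'p) chart \<Rightarrow> ('b, real^'n) chart \<Rightarrow> 'n \<Rightarrow> ('a, 'b) jet field" where
  "delta_x AT AM N c d i e f = partial_x AT AM c d i e f
     - (\<Sum>j\<in>UNIV. \<Sum>\<beta>\<in>UNIV. N c d j \<beta> i e * partial_v AT AM c d j \<beta> e f)"

text \<open>The three distributions. By the transformation rules the span is the same in every chart at \<open>e\<close>.\<close>

definition dist_T ::
  "('a, real^'p::finite) chart set \<Rightarrow> ('b, real^'n::finite) chart set \<Rightarrow> ('a, 'b, 'p, 'n) M_family
     \<Rightarrow> ('a, 'b) jet \<Rightarrow> ('a, 'b) jet tangent set" where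
  "dist_T AT AM M e = {(\<lambda>f. \<Sum>\<alpha>\<in>UNIV. a \<alpha> * delta_t AT AM M c d \<alpha> e f) |c d a.
     c \<in> AT \<and> d \<in> AM \<and> e \<in> jet_dom AT AM c d}"

definition dist_M ::
  "('a, real^'p::finite) chart set \<Rightarrow> ('b, real^'n::finite) chart set \<Rightarrow> ('a, 'b, 'p, 'n) N_family
     \<Rightarrow> ('a, 'b) jet \<Rightarrow> ('a, 'b) jet tangent set" where
  "dist_M AT AM N e = {(\<lambda>f. \<Sum>i\<in>UNIV. a i * delta_x AT AM N c d i e f) |c d a.
     c \<in> AT \<and> d \<in> AM \<and> e \<in> jet_dom AT AM c d}"

definition dist_V ::
  "('a, real^'p::finite) chart set \<Rightarrow> ('b, real^'n::finite) chart set
     \<Rightarrow> ('a, 'b) jet \<Rightarrow> ('a, 'b) jet tangent set" where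
  "dist_V AT AM e = {(\<lambda>f. \<Sum>i\<in>UNIV. \<Sum>\<alpha>\<in>UNIV. a i \<alpha> * partial_v AT AM c d i \<alpha> e f) |c d a.
     c \<in> AT \<and> d \<in> AM \<and> e \<in> jet_dom AT AM c d}"

text \<open>Projection onto \<open>P\<close> along \<open>Q \<oplus> R\<close>.\<close>

definition proj_along ::
  "'m tangent set \<Rightarrow> 'm tangent set \<Rightarrow> 'm tangent set \<Rightarrow> 'm tangent \<Rightarrow> 'm tangent" where
  "proj_along P Q R v = (THE u. u \<in> P \<and> (\<exists>w\<in>Q. \<exists>z\<in>R. v = (\<lambda>f. u f + w f + z f)))"

definition proj_T ::
  "('a, real^'p::finite) chart set \<Rightarrow> ('b, real^'n::finite) chart set
     \<Rightarrow> ('a, 'b, 'p, 'n) M_family \<Rightarrow> ('a, 'b, 'p, 'n) N_family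
     \<Rightarrow> ('a, 'b) jet field \<Rightarrow> ('a, 'b) jet field" where
  "proj_T AT AM M N X = (\<lambda>e. if e \<in> jets AT AM
     then proj_along (dist_T AT AM M e) (dist_M AT AM N e) (dist_V AT AM e) (X e) else (\<lambda>f. 0))"

definition proj_M ::
  "('a, real^'p::finite) chart set \<Rightarrow> ('b, real^'n::finite) chart set
     \<Rightarrow> ('a, 'b, 'p, 'n) M_family \<Rightarrow> ('a, 'b, 'p, 'n) N_family
     \<Rightarrow> ('a, 'b) jet field \<Rightarrow> ('a, 'b) jet field" where
  "proj_M AT AM M N X = (\<lambda>e. if e \<in> jets AT AM
     then proj_along (dist_M AT AM N e) (dist_T AT AM M e) (dist_V AT AM e) (X e) else (\<lambda>f. 0))"

definition proj_V ::
  "('a, real^'p::finite) chart set \<Rightarrow> ('b, real^'n::finite) chart set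
     \<Rightarrow> ('a, 'b, 'p, 'n) M_family \<Rightarrow> ('a, 'b, 'p, 'n) N_family
     \<Rightarrow> ('a, 'b) jet field \<Rightarrow> ('a, 'b) jet field" where
  "proj_V AT AM M N X = (\<lambda>e. if e \<in> jets AT AM
     then proj_along (dist_V AT AM e) (dist_T AT AM M e) (dist_M AT AM N e) (X e) else (\<lambda>f. 0))"

section \<open>\<open>\<Gamma>\<close>-linear connections and their local components\<close>

definition Gamma_linear_connection ::
  "('a, real^'p::finite) chart set \<Rightarrow> ('b, real^'n::finite) chart set
     \<Rightarrow> ('a, 'b, 'p, 'n) M_family \<Rightarrow> ('a, 'b, 'p, 'n) N_family
     \<Rightarrow> (('a, 'b) jet field \<Rightarrow> ('a, 'b) jet field \<Rightarrow> ('a, 'b) jet field) \<Rightarrow> bool" where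
  "Gamma_linear_connection AT AM M N D \<longleftrightarrow> linear_connection (jet_atlas AT AM) D \<and>
     (\<forall>X\<in>vector_fields (jet_atlas AT AM). \<forall>Y\<in>vector_fields (jet_atlas AT AM).
        D X (proj_T AT AM M N Y) = proj_T AT AM M N (D X Y) \<and>
        D X (proj_M AT AM M N Y) = proj_M AT AM M N (D X Y) \<and>
        D X (proj_V AT AM M N Y) = proj_V AT AM M N (D X Y))"

text \<open>A linear connection and its torsion act on global vector fields, whereas the adapted basis
  consists of local ones. As both operators are local, expressions such as
  \<open>\<nabla>\<^bsub>\<delta>/\<delta>t\<^esub> \<delta>/\<delta>t\<close> at \<open>e\<close> are evaluated, as usual, on global fields that coincide with the adapted
  basis on a neighbourhood of \<open>e\<close>.\<close>

definition agree_near ::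
  "('m, 'v::euclidean_space) chart set \<Rightarrow> 'm \<Rightarrow> 'm field \<Rightarrow> 'm field \<Rightarrow> bool" where
  "agree_near A x X Y \<longleftrightarrow> (\<exists>W. openin (manifold_topology A) W \<and> x \<in> W \<and> (\<forall>y\<in>W. X y = Y y))"

definition extends_adapted_basis ::
  "('a, real^'p::finite) chart set \<Rightarrow> ('b, real^'n::finite) chart set
     \<Rightarrow> ('a, 'b, 'p, 'n) M_family \<Rightarrow> ('a, 'b, 'p, 'n) N_family
     \<Rightarrow> ('a, real^'p) chart \<Rightarrow> ('b, real^'n) chart \<Rightarrow> ('a, 'b) jet
     \<Rightarrow> ('p \<Rightarrow> ('a, 'b) jet field) \<Rightarrow> ('n \<Rightarrow> ('a, 'b) jet field) \<Rightarrow> ('n \<Rightarrow> 'p \<Rightarrow> ('a, 'b) jet field)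
     \<Rightarrow> bool" where
  "extends_adapted_basis AT AM M N c d e Xt Xx Xv \<longleftrightarrow>
     (\<forall>\<alpha>. Xt \<alpha> \<in> vector_fields (jet_atlas AT AM) \<and>
          agree_near (jet_atlas AT AM) e (Xt \<alpha>) (delta_t AT AM M c d \<alpha>)) \<and>
     (\<forall>i. Xx i \<in> vector_fields (jet_atlas AT AM) \<and>
          agree_near (jet_atlas AT AM) e (Xx i) (delta_x AT AM N c d i)) \<and>
     (\<forall>i \<alpha>. Xv i \<alpha> \<in> vector_fields (jet_atlas AT AM) \<and>
          agree_near (jet_atlas AT AM) e (Xv i \<alpha>) (partial_v AT AM c d i \<alpha>))"

text \<open>Index conventions for the nine families (arguments after the charts, before the point):
  first the index of the resulting basis vector, then that of the differentiated one, then that of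
  the direction; for the vertical basis vector \<open>\<partial>/\<partial>x\<^sup>i\<^sub>\<alpha>\<close> the index is the pair \<open>i \<alpha>\<close>.\<close>

definition local_components ::
  "('a, real^'p::finite) chart set \<Rightarrow> ('b, real^'n::finite) chart set
     \<Rightarrow> ('a, 'b, 'p, 'n) M_family \<Rightarrow> ('a, 'b, 'p, 'n) N_family
     \<Rightarrow> (('a, 'b) jet field \<Rightarrow> ('a, 'b) jet field \<Rightarrow> ('a, 'b) jet field)
     \<Rightarrow> (('a, real^'p) chart \<Rightarrow> ('b, real^'n) chart \<Rightarrow> 'p \<Rightarrow> 'p \<Rightarrow> 'p \<Rightarrow> ('a, 'b) jet \<Rightarrow> real)
     \<Rightarrow> (('a, real^'p) chart \<Rightarrow> ('b, real^'n) chart \<Rightarrow> 'n \<Rightarrow> 'n \<Rightarrow> 'p \<Rightarrow> ('a, 'b) jet \<Rightarrow> real)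
     \<Rightarrow> (('a, real^'p) chart \<Rightarrow> ('b, real^'n) chart \<Rightarrow> 'n \<Rightarrow> 'p \<Rightarrow> 'n \<Rightarrow> 'p \<Rightarrow> 'p \<Rightarrow> ('a, 'b) jet \<Rightarrow> real)
     \<Rightarrow> (('a, real^'p) chart \<Rightarrow> ('b, real^'n) chart \<Rightarrow> 'p \<Rightarrow> 'p \<Rightarrow> 'n \<Rightarrow> ('a, 'b) jet \<Rightarrow> real)
     \<Rightarrow> (('a, real^'p) chart \<Rightarrow> ('b, real^'n) chart \<Rightarrow> 'n \<Rightarrow> 'n \<Rightarrow> 'n \<Rightarrow> ('a, 'b) jet \<Rightarrow> real)
     \<Rightarrow> (('a, real^'p) chart \<Rightarrow> ('b, real^'n) chart \<Rightarrow> 'n \<Rightarrow> 'p \<Rightarrow> 'n \<Rightarrow> 'p \<Rightarrow> 'n \<Rightarrow> ('a, 'b) jet \<Rightarrow> real)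
     \<Rightarrow> (('a, real^'p) chart \<Rightarrow> ('b, real^'n) chart \<Rightarrow> 'p \<Rightarrow> 'p \<Rightarrow> 'n \<Rightarrow> 'p \<Rightarrow> ('a, 'b) jet \<Rightarrow> real)
     \<Rightarrow> (('a, real^'p) chart \<Rightarrow> ('b, real^'n) chart \<Rightarrow> 'n \<Rightarrow> 'n \<Rightarrow> 'n \<Rightarrow> 'p \<Rightarrow> ('a, 'b) jet \<Rightarrow> real)
     \<Rightarrow> (('a, real^'p) chart \<Rightarrow> ('b, real^'n) chart \<Rightarrow> 'n \<Rightarrow> 'p \<Rightarrow> 'n \<Rightarrow> 'p \<Rightarrow> 'n \<Rightarrow> 'p \<Rightarrow> ('a, 'b) jet \<Rightarrow> real)
     \<Rightarrow> bool" where
  "local_components AT AM M N D Gb G Gv Lb L Lv Cb C Cv \<longleftrightarrow>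
     (\<forall>c\<in>AT. \<forall>d\<in>AM. \<forall>e\<in>jet_dom AT AM c d. \<forall>Xt Xx Xv.
        extends_adapted_basis AT AM M N c d e Xt Xx Xv \<longrightarrow> (\<forall>\<beta> \<gamma> i j.
        D (Xt \<gamma>) (Xt \<beta>) e = (\<lambda>f. \<Sum>\<alpha>\<in>UNIV. Gb c d \<alpha> \<beta> \<gamma> e * delta_t AT AM M c d \<alpha> e f) \<and>
        D (Xt \<gamma>) (Xx i) e = (\<lambda>f. \<Sum>k\<in>UNIV. G c d k i \<gamma> e * delta_x AT AM N c d k e f) \<and>
        D (Xt \<gamma>) (Xv i \<beta>) e =
          (\<lambda>f. \<Sum>k\<in>UNIV. \<Sum>\<alpha>\<in>UNIV. Gv c d k \<alpha> i \<beta> \<gamma> e * partial_v AT AM c d k \<alpha> e f) \<and>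
        D (Xx j) (Xt \<beta>) e = (\<lambda>f. \<Sum>\<alpha>\<in>UNIV. Lb c d \<alpha> \<beta> j e * delta_t AT AM M c d \<alpha> e f) \<and>
        D (Xx j) (Xx i) e = (\<lambda>f. \<Sum>k\<in>UNIV. L c d k i j e * delta_x AT AM N c d k e f) \<and>
        D (Xx j) (Xv i \<beta>) e =
          (\<lambda>f. \<Sum>k\<in>UNIV. \<Sum>\<alpha>\<in>UNIV. Lv c d k \<alpha> i \<beta> j e * partial_v AT AM c d k \<alpha> e f) \<and>
        D (Xv j \<gamma>) (Xt \<beta>) e = (\<lambda>f. \<Sum>\<alpha>\<in>UNIV. Cb c d \<alpha> \<beta> j \<gamma> e * delta_t AT AM M c d \<alpha> e f) \<and>
        D (Xv j \<gamma>) (Xx i) e = (\<lambda>f. \<Sum>k\<in>UNIV. C c d k i j \<gamma> e * delta_x AT AM N c d k e f) \<and>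
        D (Xv j \<gamma>) (Xv i \<beta>) e =
          (\<lambda>f. \<Sum>k\<in>UNIV. \<Sum>\<alpha>\<in>UNIV. Cv c d k \<alpha> i \<beta> j \<gamma> e * partial_v AT AM c d k \<alpha> e f)))"

end

theory Submission
  imports Defs
begin

text \<open>In the chart of \<open>J\<^sup>1(T,M)\<close> induced by charts of \<open>T\<close> and \<open>M\<close> every field of the adapted basis has
  components \<open>k - (0, 0, m)\<close> with \<open>k\<close> constant and \<open>m\<close> a vertical coefficient of \<open>\<Gamma>\<close> (or zero), so the
  bracket of two such fields is vertical, with coefficients the derivatives of \<open>m\<close> along the fields;
  together with the definition of the local components this evaluates the torsion on the basis. The
  transformation rules of \<open>\<Gamma>\<close> say that the lifts \<open>a \<mapsto> (a, 0, - M a)\<close> and \<open>b \<mapsto> (0, b, - N b)\<close> commute with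
  changes of jet charts, so the three distributions can be read off in any single chart. Finally the
  torsion is a tensor, and bump functions show that a tensor is determined by its values on local frames.\<close>

section \<open>Smooth maps\<close>

text \<open>Two mismatches shape the proof. \<open>D\<close>, the torsion and all tensors act on
  global fields, whereas the adapted basis lives on a chart domain. Basis fields are therefore cut
  off, and a cut-off extends smoothly by zero only because a compact set inside a chart is closed;
  so the Hausdorff property has to be carried over from \<open>T\<close> and \<open>M\<close> to the
  jet space. In the other direction, an equality of tensors is checked point by point, which
  requires that a C-infinity-linear operator on global fields sees only the value of its argument at
  the point.

  Jets are equivalence classes reached through chosen representatives, and charts are total
  functions with arbitrary values off their domain. Hence most statements concern germs and are
  phrased with \<open>eventually\<close> in \<open>nhds\<close>, and definitions that quantify over
  all charts are first reduced to a single one. Brackets are computed from coordinate expressions,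
  where the second-order terms have to cancel; this rests on the symmetry of iterated directional
  derivatives.\<close>

lemma has_derivative_cong_eventually:
  assumes "eventually (\<lambda>y. f y = g y) (nhds x)"
  shows "(f has_derivative f') (at x) \<longleftrightarrow> (g has_derivative f') (at x)"
proof -
  obtain W where "open W" "x \<in> W" "\<And>y. y \<in> W \<Longrightarrow> f y = g y"
    using assms by (auto simp: eventually_nhds)
  then show ?thesis
    by (metis has_derivative_transform_within_open)
qed

lemma frechet_derivative_cong_eventually:
  "eventually (\<lambda>y. f y = g y) (nhds x) \<Longrightarrow> frechet_derivative f (at x) = frechet_derivative g (at x)"
  by (simp add: frechet_derivative_def has_derivative_cong_eventually)

lemma differentiable_cong_eventually:
  "eventually (\<lambda>y. f y = g y) (nhds x) \<Longrightarrow> f differentiable (at x) \<longleftrightarrow> g differentiable (at x)"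
  by (simp add: differentiable_def has_derivative_cong_eventually)

lemma has_derivative_frechet:
  "f differentiable (at x) \<Longrightarrow> (f has_derivative frechet_derivative f (at x)) (at x)"
  by (simp add: frechet_derivative_works)

lemma frechet_derivative_eq:
  "(f has_derivative f') (at x) \<Longrightarrow> frechet_derivative f (at x) = f'"
  by (rule frechet_derivative_at[symmetric])

text \<open>Openness of \<open>S\<close> turns agreement on \<open>S\<close> into agreement near
  each of its points, so the derivatives agree on \<open>S\<close> as well and the induction passes
  on to them; hence \<open>f\<close> and \<open>g\<close> are generalised.\<close>

lemma Ck_on_cong:
  assumes "open S" and "\<And>x. x \<in> S \<Longrightarrow> f x = g x" and "Ck_on k S f"
  shows "Ck_on k S g"
  using assms(2,3)
proof (induction k arbitrary: f g)
  case 0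
  then show ?case
    by (simp cong: continuous_on_cong)
next
  case (Suc k)
  have ev: "eventually (\<lambda>y. f y = g y) (nhds x)" if "x \<in> S" for x
    using eventually_nhds_in_open[OF \<open>open S\<close> that] Suc.prems(1) by (auto elim: eventually_mono)
  show ?case
    unfolding Ck_on.simps
  proof (intro conjI ballI allI)
    fix x assume "x \<in> S"
    then show "g differentiable (at x)"
      using Suc.prems(2) differentiable_cong_eventually[OF ev] by auto
  next
    fix v
    show "Ck_on k S (\<lambda>x. frechet_derivative g (at x) v)"
      by (rule Suc.IH[where f = "\<lambda>x. frechet_derivative f (at x) v"])
        (use Suc.prems frechet_derivative_cong_eventually[OF ev] in auto)
  qed
qed

lemma Ck_on_subset: "Ck_on k S f \<Longrightarrow> T \<subseteq> S \<Longrightarrow> Ck_on k T f"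
  by (induction k arbitrary: f) (auto intro: continuous_on_subset)

lemma Ck_on_SucD: "Ck_on (Suc k) S f \<Longrightarrow> Ck_on k S f"
proof (induction k arbitrary: f)
  case 0
  then show ?case
    by (auto intro!: continuous_at_imp_continuous_on differentiable_imp_continuous_within)
next
  case (Suc k)
  then show ?case
    by (subst Ck_on.simps) (auto simp del: Ck_on.simps(1))
qed

lemma Ck_on_const: "Ck_on k S (\<lambda>x. c)"
  by (induction k arbitrary: c) auto

text \<open>The recursion of \<open>Ck_on\<close> speaks of \<open>frechet_derivative\<close>; this
  rule lets any explicit derivative \<open>f'\<close> take its place, and most closure properties
  below go through it.\<close>

lemma Ck_on_SucI:
  assumes "open S" and "\<And>x. x \<in> S \<Longrightarrow> (f has_derivative f' x) (at x)"
    and "\<And>v. Ck_on k S (\<lambda>x. f' x v)"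
  shows "Ck_on (Suc k) S f"
  unfolding Ck_on.simps
proof (intro conjI ballI allI)
  fix v
  show "Ck_on k S (\<lambda>x. frechet_derivative f (at x) v)"
    by (rule Ck_on_cong[OF assms(1) _ assms(3)]) (simp add: frechet_derivative_eq[OF assms(2)])
qed (use assms(2) in \<open>auto simp: differentiable_def\<close>)

lemma Ck_on_Suc_has_derivative:
  "Ck_on (Suc k) S f \<Longrightarrow> x \<in> S \<Longrightarrow> (f has_derivative frechet_derivative f (at x)) (at x)"
  by (auto intro: has_derivative_frechet)

lemma Ck_on_bounded_linear_compose:
  assumes "bounded_linear L" and "open S" and "Ck_on k S f"
  shows "Ck_on k S (\<lambda>x. L (f x))"
  using assms(3)
proof (induction k arbitrary: f)
  case 0
  then show ?case
    by (simp add: bounded_linear.continuous_on[OF assms(1)])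
next
  case (Suc k)
  show ?case
    by (rule Ck_on_SucI[OF assms(2)
          bounded_linear.has_derivative[OF assms(1) Ck_on_Suc_has_derivative[OF Suc.prems]]])
      (use Suc in auto)
qed

lemma Ck_on_bounded_linear:
  assumes "bounded_linear L" and "open S"
  shows "Ck_on k S L"
proof (cases k)
  case 0
  then show ?thesis
    by (simp add: bounded_linear.continuous_on[OF assms(1)])
next
  case (Suc k)
  then show ?thesis
    using Ck_on_SucI[OF assms(2) bounded_linear_imp_has_derivative[OF assms(1)] Ck_on_const]
    by blast
qed

lemma Ck_on_add:
  assumes "open S" and "Ck_on k S f" and "Ck_on k S g"
  shows "Ck_on k S (\<lambda>x. f x + g x)"
  using assms(2,3)
proof (induction k arbitrary: f g)
  case 0
  then show ?case
    by (simp add: continuous_on_add)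
next
  case (Suc k)
  show ?case
    by (rule Ck_on_SucI[OF assms(1) has_derivative_add[OF
          Ck_on_Suc_has_derivative[OF Suc.prems(1)] Ck_on_Suc_has_derivative[OF Suc.prems(2)]]])
      (use Suc in auto)
qed

lemma Ck_on_sum:
  assumes "open S" and "\<And>i. i \<in> I \<Longrightarrow> Ck_on k S (f i)"
  shows "Ck_on k S (\<lambda>x. \<Sum>i\<in>I. f i x)"
  using assms(2)
  by (induction I rule: infinite_finite_induct) (auto intro: Ck_on_const Ck_on_add assms(1))

text \<open>In the product rule the factors reappear next to their derivatives, so the induction
  hypothesis is applied to one derivative and one factor, the latter demoted from class
  \<open>Suc k\<close> to \<open>k\<close>.\<close>

lemma Ck_on_bilinear:
  assumes "bounded_bilinear p" and "open S" and "Ck_on k S f" and "Ck_on k S g"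
  shows "Ck_on k S (\<lambda>x. p (f x) (g x))"
  using assms(3,4)
proof (induction k arbitrary: f g)
  case 0
  then show ?case
    by (simp add: bounded_bilinear.continuous_on[OF assms(1)])
next
  case (Suc k)
  show ?case
    by (rule Ck_on_SucI[OF assms(2) bounded_bilinear.FDERIV[OF assms(1)
          Ck_on_Suc_has_derivative[OF Suc.prems(1)] Ck_on_Suc_has_derivative[OF Suc.prems(2)]]])
      (use Suc Ck_on_SucD[OF Suc.prems(1)] Ck_on_SucD[OF Suc.prems(2)] in
        \<open>auto intro!: Ck_on_add[OF assms(2)]\<close>)
qed

text \<open>\<open>Ck_on\<close> controls derivatives only in fixed directions. Expansion over
  \<open>Basis\<close> reduces a direction that varies with the point to finitely many fixed
  ones.\<close>

lemma frechet_derivative_expand: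
  fixes g :: "'v::euclidean_space \<Rightarrow> 'w::real_normed_vector"
  assumes "g differentiable (at y)"
  shows "frechet_derivative g (at y) w = (\<Sum>b\<in>Basis. (w \<bullet> b) *\<^sub>R frechet_derivative g (at y) b)"
proof -
  have "linear (frechet_derivative g (at y))"
    by (rule linear_frechet_derivative[OF assms])
  then show ?thesis
    by (subst euclidean_representation[of w, symmetric]) (simp only: linear_sum linear_cmul)
qed

text \<open>The chain rule yields the derivative of \<open>g\<close> in a moving direction. Expanded
  over \<open>Basis\<close> it is a sum of products: a component of a derivative of
  \<open>f\<close>, times a fixed directional derivative of \<open>g\<close> composed with
  \<open>f\<close>, to which the induction hypothesis applies.\<close>

lemma Ck_on_compose:
  fixes f :: "'u::real_normed_vector \<Rightarrow> 'v::euclidean_space" and g :: "'v \<Rightarrow> 'w::real_normed_vector"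
  assumes "open S" and "open T" and "f ` S \<subseteq> T" and "Ck_on k S f" and "Ck_on k T g"
  shows "Ck_on k S (\<lambda>x. g (f x))"
  using assms(4,5)
proof (induction k arbitrary: g)
  case 0
  then show ?case
    using assms(3) by (auto intro: continuous_on_compose2)
next
  case (Suc k)
  have gd: "(g has_derivative frechet_derivative g (at (f x))) (at (f x))" if "x \<in> S" for x
    using that assms(3) by (intro Ck_on_Suc_has_derivative[OF Suc.prems(2)]) auto
  show ?case
  proof (rule Ck_on_SucI[OF assms(1)])
    show "((\<lambda>x. g (f x)) has_derivative
        (\<lambda>v. \<Sum>b\<in>Basis. (frechet_derivative f (at x) v \<bullet> b) *\<^sub>R frechet_derivative g (at (f x)) b))
        (at x)" if "x \<in> S" for x
    proof -
      have "g differentiable (at (f x))"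
        using gd[OF that] by (auto simp: differentiable_def)
      note e = frechet_derivative_expand[OF this]
      show ?thesis
        unfolding e[symmetric]
        by (rule has_derivative_compose[OF Ck_on_Suc_has_derivative[OF Suc.prems(1) that] gd[OF that]])
    qed
  next
    fix v
    have 1: "Ck_on k S (\<lambda>x. frechet_derivative f (at x) v \<bullet> b)" for b
      using Suc.prems(1)
      by (intro Ck_on_bounded_linear_compose[OF bounded_linear_inner_left assms(1)]) auto
    have 2: "Ck_on k S (\<lambda>x. frechet_derivative g (at (f x)) b)" for b
      using Suc.IH[of "\<lambda>y. frechet_derivative g (at y) b"] Suc.prems Ck_on_SucD[OF Suc.prems(1)]
      by auto
    show "Ck_on k S (\<lambda>x. \<Sum>b\<in>Basis. (frechet_derivative f (at x) v \<bullet> b) *\<^sub>R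
        frechet_derivative g (at (f x)) b)"
      by (intro Ck_on_sum Ck_on_bilinear[OF bounded_bilinear_scaleR] assms(1) 1 2)
  qed
qed

section \<open>Smoothness at a point, with open domains hidden in the definition\<close>

definition smooth_at :: "('v::real_normed_vector \<Rightarrow> 'w::real_normed_vector) \<Rightarrow> 'v \<Rightarrow> bool" where
  "smooth_at f x \<longleftrightarrow> (\<exists>W. open W \<and> x \<in> W \<and> smooth_on W f)"

lemma smooth_on_subset: "smooth_on S f \<Longrightarrow> T \<subseteq> S \<Longrightarrow> smooth_on T f"
  by (auto simp: smooth_on_def intro: Ck_on_subset)

lemma smooth_at_eventually: "smooth_at f x \<Longrightarrow> eventually (smooth_at f) (nhds x)"
  by (auto simp: smooth_at_def eventually_nhds)

lemma smooth_at_differentiable: "smooth_at f x \<Longrightarrow> f differentiable (at x)"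
  unfolding smooth_at_def smooth_on_def by (metis Ck_on.simps(2))

lemma smooth_at_has_derivative:
  "smooth_at f x \<Longrightarrow> (f has_derivative frechet_derivative f (at x)) (at x)"
  by (intro has_derivative_frechet smooth_at_differentiable)

lemma smooth_at_continuous: "smooth_at f x \<Longrightarrow> isCont f x"
  by (intro differentiable_imp_continuous_within smooth_at_differentiable)

lemma smooth_at_linear_frechet: "smooth_at f x \<Longrightarrow> linear (frechet_derivative f (at x))"
  by (intro linear_frechet_derivative smooth_at_differentiable)

lemma smooth_at_cong:
  assumes "eventually (\<lambda>y. f y = g y) (nhds x)" and "smooth_at f x"
  shows "smooth_at g x"
proof -
  obtain W where W: "open W" "x \<in> W" "smooth_on W f"
    using assms(2) by (auto simp: smooth_at_def)
  obtain V where V: "open V" "x \<in> V" "\<forall>y\<in>V. f y = g y"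
    using assms(1) by (auto simp: eventually_nhds)
  have "smooth_on (W \<inter> V) g"
    unfolding smooth_on_def
  proof
    fix k
    show "Ck_on k (W \<inter> V) g"
      by (rule Ck_on_cong[where f = f]) (use W V in \<open>auto simp: smooth_on_def intro: Ck_on_subset\<close>)
  qed
  then show ?thesis
    using W V by (auto simp: smooth_at_def intro!: exI[of _ "W \<inter> V"])
qed

lemma smooth_at_cong_iff:
  assumes "eventually (\<lambda>y. f y = g y) (nhds x)"
  shows "smooth_at f x \<longleftrightarrow> smooth_at g x"
  using smooth_at_cong[OF assms] smooth_at_cong[of g f x] assms by (auto simp: eq_commute)

lemma smooth_at_const: "smooth_at (\<lambda>x. c) x"
  by (auto simp: smooth_at_def smooth_on_def Ck_on_const intro: exI[of _ UNIV])

lemma smooth_at_bounded_linear: "bounded_linear L \<Longrightarrow> smooth_at L x"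
  by (auto simp: smooth_at_def smooth_on_def Ck_on_bounded_linear intro: exI[of _ UNIV])

lemma smooth_at_ident: "smooth_at (\<lambda>x. x) x"
  by (intro smooth_at_bounded_linear bounded_linear_ident)

lemma smooth_at_linear:
  fixes L :: "'v::euclidean_space \<Rightarrow> 'w::real_normed_vector"
  shows "linear L \<Longrightarrow> smooth_at L x"
  by (simp add: smooth_at_bounded_linear linear_conv_bounded_linear)

lemma smooth_at_bilinear:
  assumes "bounded_bilinear p" and "smooth_at f x" and "smooth_at g x"
  shows "smooth_at (\<lambda>x. p (f x) (g x)) x"
proof -
  obtain W where W: "open W" "x \<in> W" "smooth_on W f"
    using assms(2) by (auto simp: smooth_at_def)
  obtain V where V: "open V" "x \<in> V" "smooth_on V g"
    using assms(3) by (auto simp: smooth_at_def)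
  have "smooth_on (W \<inter> V) (\<lambda>x. p (f x) (g x))"
    using W V unfolding smooth_on_def
    by (intro allI Ck_on_bilinear[OF assms(1)]) (auto intro: Ck_on_subset)
  then show ?thesis
    using W V by (auto simp: smooth_at_def intro!: exI[of _ "W \<inter> V"])
qed

lemma smooth_at_add:
  assumes "smooth_at f x" and "smooth_at g x"
  shows "smooth_at (\<lambda>x. f x + g x) x"
proof -
  obtain W where W: "open W" "x \<in> W" "smooth_on W f"
    using assms(1) by (auto simp: smooth_at_def)
  obtain V where V: "open V" "x \<in> V" "smooth_on V g"
    using assms(2) by (auto simp: smooth_at_def)
  have "smooth_on (W \<inter> V) (\<lambda>x. f x + g x)"
    using W V unfolding smooth_on_def
    by (intro allI Ck_on_add) (auto intro: Ck_on_subset)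
  then show ?thesis
    using W V by (auto simp: smooth_at_def intro!: exI[of _ "W \<inter> V"])
qed

lemma smooth_at_compose:
  fixes f :: "'u::real_normed_vector \<Rightarrow> 'v::euclidean_space" and g :: "'v \<Rightarrow> 'w::real_normed_vector"
  assumes "smooth_at f x" and "smooth_at g (f x)"
  shows "smooth_at (\<lambda>x. g (f x)) x"
proof -
  obtain W where W: "open W" "x \<in> W" "smooth_on W f"
    using assms(1) by (auto simp: smooth_at_def)
  obtain V where V: "open V" "f x \<in> V" "smooth_on V g"
    using assms(2) by (auto simp: smooth_at_def)
  have "continuous_on W f"
    using W(3) by (auto simp: smooth_on_def dest: spec[of _ 0])
  then have op: "open (W \<inter> f -` V)"
    using W(1) V(1) continuous_on_open_vimage by (metis Int_commute)
  have "smooth_on (W \<inter> f -` V) (\<lambda>x. g (f x))"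
    unfolding smooth_on_def
  proof
    fix k
    show "Ck_on k (W \<inter> f -` V) (\<lambda>x. g (f x))"
      by (rule Ck_on_compose[OF op V(1)])
        (use W(3) V(3) in \<open>auto simp: smooth_on_def intro: Ck_on_subset\<close>)
  qed
  then show ?thesis
    using W V op by (auto simp: smooth_at_def intro!: exI[of _ "W \<inter> f -` V"])
qed

lemma smooth_at_scaleR:
  "smooth_at f x \<Longrightarrow> smooth_at g x \<Longrightarrow> smooth_at (\<lambda>x. f x *\<^sub>R g x) x"
  by (rule smooth_at_bilinear[OF bounded_bilinear_scaleR])

lemma smooth_at_mult:
  fixes f :: "'u::real_normed_vector \<Rightarrow> real"
  shows "smooth_at f x \<Longrightarrow> smooth_at g x \<Longrightarrow> smooth_at (\<lambda>x. f x * g x) x"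
  by (rule smooth_at_bilinear[OF bounded_bilinear_mult])

lemma smooth_at_uminus:
  fixes f :: "'u::real_normed_vector \<Rightarrow> 'w::real_normed_vector"
  assumes "smooth_at f x"
  shows "smooth_at (\<lambda>x. - f x) x"
  using smooth_at_scaleR[OF smooth_at_const[of "-1"] assms] by simp

lemma smooth_at_diff:
  "smooth_at f x \<Longrightarrow> smooth_at g x \<Longrightarrow> smooth_at (\<lambda>x. f x - g x) x"
  using smooth_at_add[OF _ smooth_at_uminus, of f x g] by simp

lemma smooth_at_sum:
  "(\<And>i. i \<in> I \<Longrightarrow> smooth_at (f i) x) \<Longrightarrow> smooth_at (\<lambda>x. \<Sum>i\<in>I. f i x) x"
  by (induction I rule: infinite_finite_induct) (auto intro: smooth_at_const smooth_at_add)

lemma smooth_at_linear_compose: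
  fixes L :: "'v::euclidean_space \<Rightarrow> 'w::real_normed_vector"
    and f :: "'u::real_normed_vector \<Rightarrow> 'v"
  shows "linear L \<Longrightarrow> smooth_at f x \<Longrightarrow> smooth_at (\<lambda>x. L (f x)) x"
  by (intro smooth_at_compose[of f x L] smooth_at_linear)

lemma smooth_at_Pair:
  fixes f :: "'u::real_normed_vector \<Rightarrow> 'v::euclidean_space" and g :: "'u \<Rightarrow> 'w::euclidean_space"
  assumes "smooth_at f x" and "smooth_at g x"
  shows "smooth_at (\<lambda>x. (f x, g x)) x"
proof -
  have "smooth_at (\<lambda>x. (f x, 0::'w) + (0::'v, g x)) x"
    using assms
    by (intro smooth_at_add smooth_at_linear_compose[of "\<lambda>a. (a, 0::'w)"]
        smooth_at_linear_compose[of "\<lambda>a. (0::'v, a)"]) (auto intro!: linearI)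
  then show ?thesis
    by simp
qed

lemma smooth_at_vec_lambda:
  fixes f :: "'i::finite \<Rightarrow> 'u::real_normed_vector \<Rightarrow> 'v::euclidean_space"
  assumes "\<And>i. smooth_at (f i) x"
  shows "smooth_at (\<lambda>x. \<chi> i. f i x) x"
proof -
  have "smooth_at (\<lambda>x. \<Sum>i\<in>UNIV. axis i (f i x)) x"
    by (intro smooth_at_sum smooth_at_linear_compose[OF _ assms])
      (auto intro!: linearI simp: vec_eq_iff axis_def)
  moreover have "(\<Sum>i\<in>UNIV. axis i (f i x)) = (\<chi> i. f i x)" for x
    by (simp add: vec_eq_iff axis_def if_distrib sum.delta cong: if_cong)
  ultimately show ?thesis
    by simp
qed

lemma smooth_at_frechet_derivative:
  "smooth_at f x \<Longrightarrow> smooth_at (\<lambda>y. frechet_derivative f (at y) v) x"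
  unfolding smooth_at_def smooth_on_def by (fastforce dest: spec[of _ "Suc _"])

text \<open>Base point and direction both move, so the direction is expanded over
  \<open>Basis\<close>. The expansion is valid where \<open>f\<close> is differentiable at
  \<open>g y\<close>, which holds for \<open>y\<close> near \<open>x\<close> because
  \<open>g\<close> is continuous at \<open>x\<close>.\<close>

lemma smooth_at_frechet_derivative_compose:
  fixes f :: "'v::euclidean_space \<Rightarrow> 'w::real_normed_vector" and g a :: "'u::real_normed_vector \<Rightarrow> 'v"
  assumes "smooth_at f (g x)" and "smooth_at g x" and "smooth_at a x"
  shows "smooth_at (\<lambda>y. frechet_derivative f (at (g y)) (a y)) x"
proof -
  have "smooth_at (\<lambda>y. \<Sum>b\<in>Basis. (a y \<bullet> b) *\<^sub>R frechet_derivative f (at (g y)) b) x"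
    by (intro smooth_at_sum smooth_at_scaleR
        smooth_at_linear_compose[OF _ assms(3), of "\<lambda>a. a \<bullet> _"]
        smooth_at_compose[OF assms(2) smooth_at_frechet_derivative[OF assms(1)]])
      (auto intro!: linearI simp: inner_add_left)
  moreover have "eventually (\<lambda>y. smooth_at f (g y)) (nhds x)"
    using smooth_at_continuous[OF assms(2)] smooth_at_eventually[OF assms(1)]
    unfolding continuous_at tendsto_at_iff_tendsto_nhds
    by (rule eventually_compose_filterlim[rotated])
  then have "eventually (\<lambda>y. (\<Sum>b\<in>Basis. (a y \<bullet> b) *\<^sub>R frechet_derivative f (at (g y)) b) =
      frechet_derivative f (at (g y)) (a y)) (nhds x)"
    by eventually_elim
      (metis (no_types, lifting) frechet_derivative_expand smooth_at_differentiable sum.cong)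
  ultimately show ?thesis
    by (rule smooth_at_cong[rotated])
qed

section \<open>Symmetry of second derivatives\<close>

lemma smooth_at_DERIV_line:
  fixes f :: "'v::real_normed_vector \<Rightarrow> real"
  assumes "smooth_at f (p + s *\<^sub>R a)"
  shows "DERIV (\<lambda>s. f (p + s *\<^sub>R a)) s :> frechet_derivative f (at (p + s *\<^sub>R a)) a"
proof -
  have "((\<lambda>s. p + s *\<^sub>R a) has_derivative (\<lambda>t. t *\<^sub>R a)) (at s)"
    by (auto intro!: derivative_eq_intros)
  from has_derivative_compose[OF this smooth_at_has_derivative[OF assms]]
  have "((\<lambda>s. f (p + s *\<^sub>R a)) has_derivative
      (\<lambda>t. frechet_derivative f (at (p + s *\<^sub>R a)) (t *\<^sub>R a))) (at s)" .
  moreover have "frechet_derivative f (at (p + s *\<^sub>R a)) (t *\<^sub>R a) =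
      frechet_derivative f (at (p + s *\<^sub>R a)) a * t" for t
    using linear_cmul[OF smooth_at_linear_frechet[OF assms]] by simp
  ultimately show ?thesis
    by (simp add: has_field_derivative_def)
qed

text \<open>The second difference is the change of \<open>F\<close>, the increment in direction
  \<open>b\<close>, along direction \<open>a\<close>. The mean value theorem for \<open>F\<close>
  and then for \<open>g\<close> along \<open>b\<close> produces the mixed derivative at an
  intermediate point; the norm bound allows that point to be driven to \<open>x\<close>.\<close>

lemma second_difference_mean_value:
  fixes f :: "'v::real_normed_vector \<Rightarrow> real"
  assumes f: "\<And>y. y \<in> ball x r \<Longrightarrow> smooth_at f y"
    and h: "0 < h" "h * (norm a + norm b) < r"
  obtains y where "norm (y - x) \<le> h * (norm a + norm b)"
    and "f (x + h *\<^sub>R a + h *\<^sub>R b) - f (x + h *\<^sub>R a) - f (x + h *\<^sub>R b) + f x =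
      h * h * frechet_derivative (\<lambda>y. frechet_derivative f (at y) a) (at y) b"
proof -
  have nb: "norm (s *\<^sub>R a + t *\<^sub>R b) \<le> h * (norm a + norm b)"
    if "0 \<le> s" "s \<le> h" "0 \<le> t" "t \<le> h" for s t
  proof -
    have "norm (s *\<^sub>R a + t *\<^sub>R b) \<le> s * norm a + t * norm b"
      using norm_triangle_ineq[of "s *\<^sub>R a" "t *\<^sub>R b"] that by simp
    also have "\<dots> \<le> h * norm a + h * norm b"
      using that by (intro add_mono mult_right_mono) auto
    finally show ?thesis
      by (simp add: distrib_left)
  qed
  have inb: "smooth_at f (x + s *\<^sub>R a + t *\<^sub>R b)"
    if "0 \<le> s" "s \<le> h" "0 \<le> t" "t \<le> h" for s t
  proof -
    have "dist x (x + s *\<^sub>R a + t *\<^sub>R b) = norm (s *\<^sub>R a + t *\<^sub>R b)"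
      by (metis add.assoc add_diff_cancel_left' dist_commute dist_norm)
    then show ?thesis
      using nb[OF that] h(2) by (intro f) auto
  qed
  define F where "F s = f (x + h *\<^sub>R b + s *\<^sub>R a) - f (x + s *\<^sub>R a)" for s
  define g where "g y = frechet_derivative f (at y) a" for y
  have dF: "DERIV F s :> g (x + h *\<^sub>R b + s *\<^sub>R a) - g (x + s *\<^sub>R a)" if "0 \<le> s" "s \<le> h" for s
    unfolding F_def g_def using inb[of s h] inb[of s 0] that h(1)
    by (intro DERIV_diff smooth_at_DERIV_line) (auto simp: ac_simps)
  obtain s where s: "0 < s" "s < h"
    "F h - F 0 = (h - 0) * (g (x + h *\<^sub>R b + s *\<^sub>R a) - g (x + s *\<^sub>R a))"
    using MVT2[OF h(1), of F "\<lambda>s. g (x + h *\<^sub>R b + s *\<^sub>R a) - g (x + s *\<^sub>R a)"] dF by auto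
  have "DERIV (\<lambda>t. g (x + s *\<^sub>R a + t *\<^sub>R b)) t :> frechet_derivative g (at (x + s *\<^sub>R a + t *\<^sub>R b)) b"
    if "0 \<le> t" "t \<le> h" for t
    unfolding g_def using inb[of s t] that s
    by (intro smooth_at_DERIV_line smooth_at_frechet_derivative) auto
  then obtain t where t: "0 < t" "t < h"
    "g (x + s *\<^sub>R a + h *\<^sub>R b) - g (x + s *\<^sub>R a + 0 *\<^sub>R b) =
      (h - 0) * frechet_derivative g (at (x + s *\<^sub>R a + t *\<^sub>R b)) b"
    using MVT2[OF h(1), of "\<lambda>t. g (x + s *\<^sub>R a + t *\<^sub>R b)"
        "\<lambda>t. frechet_derivative g (at (x + s *\<^sub>R a + t *\<^sub>R b)) b"] by auto
  show ?thesis
  proof (rule that)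
    show "norm (x + s *\<^sub>R a + t *\<^sub>R b - x) \<le> h * (norm a + norm b)"
      using nb[of s t] s t by (simp add: add.assoc)
    have "f (x + h *\<^sub>R a + h *\<^sub>R b) - f (x + h *\<^sub>R a) - f (x + h *\<^sub>R b) + f x = F h - F 0"
      by (simp add: F_def ac_simps)
    also have "\<dots> = h * (h * frechet_derivative g (at (x + s *\<^sub>R a + t *\<^sub>R b)) b)"
      using s(3) t(3) by (simp add: ac_simps)
    finally show "f (x + h *\<^sub>R a + h *\<^sub>R b) - f (x + h *\<^sub>R a) - f (x + h *\<^sub>R b) + f x =
      h * h * frechet_derivative (\<lambda>y. frechet_derivative f (at y) a) (at (x + s *\<^sub>R a + t *\<^sub>R b)) b"
      by (simp add: g_def[abs_def] mult.assoc)
  qed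
qed

text \<open>The second difference is symmetric in \<open>a\<close> and \<open>b\<close>, so one
  mixed derivative at some point near \<open>x\<close> equals the other at a possibly different
  point near \<open>x\<close>; continuity of both carries the equality to \<open>x\<close>.\<close>

lemma smooth_at_second_derivative_symmetric:
  fixes f :: "'v::real_normed_vector \<Rightarrow> real"
  assumes "smooth_at f x"
  shows "frechet_derivative (\<lambda>y. frechet_derivative f (at y) a) (at x) b =
    frechet_derivative (\<lambda>y. frechet_derivative f (at y) b) (at x) a"
proof -
  define H where "H a b y = frechet_derivative (\<lambda>y. frechet_derivative f (at y) a) (at y) b" for a b y
  have cont: "isCont (H a b) x" for a b
    unfolding H_def
    by (intro smooth_at_continuous smooth_at_frechet_derivative assms)
  obtain r where r: "r > 0" "\<And>y. y \<in> ball x r \<Longrightarrow> smooth_at f y"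
    using smooth_at_eventually[OF assms] by (auto simp: eventually_nhds_metric dist_commute)
  have "\<bar>H a b x - H b a x\<bar> \<le> e" if "e > 0" for e
  proof -
    have "e / 2 > 0"
      using that by simp
    then obtain d1 d2 where d: "d1 > 0" "d2 > 0"
      "\<And>y. dist y x < d1 \<Longrightarrow> dist (H a b y) (H a b x) < e / 2"
      "\<And>y. dist y x < d2 \<Longrightarrow> dist (H b a y) (H b a x) < e / 2"
      using cont[of a b] cont[of b a] unfolding continuous_at_eps_delta by metis
    define m where "m = min r (min d1 d2)"
    \<comment> \<open>The added \<open>1\<close> keeps \<open>h\<close> positive even for
      \<open>a = b = 0\<close> and makes \<open>h * (norm a + norm b)\<close> strictly smaller than
      \<open>m\<close>.\<close>
    define h where "h = m / (norm a + norm b + 1)"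
    have m: "m > 0" "m \<le> r" "m \<le> d1" "m \<le> d2"
      using r d by (auto simp: m_def)
    have h: "h > 0" "h * (norm a + norm b) < m"
      using m by (auto simp: h_def divide_simps add_pos_nonneg add_nonneg_pos)
    have hr: "h * (norm a + norm b) < r" "h * (norm b + norm a) < r"
      using h m by (auto simp: add.commute)
    obtain y where y: "norm (y - x) \<le> h * (norm a + norm b)"
      "f (x + h *\<^sub>R a + h *\<^sub>R b) - f (x + h *\<^sub>R a) - f (x + h *\<^sub>R b) + f x = h * h * H a b y"
      unfolding H_def by (rule second_difference_mean_value[OF r(2) h(1) hr(1)])
    obtain z where z: "norm (z - x) \<le> h * (norm b + norm a)"
      "f (x + h *\<^sub>R b + h *\<^sub>R a) - f (x + h *\<^sub>R b) - f (x + h *\<^sub>R a) + f x = h * h * H b a z"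
      unfolding H_def by (rule second_difference_mean_value[OF r(2) h(1) hr(2)])
    have "x + h *\<^sub>R b + h *\<^sub>R a = x + h *\<^sub>R a + h *\<^sub>R b"
      by simp
    then have "h * h * H a b y = h * h * H b a z"
      using y(2) z(2) by (simp only:)
    then have "H a b y = H b a z"
      using h(1) by simp
    moreover have "dist y x < d1" "dist z x < d2"
      using y(1) z(1) h m by (auto simp: dist_norm add.commute)
    then have "dist (H a b y) (H a b x) < e / 2" "dist (H b a z) (H b a x) < e / 2"
      using d(3)[of y] d(4)[of z] by blast+
    ultimately show ?thesis
      unfolding dist_real_def by linarith
  qed
  then have "\<bar>H a b x - H b a x\<bar> \<le> 0"
    by (rule field_le_epsilon[of _ 0, simplified]) simp
  then show ?thesis
    by (simp add: H_def)
qed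

section \<open>Smooth cut-off functions\<close>

definition poly_exp :: "real poly \<Rightarrow> real \<Rightarrow> real" where
  "poly_exp p t = (if t > 0 then poly p (inverse t) * exp (- inverse t) else 0)"

lemma poly_div_exp_tendsto_0: "((\<lambda>u::real. poly q u / exp u) \<longlongrightarrow> 0) at_top"
proof -
  have "((\<lambda>u. \<Sum>i\<le>degree q. coeff q i * (u ^ i / exp u)) \<longlongrightarrow> (\<Sum>i\<le>degree q. coeff q i * 0)) at_top"
    by (intro tendsto_intros tendsto_power_div_exp_0)
  then show ?thesis
    by (simp add: poly_altdef sum_divide_distrib)
qed

text \<open>With u = 1/t the derivative of p(u) exp(-u) in t is u^2 (p(u) - p'(u)) exp(-u), and
  \<open>[:0, 0, 1:]\<close> is the polynomial u^2. At 0 the exponential beats every polynomial in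
  u.\<close>

lemma poly_exp_DERIV:
  "DERIV (poly_exp p) t :> poly_exp ([:0, 0, 1:] * (p - pderiv p)) t"
proof -
  consider "t > 0" | "t < 0" | "t = 0"
    by linarith
  then show ?thesis
  proof cases
    case 1
    have "DERIV (\<lambda>t. poly p (inverse t) * exp (- inverse t)) t :>
        poly_exp ([:0, 0, 1:] * (p - pderiv p)) t"
      using 1 by (auto intro!: derivative_eq_intros DERIV_chain2[OF poly_DERIV]
          simp: poly_exp_def algebra_simps power2_eq_square)
    then show ?thesis
      by (rule has_field_derivative_transform_within_open[of _ _ _ "{0<..}"])
        (use 1 in \<open>auto simp: poly_exp_def\<close>)
  next
    case 2
    have "DERIV (\<lambda>t. 0) t :> poly_exp ([:0, 0, 1:] * (p - pderiv p)) t"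
      using 2 by (auto simp: poly_exp_def)
    then show ?thesis
      by (rule has_field_derivative_transform_within_open[of _ _ _ "{..<0}"])
        (use 2 in \<open>auto simp: poly_exp_def\<close>)
  next
    case 3
    \<comment> \<open>With u = 1/h the difference quotient from the right is u p(u) / exp u, hence
      the factor \<open>[:0, 1:]\<close>.\<close>
    have "((\<lambda>h. poly ([:0, 1:] * p) (inverse h) / exp (inverse h)) \<longlongrightarrow> 0) (at_right (0::real))"
      by (rule filterlim_compose[OF poly_div_exp_tendsto_0 filterlim_inverse_at_top_right])
    then have r: "((\<lambda>h. (poly_exp p (0 + h) - poly_exp p 0) / h) \<longlongrightarrow> 0) (at_right 0)"
      by (rule Lim_transform_eventually)
        (auto simp: poly_exp_def eventually_at_filter exp_minus field_simps)
    have l: "((\<lambda>h. (poly_exp p (0 + h) - poly_exp p 0) / h) \<longlongrightarrow> 0) (at_left 0)"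
      by (rule Lim_transform_eventually[OF tendsto_const])
        (auto simp: poly_exp_def eventually_at_filter)
    show ?thesis
      using filterlim_split_at[OF l r] 3 by (simp add: DERIV_def poly_exp_def)
  qed
qed

text \<open>The function of interest is exp(-1/t), that is \<open>p = 1\<close>, but only the family
  over all polynomials is closed under differentiation and so supports the induction.\<close>

lemma smooth_at_poly_exp: "smooth_at (poly_exp p) x"
proof -
  have "Ck_on k UNIV (poly_exp p)" for k
  proof (induction k arbitrary: p)
    case 0
    then show ?case
      using poly_exp_DERIV[of p] by (auto intro!: DERIV_isCont continuous_at_imp_continuous_on)
  next
    case (Suc k)
    let ?q = "[:0, 0, 1:] * (p - pderiv p)"
    have "Ck_on k UNIV (\<lambda>t. poly_exp ?q t * v)" for v
      by (rule Ck_on_bounded_linear_compose[OF bounded_linear_mult_left open_UNIV Suc.IH])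
    then show ?case
      using poly_exp_DERIV[of p] unfolding has_field_derivative_def
      by (intro Ck_on_SucI[where f' = "\<lambda>t v. poly_exp ?q t * v"]) auto
  qed
  then show ?thesis
    by (auto simp: smooth_at_def smooth_on_def intro!: exI[of _ UNIV])
qed

text \<open>A nested form of the usual step. Write phi for \<open>poly_exp 1\<close>. The inner
  phi(s - 1) vanishes for s \<le> 1 and is at least phi(1) for s \<ge> 2, so the outer argument is 1
  in the first case and nonpositive in the second. The only divisor is the constant phi(1), so no
  smoothness of a reciprocal is involved.\<close>

definition smooth_step :: "real \<Rightarrow> real" where
  "smooth_step s = poly_exp 1 (1 - poly_exp 1 (s - 1) / poly_exp 1 1) / poly_exp 1 1"

lemma smooth_step_eq_1: "s \<le> 1 \<Longrightarrow> smooth_step s = 1"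
  by (simp add: smooth_step_def poly_exp_def)

lemma smooth_step_eq_0:
  assumes "s \<ge> 2"
  shows "smooth_step s = 0"
proof -
  have "inverse (s - 1) \<le> 1"
    using assms by (simp add: field_simps)
  then have "poly_exp 1 1 \<le> poly_exp 1 (s - 1)"
    using assms by (simp add: poly_exp_def)
  moreover have "poly_exp 1 1 > 0"
    by (simp add: poly_exp_def)
  ultimately show ?thesis
    by (simp add: smooth_step_def poly_exp_def[of 1 "1 - _"])
qed

lemma smooth_at_smooth_step: "smooth_at smooth_step s"
  unfolding smooth_step_def divide_inverse
  by (intro smooth_at_mult smooth_at_const smooth_at_diff smooth_at_ident
      smooth_at_compose[OF _ smooth_at_poly_exp])

lemma smooth_bump_euclidean:
  fixes x :: "'v::euclidean_space"
  assumes "r > 0"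
  obtains \<rho> :: "'v \<Rightarrow> real" where "\<And>y. smooth_at \<rho> y"
    and "\<And>y. y \<in> ball x r \<Longrightarrow> \<rho> y = 1" and "\<And>y. y \<notin> cball x (2 * r) \<Longrightarrow> \<rho> y = 0"
proof (rule that)
  \<comment> \<open>The squared distance, unlike the norm, is smooth at the centre as well. Off the
    larger ball its scaled value is at least 4, beyond the threshold 2 of
    \<open>smooth_step\<close>.\<close>
  let ?s = "\<lambda>y. ((y - x) \<bullet> (y - x)) * inverse (r\<^sup>2)"
  have s: "?s y = (dist x y / r)\<^sup>2" for y
    by (simp add: dist_norm norm_minus_commute power_divide divide_inverse power_inverse
        power_mult_distrib dot_square_norm)
  show "smooth_at (\<lambda>y. smooth_step (?s y)) y" for y
    by (intro smooth_at_compose[OF _ smooth_at_smooth_step] smooth_at_mult smooth_at_const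
        smooth_at_bilinear[OF bounded_bilinear_inner] smooth_at_diff smooth_at_ident)
  show "smooth_step (?s y) = 1" if "y \<in> ball x r" for y
  proof (rule smooth_step_eq_1)
    have "dist x y / r \<le> 1"
      using that assms by (simp add: field_simps)
    then show "?s y \<le> 1"
      unfolding s using assms by (simp add: power_le_one)
  qed
  show "smooth_step (?s y) = 0" if "y \<notin> cball x (2 * r)" for y
  proof (rule smooth_step_eq_0)
    have "2 \<le> dist x y / r"
      using that assms by (simp add: field_simps)
    then have "2\<^sup>2 \<le> (dist x y / r)\<^sup>2"
      by (rule power_mono) simp
    then show "2 \<le> ?s y"
      unfolding s by simp
  qed
qed

section \<open>Charts, tangent vectors and vector fields\<close>

text \<open>The Hausdorff condition is kept apart: the jet atlas is first recognised as a
  \<open>smooth_atlas\<close>, and the description of the topology gained in this way is what its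
  Hausdorff proof uses.\<close>

locale smooth_atlas =
  fixes A :: "('m, 'v::euclidean_space) chart set"
  assumes chart_inj: "c \<in> A \<Longrightarrow> inj_on (snd c) (fst c)"
    and open_chart_image: "c \<in> A \<Longrightarrow> open (snd c ` fst c)"
    and open_overlap: "c \<in> A \<Longrightarrow> c' \<in> A \<Longrightarrow> open (snd c ` (fst c \<inter> fst c'))"
    and smooth_transition: "c \<in> A \<Longrightarrow> c' \<in> A \<Longrightarrow> x \<in> fst c \<Longrightarrow> x \<in> fst c' \<Longrightarrow>
      smooth_at (snd c' \<circ> chart_inv c) (snd c x)"
begin

lemma chart_inv_chart [simp]: "c \<in> A \<Longrightarrow> x \<in> fst c \<Longrightarrow> chart_inv c (snd c x) = x"
  by (simp add: chart_inv_def chart_inj)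

lemma eventually_overlap:
  assumes "c \<in> A" "c' \<in> A" "x \<in> fst c" "x \<in> fst c'"
  shows "eventually (\<lambda>u. chart_inv c u \<in> fst c \<and> chart_inv c u \<in> fst c' \<and>
    snd c (chart_inv c u) = u) (nhds (snd c x))"
proof -
  have "eventually (\<lambda>u. u \<in> snd c ` (fst c \<inter> fst c')) (nhds (snd c x))"
    using assms by (intro eventually_nhds_in_open open_overlap) auto
  then show ?thesis
    by eventually_elim (use assms in auto)
qed

lemma eventually_chart:
  assumes "c \<in> A" "x \<in> fst c"
  shows "eventually (\<lambda>u. chart_inv c u \<in> fst c \<and> snd c (chart_inv c u) = u) (nhds (snd c x))"
  using eventually_overlap[OF assms(1) assms(1) assms(2) assms(2)] by (auto elim: eventually_mono)

text \<open>Validity near a point does not depend on the chart, because transition maps are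
  continuous.\<close>

lemma eventually_change_chart:
  assumes "c \<in> A" "c' \<in> A" "x \<in> fst c" "x \<in> fst c'"
    and "eventually (\<lambda>u. P (chart_inv c u)) (nhds (snd c x))"
  shows "eventually (\<lambda>u. P (chart_inv c' u)) (nhds (snd c' x))"
proof -
  have "isCont (snd c \<circ> chart_inv c') (snd c' x)"
    using assms by (intro smooth_at_continuous smooth_transition)
  moreover have "(snd c \<circ> chart_inv c') (snd c' x) = snd c x"
    using assms by simp
  ultimately have "filterlim (snd c \<circ> chart_inv c') (nhds (snd c x)) (nhds (snd c' x))"
    unfolding continuous_at tendsto_at_iff_tendsto_nhds by simp
  from eventually_compose_filterlim[OF assms(5) this]
  have "eventually (\<lambda>u. P (chart_inv c ((snd c \<circ> chart_inv c') u))) (nhds (snd c' x))" .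
  then show ?thesis
    using eventually_overlap[OF assms(2,1,4,3)] by eventually_elim (use assms in auto)
qed

section \<open>The manifold topology in charts\<close>

lemma openin_manifold_topology:
  "openin (manifold_topology A) W \<longleftrightarrow> W \<subseteq> carrier A \<and> (\<forall>c\<in>A. open (snd c ` (W \<inter> fst c)))"
proof -
  have "istopology (\<lambda>W. W \<subseteq> carrier A \<and> (\<forall>c\<in>A. open (snd c ` (W \<inter> fst c))))"
    unfolding istopology_def
  proof (intro conjI allI impI ballI)
    fix V W c
    assume V: "V \<subseteq> carrier A \<and> (\<forall>c\<in>A. open (snd c ` (V \<inter> fst c)))"
      and W: "W \<subseteq> carrier A \<and> (\<forall>c\<in>A. open (snd c ` (W \<inter> fst c)))"
      and c: "c \<in> A"
    have "snd c ` (V \<inter> W \<inter> fst c) = snd c ` (V \<inter> fst c) \<inter> snd c ` (W \<inter> fst c)"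
      using chart_inj[OF c] by (auto simp: inj_on_def)
    then show "open (snd c ` (V \<inter> W \<inter> fst c))"
      using V W c by auto
  next
    fix \<W> c
    assume W: "\<forall>W\<in>\<W>. W \<subseteq> carrier A \<and> (\<forall>c\<in>A. open (snd c ` (W \<inter> fst c)))" and c: "c \<in> A"
    have "snd c ` (\<Union> \<W> \<inter> fst c) = (\<Union>W\<in>\<W>. snd c ` (W \<inter> fst c))"
      by auto
    then show "open (snd c ` (\<Union> \<W> \<inter> fst c))"
      using W c by auto
  qed auto
  then show ?thesis
    by (simp add: manifold_topology_def)
qed

lemma topspace_manifold_topology: "topspace (manifold_topology A) = carrier A"
proof -
  have "openin (manifold_topology A) (carrier A)"
    unfolding openin_manifold_topology
  proof (intro conjI ballI)
    fix c assume c: "c \<in> A"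
    then have "carrier A \<inter> fst c = fst c"
      by (auto simp: carrier_def)
    then show "open (snd c ` (carrier A \<inter> fst c))"
      using open_chart_image[OF c] by simp
  qed auto
  then show ?thesis
    unfolding topspace_def by (auto simp: openin_manifold_topology)
qed

lemma openin_imp_eventually:
  assumes "openin (manifold_topology A) W" and "c \<in> A" "x \<in> fst c" "x \<in> W"
  shows "eventually (\<lambda>u. chart_inv c u \<in> W) (nhds (snd c x))"
proof -
  have "eventually (\<lambda>u. u \<in> snd c ` (W \<inter> fst c)) (nhds (snd c x))"
    using assms by (intro eventually_nhds_in_open) (auto simp: openin_manifold_topology)
  then show ?thesis
    by eventually_elim (use assms in auto)
qed

text \<open>Around each point one chart of choice is enough, since
  \<open>eventually_change_chart\<close> transfers the neighbourhood to all others.\<close>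

lemma openin_manifold_topologyI:
  assumes "W \<subseteq> carrier A"
    and "\<And>x. x \<in> W \<Longrightarrow> \<exists>c\<in>A. x \<in> fst c \<and> eventually (\<lambda>u. chart_inv c u \<in> W) (nhds (snd c x))"
  shows "openin (manifold_topology A) W"
  unfolding openin_manifold_topology
proof (intro conjI ballI assms(1))
  fix c assume c: "c \<in> A"
  show "open (snd c ` (W \<inter> fst c))"
    unfolding open_subopen[of "snd c ` _"]
  proof
    fix v assume "v \<in> snd c ` (W \<inter> fst c)"
    then obtain x where x: "x \<in> W" "x \<in> fst c" "v = snd c x"
      by auto
    obtain c' where c': "c' \<in> A" "x \<in> fst c'" "eventually (\<lambda>u. chart_inv c' u \<in> W) (nhds (snd c' x))"
      using assms(2)[OF x(1)] by auto
    have "eventually (\<lambda>u. chart_inv c u \<in> W) (nhds (snd c x))"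
      by (rule eventually_change_chart[OF c'(1) c c'(2) x(2) c'(3)])
    with eventually_chart[OF c x(2)]
    have "eventually (\<lambda>u. u \<in> snd c ` (W \<inter> fst c)) (nhds (snd c x))"
      by eventually_elim (auto intro: image_eqI[OF sym])
    then show "\<exists>T. open T \<and> v \<in> T \<and> T \<subseteq> snd c ` (W \<inter> fst c)"
      by (auto simp: eventually_nhds x(3))
  qed
qed

lemma agree_near_imp_eventually:
  "agree_near A x X Y \<Longrightarrow> c \<in> A \<Longrightarrow> x \<in> fst c \<Longrightarrow>
    eventually (\<lambda>u. X (chart_inv c u) = Y (chart_inv c u)) (nhds (snd c x))"
  unfolding agree_near_def by (metis (mono_tags, lifting) eventually_mono openin_imp_eventually)

lemma eventually_imp_agree_near:
  assumes "c \<in> A" "x \<in> fst c"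
    and "eventually (\<lambda>u. X (chart_inv c u) = Y (chart_inv c u)) (nhds (snd c x))"
  shows "agree_near A x X Y"
proof -
  \<comment> \<open>Agreement is known only near \<open>snd c x\<close>. The points around which it
    persists form an open set by \<open>eventually_eventually\<close>, and this set can serve as the
    witness.\<close>
  define W where "W = {y \<in> fst c. eventually (\<lambda>u. X (chart_inv c u) = Y (chart_inv c u)) (nhds (snd c y))}"
  have W: "y \<in> fst c \<and> X y = Y y" if "y \<in> W" for y
    using that eventually_nhds_x_imp_x assms(1) unfolding W_def by fastforce
  have "openin (manifold_topology A) W"
  proof (rule openin_manifold_topologyI)
    show "W \<subseteq> carrier A"
      using assms(1) by (auto simp: W_def carrier_def)
  next
    fix y assume y: "y \<in> W"
    have "eventually (\<lambda>v. eventually (\<lambda>u. X (chart_inv c u) = Y (chart_inv c u)) (nhds v)) (nhds (snd c y))"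
      using y by (simp add: W_def eventually_eventually)
    moreover have "y \<in> fst c"
      using y by (simp add: W_def)
    ultimately have "eventually (\<lambda>v. chart_inv c v \<in> W) (nhds (snd c y))"
      using eventually_chart[OF assms(1), of y] unfolding W_def
      by (auto elim: eventually_elim2)
    then show "\<exists>c\<in>A. y \<in> fst c \<and> eventually (\<lambda>u. chart_inv c u \<in> W) (nhds (snd c y))"
      using assms(1) \<open>y \<in> fst c\<close> by auto
  qed
  moreover have "x \<in> W"
    using assms by (auto simp: W_def)
  ultimately show ?thesis
    using W by (auto simp: agree_near_def)
qed

lemma smooth_near_iff:
  assumes "c \<in> A" "x \<in> fst c"
  shows "smooth_near A f x \<longleftrightarrow> smooth_at (f \<circ> chart_inv c) (snd c x)"
proof
  assume "smooth_near A f x"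
  then have "\<exists>W. open W \<and> snd c x \<in> W \<and> W \<subseteq> snd c ` fst c \<and> smooth_on W (f \<circ> chart_inv c)"
    using assms by (simp add: smooth_near_def)
  then show "smooth_at (f \<circ> chart_inv c) (snd c x)"
    by (auto simp: smooth_at_def)
next
  assume f: "smooth_at (f \<circ> chart_inv c) (snd c x)"
  have "\<exists>W. open W \<and> snd c' x \<in> W \<and> W \<subseteq> snd c' ` fst c' \<and> smooth_on W (f \<circ> chart_inv c')"
    if c': "c' \<in> A" "x \<in> fst c'" for c'
  proof -
    have "smooth_at (\<lambda>u. (f \<circ> chart_inv c) ((snd c \<circ> chart_inv c') u)) (snd c' x)"
      by (rule smooth_at_compose[OF smooth_transition[OF c'(1) assms(1) c'(2) assms(2)]])
        (use assms c' f in \<open>simp add: o_def\<close>)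
    moreover have "eventually (\<lambda>u. (f \<circ> chart_inv c) ((snd c \<circ> chart_inv c') u) = (f \<circ> chart_inv c') u)
        (nhds (snd c' x))"
      using eventually_overlap[OF c'(1) assms(1) c'(2) assms(2)]
      by eventually_elim (use assms in auto)
    ultimately have "smooth_at (f \<circ> chart_inv c') (snd c' x)"
      by (rule smooth_at_cong[rotated])
    then obtain W where "open W" "snd c' x \<in> W" "smooth_on W (f \<circ> chart_inv c')"
      by (auto simp: smooth_at_def)
    then show ?thesis
      using open_chart_image[OF c'(1)] c'(2)
      by (intro exI[of _ "W \<inter> snd c' ` fst c'"]) (auto intro: smooth_on_subset)
  qed
  then show "smooth_near A f x"
    using assms by (auto simp: smooth_near_def carrier_def)
qed

lemma smooth_near_carrier: "smooth_near A f x \<Longrightarrow> x \<in> carrier A"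
  by (simp add: smooth_near_def)

lemma carrierE:
  assumes "x \<in> carrier A"
  obtains c where "c \<in> A" "x \<in> fst c"
  using assms by (auto simp: carrier_def)

lemma smooth_near_cong:
  assumes "c \<in> A" "x \<in> fst c"
    and "eventually (\<lambda>u. f (chart_inv c u) = g (chart_inv c u)) (nhds (snd c x))"
  shows "smooth_near A f x \<longleftrightarrow> smooth_near A g x"
  unfolding smooth_near_iff[OF assms(1,2)] by (rule smooth_at_cong_iff) (use assms(3) in simp)

lemma smooth_near_eventually:
  assumes "c \<in> A" "x \<in> fst c" and "smooth_near A f x"
  shows "eventually (\<lambda>u. smooth_near A f (chart_inv c u)) (nhds (snd c x))"
  using smooth_at_eventually[OF assms(3)[unfolded smooth_near_iff[OF assms(1,2)]]]
    eventually_chart[OF assms(1,2)]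
  by eventually_elim (use assms(1) in \<open>auto simp: smooth_near_iff\<close>)

lemma smooth_near_const: "x \<in> carrier A \<Longrightarrow> smooth_near A (\<lambda>y. r) x"
  by (elim carrierE) (simp add: smooth_near_iff comp_def smooth_at_const)

lemma smooth_near_add:
  assumes "smooth_near A f x" "smooth_near A g x"
  shows "smooth_near A (\<lambda>y. f y + g y) x"
proof -
  obtain c where "c \<in> A" "x \<in> fst c"
    using carrierE[OF smooth_near_carrier[OF assms(1)]] .
  then show ?thesis
    using assms smooth_at_add[of "f \<circ> chart_inv c" "snd c x" "g \<circ> chart_inv c"]
    by (simp add: smooth_near_iff comp_def)
qed

lemma smooth_near_mult:
  assumes "smooth_near A f x" "smooth_near A g x"
  shows "smooth_near A (\<lambda>y. f y * g y) x"
proof -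
  obtain c where "c \<in> A" "x \<in> fst c"
    using carrierE[OF smooth_near_carrier[OF assms(1)]] .
  then show ?thesis
    using assms smooth_at_mult[of "f \<circ> chart_inv c" "snd c x" "g \<circ> chart_inv c"]
    by (simp add: smooth_near_iff comp_def)
qed

section \<open>Tangent vectors in coordinates\<close>

lemma dir_vec_not_smooth: "\<not> smooth_near A f x \<Longrightarrow> dir_vec A c b x f = 0"
  by (simp add: dir_vec_def)

lemma dir_vec_smooth:
  "smooth_near A f x \<Longrightarrow> dir_vec A c b x f = frechet_derivative (f \<circ> chart_inv c) (at (snd c x)) b"
  by (simp add: dir_vec_def)

lemma linear_dir_vec:
  assumes "c \<in> A" "x \<in> fst c"
  shows "linear (\<lambda>b. dir_vec A c b x f)"
proof (cases "smooth_near A f x")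
  case True
  then show ?thesis
    using smooth_at_linear_frechet[of "f \<circ> chart_inv c" "snd c x"] assms
    by (simp add: dir_vec_smooth smooth_near_iff)
next
  case False
  then show ?thesis
    by (simp add: dir_vec_not_smooth linear_zero)
qed

lemma dir_vec_add:
  assumes "c \<in> A" "x \<in> fst c" and "smooth_near A f x" "smooth_near A g x"
  shows "dir_vec A c b x (\<lambda>y. f y + g y) = dir_vec A c b x f + dir_vec A c b x g"
proof -
  have "((\<lambda>u. (f \<circ> chart_inv c) u + (g \<circ> chart_inv c) u) has_derivative
      (\<lambda>b. frechet_derivative (f \<circ> chart_inv c) (at (snd c x)) b +
        frechet_derivative (g \<circ> chart_inv c) (at (snd c x)) b)) (at (snd c x))"
    using assms by (intro has_derivative_add smooth_at_has_derivative) (simp_all add: smooth_near_iff o_def)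
  from frechet_derivative_eq[OF this] show ?thesis
    using assms smooth_near_add[OF assms(3,4)] by (simp add: dir_vec_smooth comp_def)
qed

lemma dir_vec_mult:
  assumes "c \<in> A" "x \<in> fst c" and "smooth_near A f x" "smooth_near A g x"
  shows "dir_vec A c b x (\<lambda>y. f y * g y) = dir_vec A c b x f * g x + f x * dir_vec A c b x g"
proof -
  have "((\<lambda>u. (f \<circ> chart_inv c) u * (g \<circ> chart_inv c) u) has_derivative
      (\<lambda>b. (f \<circ> chart_inv c) (snd c x) * frechet_derivative (g \<circ> chart_inv c) (at (snd c x)) b +
        frechet_derivative (f \<circ> chart_inv c) (at (snd c x)) b * (g \<circ> chart_inv c) (snd c x)))
      (at (snd c x))"
    using assms by (intro has_derivative_mult smooth_at_has_derivative) (simp_all add: smooth_near_iff o_def)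
  from frechet_derivative_eq[OF this] show ?thesis
    using assms smooth_near_mult[OF assms(3,4)] by (simp add: dir_vec_smooth comp_def)
qed

text \<open>Chain rule for \<open>f\<close> read through the transition map. Both sides send
  functions that are not smooth near \<open>x\<close> to \<open>0\<close>, so the vectors are equal
  as HOL functions.\<close>

lemma dir_vec_change_chart:
  assumes "c \<in> A" "c' \<in> A" "x \<in> fst c" "x \<in> fst c'"
  shows "dir_vec A c b x = dir_vec A c' (frechet_derivative (snd c' \<circ> chart_inv c) (at (snd c x)) b) x"
proof
  fix f
  show "dir_vec A c b x f =
      dir_vec A c' (frechet_derivative (snd c' \<circ> chart_inv c) (at (snd c x)) b) x f"
  proof (cases "smooth_near A f x")
    case True
    have 1: "((snd c' \<circ> chart_inv c) has_derivative
        frechet_derivative (snd c' \<circ> chart_inv c) (at (snd c x))) (at (snd c x))"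
      using assms by (intro smooth_at_has_derivative smooth_transition)
    have "((f \<circ> chart_inv c') has_derivative
        frechet_derivative (f \<circ> chart_inv c') (at (snd c' x))) (at ((snd c' \<circ> chart_inv c) (snd c x)))"
      using True smooth_at_has_derivative[of "f \<circ> chart_inv c'" "snd c' x"] assms(1,3)
        smooth_near_iff[OF assms(2,4)]
      by simp
    from frechet_derivative_eq[OF has_derivative_compose[OF 1 this]]
    have "frechet_derivative (\<lambda>u. (f \<circ> chart_inv c') ((snd c' \<circ> chart_inv c) u)) (at (snd c x)) b =
        frechet_derivative (f \<circ> chart_inv c') (at (snd c' x))
          (frechet_derivative (snd c' \<circ> chart_inv c) (at (snd c x)) b)"
      by simp
    moreover have "frechet_derivative (\<lambda>u. (f \<circ> chart_inv c') ((snd c' \<circ> chart_inv c) u)) (at (snd c x)) =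
        frechet_derivative (f \<circ> chart_inv c) (at (snd c x))"
      by (rule frechet_derivative_cong_eventually, rule eventually_mono[OF eventually_overlap[OF assms]])
        (use assms in auto)
    ultimately show ?thesis
      using True by (simp add: dir_vec_smooth)
  qed (simp add: dir_vec_not_smooth)
qed

lemma tangent_space_eq_range:
  assumes "c \<in> A" "x \<in> fst c"
  shows "tangent_space A x = range (\<lambda>b. dir_vec A c b x)"
proof
  show "tangent_space A x \<subseteq> range (\<lambda>b. dir_vec A c b x)"
    using dir_vec_change_chart[OF _ assms(1) _ assms(2)] by (fastforce simp: tangent_space_def)
  show "range (\<lambda>b. dir_vec A c b x) \<subseteq> tangent_space A x"
    using assms unfolding tangent_space_def by blast
qed

text \<open>Coordinate functions recover the direction of a tangent vector, which makes
  \<open>dir_vec\<close> injective in that direction. Arbitrary values of \<open>snd c\<close> off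
  its domain do not affect the germ.\<close>

lemma smooth_near_coordinate:
  assumes "c \<in> A" "x \<in> fst c"
  shows "smooth_near A (\<lambda>y. snd c y \<bullet> w) x"
    and "dir_vec A c b x (\<lambda>y. snd c y \<bullet> w) = b \<bullet> w"
proof -
  have ev: "eventually (\<lambda>u. u \<bullet> w = ((\<lambda>y. snd c y \<bullet> w) \<circ> chart_inv c) u) (nhds (snd c x))"
    using eventually_chart[OF assms] by eventually_elim auto
  show 1: "smooth_near A (\<lambda>y. snd c y \<bullet> w) x"
    unfolding smooth_near_iff[OF assms]
    by (rule smooth_at_cong[OF ev]) (intro smooth_at_bounded_linear bounded_linear_inner_left)
  have "frechet_derivative (\<lambda>u. u \<bullet> w) (at (snd c x)) = (\<lambda>u. u \<bullet> w)"
    by (intro frechet_derivative_eq bounded_linear_imp_has_derivative bounded_linear_inner_left)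
  then show "dir_vec A c b x (\<lambda>y. snd c y \<bullet> w) = b \<bullet> w"
    using frechet_derivative_cong_eventually[OF ev] by (simp only: dir_vec_smooth[OF 1])
qed

definition components :: "('m, 'v) chart \<Rightarrow> 'm tangent \<Rightarrow> 'v" where
  "components c v = (\<Sum>w\<in>Basis. v (\<lambda>y. snd c y \<bullet> w) *\<^sub>R w)"

lemma components_dir_vec: "c \<in> A \<Longrightarrow> x \<in> fst c \<Longrightarrow> components c (dir_vec A c b x) = b"
  by (simp add: components_def smooth_near_coordinate euclidean_representation)

lemma dir_vec_eq_iff:
  "c \<in> A \<Longrightarrow> x \<in> fst c \<Longrightarrow> dir_vec A c b x = dir_vec A c b' x \<longleftrightarrow> b = b'"
  by (metis components_dir_vec)

lemma dir_vec_components: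
  "c \<in> A \<Longrightarrow> x \<in> fst c \<Longrightarrow> v \<in> tangent_space A x \<Longrightarrow> dir_vec A c (components c v) x = v"
  by (auto simp: tangent_space_eq_range components_dir_vec)

section \<open>Coordinate expressions of vector fields\<close>

definition local_rep :: "('m, 'v) chart \<Rightarrow> 'm \<Rightarrow> 'm field \<Rightarrow> ('v \<Rightarrow> 'v) \<Rightarrow> bool" where
  "local_rep c x X a \<longleftrightarrow> smooth_at a (snd c x) \<and>
    eventually (\<lambda>u. X (chart_inv c u) = dir_vec A c (a u) (chart_inv c u)) (nhds (snd c x))"

lemma local_rep_at:
  "c \<in> A \<Longrightarrow> x \<in> fst c \<Longrightarrow> local_rep c x X a \<Longrightarrow> X x = dir_vec A c (a (snd c x)) x"
  unfolding local_rep_def using eventually_nhds_x_imp_x by fastforce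

lemma local_rep_eventually:
  assumes "c \<in> A" "x \<in> fst c" "local_rep c x X a"
  shows "eventually (\<lambda>u. local_rep c (chart_inv c u) X a) (nhds (snd c x))"
proof -
  have "eventually (\<lambda>v. eventually (\<lambda>u. X (chart_inv c u) = dir_vec A c (a u) (chart_inv c u)) (nhds v))
      (nhds (snd c x))"
    using assms(3) by (simp add: local_rep_def eventually_eventually)
  moreover have "eventually (smooth_at a) (nhds (snd c x))"
    using assms(3) by (auto simp: local_rep_def intro: smooth_at_eventually)
  ultimately show ?thesis
    using eventually_chart[OF assms(1,2)] by eventually_elim (auto simp: local_rep_def)
qed

lemma local_rep_apply:
  assumes "c \<in> A" "x \<in> fst c" "local_rep c x X a" and "smooth_near A f x"
  shows "eventually (\<lambda>u. X (chart_inv c u) f = frechet_derivative (f \<circ> chart_inv c) (at u) (a u))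
      (nhds (snd c x))"
    and "smooth_near A (\<lambda>y. X y f) x"
proof -
  have "eventually (\<lambda>u. X (chart_inv c u) = dir_vec A c (a u) (chart_inv c u)) (nhds (snd c x))"
    using assms(3) by (simp add: local_rep_def)
  then show ev: "eventually (\<lambda>u. X (chart_inv c u) f = frechet_derivative (f \<circ> chart_inv c) (at u) (a u))
      (nhds (snd c x))"
    using eventually_chart[OF assms(1,2)] smooth_near_eventually[OF assms(1,2,4)]
    by eventually_elim (auto simp: dir_vec_smooth)
  have "smooth_at (\<lambda>u. frechet_derivative (f \<circ> chart_inv c) (at u) (a u)) (snd c x)"
    using assms by (intro smooth_at_frechet_derivative_compose smooth_at_ident)
      (auto simp: local_rep_def smooth_near_iff)
  then show "smooth_near A (\<lambda>y. X y f) x"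
    unfolding smooth_near_iff[OF assms(1,2)]
    by (rule smooth_at_cong[rotated]) (use ev in \<open>simp add: eq_commute\<close>)
qed

lemma vector_fieldI:
  assumes "\<And>x. x \<notin> carrier A \<Longrightarrow> X x = (\<lambda>f. 0)"
    and "\<And>x. x \<in> carrier A \<Longrightarrow> \<exists>c\<in>A. x \<in> fst c \<and> (\<exists>a. local_rep c x X a)"
  shows "X \<in> vector_fields A"
  unfolding vector_fields_def
proof (safe)
  fix x assume "x \<in> carrier A"
  then obtain c a where c: "c \<in> A" "x \<in> fst c" "local_rep c x X a"
    using assms(2) by blast
  show "X x \<in> tangent_space A x"
    using local_rep_at[OF c] c unfolding tangent_space_def by blast
next
  fix x f assume f: "smooth_near A f x"
  then obtain c a where c: "c \<in> A" "x \<in> fst c" "local_rep c x X a"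
    using assms(2) smooth_near_carrier by blast
  show "smooth_near A (\<lambda>y. X y f) x"
    by (rule local_rep_apply(2)[OF c f])
qed (simp add: assms(1))

lemma vector_field_off_carrier: "X \<in> vector_fields A \<Longrightarrow> x \<notin> carrier A \<Longrightarrow> X x = (\<lambda>f. 0)"
  by (auto simp: vector_fields_def)

lemma vector_field_smooth: "X \<in> vector_fields A \<Longrightarrow> smooth_near A f x \<Longrightarrow> smooth_near A (\<lambda>y. X y f) x"
  by (auto simp: vector_fields_def)

text \<open>By definition a field maps smooth functions to smooth functions; applied to the
  coordinate functions, this says that its components are smooth.\<close>

lemma vector_field_local_rep:
  assumes "X \<in> vector_fields A" "c \<in> A" "x \<in> fst c"
  shows "local_rep c x X (\<lambda>u. components c (X (chart_inv c u)))"
  unfolding local_rep_def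
proof
  have "smooth_at ((\<lambda>y. X y (\<lambda>z. snd c z \<bullet> w)) \<circ> chart_inv c) (snd c x)" for w
    using assms vector_field_smooth[OF assms(1) smooth_near_coordinate(1)[OF assms(2,3)]]
    by (simp add: smooth_near_iff)
  then show "smooth_at (\<lambda>u. components c (X (chart_inv c u))) (snd c x)"
    unfolding components_def comp_def by (intro smooth_at_sum smooth_at_scaleR smooth_at_const)
  have T: "X y \<in> tangent_space A y" if "y \<in> fst c" for y
    using that assms by (auto simp: vector_fields_def carrier_def)
  show "eventually (\<lambda>u. X (chart_inv c u) =
      dir_vec A c (components c (X (chart_inv c u))) (chart_inv c u)) (nhds (snd c x))"
    using eventually_chart[OF assms(2,3)]
    by eventually_elim (use assms T in \<open>simp add: dir_vec_components\<close>)
qed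

lemma vector_field_tangent:
  assumes "X \<in> vector_fields A" "c \<in> A" "x \<in> fst c"
  obtains b where "X x = dir_vec A c b x"
  using local_rep_at[OF assms(2,3) vector_field_local_rep[OF assms]] by blast

lemma vector_field_not_smooth:
  assumes "X \<in> vector_fields A" "\<not> smooth_near A f x"
  shows "X x f = 0"
proof (cases "x \<in> carrier A")
  case True
  then obtain c where c: "c \<in> A" "x \<in> fst c"
    by (rule carrierE)
  obtain b where "X x = dir_vec A c b x"
    using vector_field_tangent[OF assms(1) c] .
  then show ?thesis
    using dir_vec_not_smooth[OF assms(2)] by simp
qed (simp add: vector_field_off_carrier[OF assms(1)])

lemma vector_field_add:
  assumes "X \<in> vector_fields A" "smooth_near A f x" "smooth_near A g x"
  shows "X x (\<lambda>y. f y + g y) = X x f + X x g"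
proof -
  obtain c where c: "c \<in> A" "x \<in> fst c"
    using carrierE[OF smooth_near_carrier[OF assms(2)]] .
  obtain b where "X x = dir_vec A c b x"
    using vector_field_tangent[OF assms(1) c] .
  then show ?thesis
    using dir_vec_add[OF c assms(2,3)] by simp
qed

lemma vector_field_mult:
  assumes "X \<in> vector_fields A" "smooth_near A f x" "smooth_near A g x"
  shows "X x (\<lambda>y. f y * g y) = X x f * g x + f x * X x g"
proof -
  obtain c where c: "c \<in> A" "x \<in> fst c"
    using carrierE[OF smooth_near_carrier[OF assms(2)]] .
  obtain b where "X x = dir_vec A c b x"
    using vector_field_tangent[OF assms(1) c] .
  then show ?thesis
    using dir_vec_mult[OF c assms(2,3)] by simp
qed

end

locale Hausdorff_atlas = smooth_atlas A for A :: "('m, 'v::euclidean_space) chart set" +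
  assumes Hausdorff: "Hausdorff_space (manifold_topology A)"

lemma smooth_manifold_imp_Hausdorff_atlas: "smooth_manifold A \<Longrightarrow> Hausdorff_atlas A"
proof
  fix c c' x
  assume "smooth_manifold A" "c \<in> A" "c' \<in> A" "x \<in> fst c" "x \<in> fst c'"
  then show "smooth_at (snd c' \<circ> chart_inv c) (snd c x)"
    unfolding smooth_manifold_def smooth_at_def
    by (intro exI[of _ "snd c ` (fst c \<inter> fst c')"]) auto
qed (auto simp: smooth_manifold_def)

text \<open>Product rule for the derivative of \<open>F\<close> paired with the moving direction
  \<open>b\<close>. In the second-order term symmetry exchanges \<open>a\<close> with the basis
  vectors, so that the sum over \<open>Basis\<close> reassembles to a derivative along the fixed
  vector \<open>b x\<close>.\<close>

lemma frechet_derivative_along_field: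
  fixes F :: "'v::euclidean_space \<Rightarrow> real" and b :: "'v \<Rightarrow> 'v"
  assumes "smooth_at F x" and "smooth_at b x"
  shows "frechet_derivative (\<lambda>u. frechet_derivative F (at u) (b u)) (at x) a =
    frechet_derivative F (at x) (frechet_derivative b (at x) a) +
    frechet_derivative (\<lambda>u. frechet_derivative F (at u) a) (at x) (b x)"
proof -
  let ?D = "\<lambda>w u. frechet_derivative F (at u) w"
  have sD: "smooth_at (?D w) x" for w
    by (rule smooth_at_frechet_derivative[OF assms(1)])
  have "((\<lambda>u. \<Sum>w\<in>Basis. (b u \<bullet> w) * ?D w u) has_derivative
      (\<lambda>a. \<Sum>w\<in>Basis. (b x \<bullet> w) * frechet_derivative (?D w) (at x) a +
        (frechet_derivative b (at x) a \<bullet> w) * ?D w x)) (at x)"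
    by (intro has_derivative_sum has_derivative_mult has_derivative_inner_left
        smooth_at_has_derivative[OF assms(2)] smooth_at_has_derivative[OF sD])
  moreover have "eventually (\<lambda>u. (\<Sum>w\<in>Basis. (b u \<bullet> w) * ?D w u) = frechet_derivative F (at u) (b u)) (nhds x)"
    using smooth_at_eventually[OF assms(1)]
    by eventually_elim (simp add: frechet_derivative_expand[OF smooth_at_differentiable, where w = "b _"])
  ultimately have "frechet_derivative (\<lambda>u. frechet_derivative F (at u) (b u)) (at x) a =
      (\<Sum>w\<in>Basis. (b x \<bullet> w) * frechet_derivative (?D w) (at x) a +
        (frechet_derivative b (at x) a \<bullet> w) * ?D w x)"
    by (simp only: frechet_derivative_cong_eventually[symmetric] frechet_derivative_eq)
  also have "\<dots> = (\<Sum>w\<in>Basis. (b x \<bullet> w) * frechet_derivative (?D a) (at x) w) +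
      (\<Sum>w\<in>Basis. (frechet_derivative b (at x) a \<bullet> w) * ?D w x)"
    by (simp only: sum.distrib smooth_at_second_derivative_symmetric[OF assms(1), of _ a])
  also have "\<dots> = frechet_derivative (?D a) (at x) (b x) + frechet_derivative F (at x) (frechet_derivative b (at x) a)"
    using frechet_derivative_expand[OF smooth_at_differentiable[OF assms(1)],
        of "frechet_derivative b (at x) a"]
      frechet_derivative_expand[OF smooth_at_differentiable[OF sD[of a]], of "b x"] by simp
  finally show ?thesis
    by simp
qed

context smooth_atlas
begin

text \<open>In \<open>X (Y f)\<close> and \<open>Y (X f)\<close> the second derivative of
  \<open>f\<close> is taken along the same two vectors in opposite order. These terms cancel by
  symmetry, and the derivative of \<open>f\<close> along Db(a) - Da(b) remains.\<close>

lemma lie_bracket_local_rep_at: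
  assumes c: "c \<in> A" "x \<in> fst c" and X: "local_rep c x X a" and Y: "local_rep c x Y b"
  shows "lie_bracket A X Y x = dir_vec A c
    (frechet_derivative b (at (snd c x)) (a (snd c x)) - frechet_derivative a (at (snd c x)) (b (snd c x))) x"
proof
  fix f :: "'m \<Rightarrow> real"
  let ?u = "snd c x" and ?F = "f \<circ> chart_inv c"
  show "lie_bracket A X Y x f = dir_vec A c
    (frechet_derivative b (at ?u) (a ?u) - frechet_derivative a (at ?u) (b ?u)) x f"
  proof (cases "smooth_near A f x")
    case True
    have F: "smooth_at ?F ?u"
      using True c by (simp add: smooth_near_iff)
    have a: "smooth_at a ?u" and b: "smooth_at b ?u"
      using X Y by (auto simp: local_rep_def)
    have 1: "Z x (\<lambda>y. W y f) = frechet_derivative ?F (at ?u) (frechet_derivative w (at ?u) (z ?u)) +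
        frechet_derivative (\<lambda>u. frechet_derivative ?F (at u) (z ?u)) (at ?u) (w ?u)"
      if Z: "local_rep c x Z z" and W: "local_rep c x W w" for Z W z w
    proof -
      have "frechet_derivative ((\<lambda>y. W y f) \<circ> chart_inv c) (at ?u) =
          frechet_derivative (\<lambda>u. frechet_derivative ?F (at u) (w u)) (at ?u)"
        by (rule frechet_derivative_cong_eventually)
          (use local_rep_apply(1)[OF c W True] in \<open>simp add: o_def\<close>)
      then have "Z x (\<lambda>y. W y f) = frechet_derivative (\<lambda>u. frechet_derivative ?F (at u) (w u)) (at ?u) (z ?u)"
        using local_rep_at[OF c Z] by (simp add: dir_vec_smooth[OF local_rep_apply(2)[OF c W True]])
      also have "\<dots> = frechet_derivative ?F (at ?u) (frechet_derivative w (at ?u) (z ?u)) +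
        frechet_derivative (\<lambda>u. frechet_derivative ?F (at u) (z ?u)) (at ?u) (w ?u)"
        using W by (intro frechet_derivative_along_field F) (auto simp: local_rep_def)
      finally show ?thesis .
    qed
    show ?thesis
      using True 1[OF X Y] 1[OF Y X] smooth_at_second_derivative_symmetric[OF F, of "a ?u" "b ?u"]
      by (simp add: lie_bracket_def dir_vec_smooth linear_diff[OF smooth_at_linear_frechet[OF F]])
  qed (simp add: lie_bracket_def dir_vec_not_smooth)
qed

lemma lie_bracket_local_rep:
  assumes c: "c \<in> A" "x \<in> fst c" and X: "local_rep c x X a" and Y: "local_rep c x Y b"
  shows "local_rep c x (lie_bracket A X Y)
    (\<lambda>u. frechet_derivative b (at u) (a u) - frechet_derivative a (at u) (b u))"
  unfolding local_rep_def
proof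
  show "smooth_at (\<lambda>u. frechet_derivative b (at u) (a u) - frechet_derivative a (at u) (b u)) (snd c x)"
    using X Y unfolding local_rep_def
    by (intro smooth_at_diff smooth_at_frechet_derivative_compose smooth_at_ident) auto
  show "eventually (\<lambda>u. lie_bracket A X Y (chart_inv c u) = dir_vec A c
      (frechet_derivative b (at u) (a u) - frechet_derivative a (at u) (b u)) (chart_inv c u)) (nhds (snd c x))"
    using local_rep_eventually[OF c X] local_rep_eventually[OF c Y] eventually_chart[OF c]
    by eventually_elim (use c in \<open>simp add: lie_bracket_local_rep_at\<close>)
qed

section \<open>Module operations on fields, the bracket and the torsion\<close>

lemma local_rep_dir_vec:
  "smooth_at a (snd c x) \<Longrightarrow> (\<And>u. X (chart_inv c u) = dir_vec A c (a u) (chart_inv c u)) \<Longrightarrow> local_rep c x X a"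
  by (simp add: local_rep_def)

lemma local_rep_fadd:
  assumes c: "c \<in> A" "x \<in> fst c" and X: "local_rep c x X a" and Y: "local_rep c x Y b"
  shows "local_rep c x (fadd X Y) (\<lambda>u. a u + b u)"
  unfolding local_rep_def
proof
  show "smooth_at (\<lambda>u. a u + b u) (snd c x)"
    using X Y unfolding local_rep_def by (intro smooth_at_add) auto
  have "eventually (\<lambda>u. X (chart_inv c u) = dir_vec A c (a u) (chart_inv c u)) (nhds (snd c x))"
    "eventually (\<lambda>u. Y (chart_inv c u) = dir_vec A c (b u) (chart_inv c u)) (nhds (snd c x))"
    using X Y by (auto simp: local_rep_def)
  then show "eventually (\<lambda>u. fadd X Y (chart_inv c u) = dir_vec A c (a u + b u) (chart_inv c u)) (nhds (snd c x))"
    using eventually_chart[OF c]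
    by eventually_elim (use c in \<open>auto simp: fadd_def linear_add[OF linear_dir_vec]\<close>)
qed

lemma local_rep_fscale:
  assumes c: "c \<in> A" "x \<in> fst c" and X: "local_rep c x X a" and g: "smooth_near A g x"
  shows "local_rep c x (fscale g X) (\<lambda>u. g (chart_inv c u) *\<^sub>R a u)"
  unfolding local_rep_def
proof
  show "smooth_at (\<lambda>u. g (chart_inv c u) *\<^sub>R a u) (snd c x)"
    using X g c unfolding local_rep_def
    by (intro smooth_at_scaleR) (auto simp: smooth_near_iff o_def)
  have "eventually (\<lambda>u. X (chart_inv c u) = dir_vec A c (a u) (chart_inv c u)) (nhds (snd c x))"
    using X by (auto simp: local_rep_def)
  then show "eventually (\<lambda>u. fscale g X (chart_inv c u) =
      dir_vec A c (g (chart_inv c u) *\<^sub>R a u) (chart_inv c u)) (nhds (snd c x))"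
    using eventually_chart[OF c]
    by eventually_elim (use c in \<open>auto simp: fscale_def linear_cmul[OF linear_dir_vec]\<close>)
qed

lemma vector_fieldI_charts:
  assumes "\<And>x. x \<notin> carrier A \<Longrightarrow> X x = (\<lambda>f. 0)"
    and "\<And>c x. c \<in> A \<Longrightarrow> x \<in> fst c \<Longrightarrow> \<exists>a. local_rep c x X a"
  shows "X \<in> vector_fields A"
  using assms by (intro vector_fieldI) (auto elim!: carrierE)

lemma vector_field_fadd:
  assumes "X \<in> vector_fields A" "Y \<in> vector_fields A"
  shows "fadd X Y \<in> vector_fields A"
proof (rule vector_fieldI_charts)
  fix c x assume c: "c \<in> A" "x \<in> fst c"
  then show "\<exists>a. local_rep c x (fadd X Y) a"
    using local_rep_fadd[OF c vector_field_local_rep[OF assms(1) c] vector_field_local_rep[OF assms(2) c]]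
    by blast
qed (simp add: fadd_def vector_field_off_carrier assms)

lemma vector_field_fscale:
  assumes "X \<in> vector_fields A" "smooth_fun A g"
  shows "fscale g X \<in> vector_fields A"
proof (rule vector_fieldI_charts)
  fix c x assume c: "c \<in> A" "x \<in> fst c"
  then have "smooth_near A g x"
    using assms(2) by (auto simp: smooth_fun_def carrier_def)
  then show "\<exists>a. local_rep c x (fscale g X) a"
    using local_rep_fscale[OF c vector_field_local_rep[OF assms(1) c]] by blast
qed (simp add: fscale_def vector_field_off_carrier assms)

lemma vector_field_lie_bracket:
  assumes "X \<in> vector_fields A" "Y \<in> vector_fields A"
  shows "lie_bracket A X Y \<in> vector_fields A"
proof (rule vector_fieldI_charts)
  fix c x assume c: "c \<in> A" "x \<in> fst c"
  then show "\<exists>a. local_rep c x (lie_bracket A X Y) a"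
    using lie_bracket_local_rep[OF c vector_field_local_rep[OF assms(1) c] vector_field_local_rep[OF assms(2) c]]
    by blast
next
  fix x assume "x \<notin> carrier A"
  then show "lie_bracket A X Y x = (\<lambda>f. 0)"
    using smooth_near_carrier by (fastforce simp: lie_bracket_def)
qed

lemma smooth_fun_const: "smooth_fun A (\<lambda>x. r)"
  by (simp add: smooth_fun_def smooth_near_const)

lemma lie_bracket_fadd_left:
  assumes "X \<in> vector_fields A" "X' \<in> vector_fields A" "Y \<in> vector_fields A"
  shows "lie_bracket A (fadd X X') Y = fadd (lie_bracket A X Y) (lie_bracket A X' Y)"
proof (intro ext)
  fix x and f :: "'m \<Rightarrow> real"
  show "lie_bracket A (fadd X X') Y x f = fadd (lie_bracket A X Y) (lie_bracket A X' Y) x f"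
    using vector_field_add[OF assms(3) vector_field_smooth[OF assms(1)] vector_field_smooth[OF assms(2)],
        of f x f]
    by (auto simp: lie_bracket_def fadd_def)
qed

text \<open>The term with \<open>- Y x g\<close> measures how the bracket fails to be linear over
  functions. In the torsion it is cancelled by the Leibniz term of
  \<open>D Y (fscale g X)\<close>.\<close>

lemma lie_bracket_fscale_left:
  assumes "X \<in> vector_fields A" "Y \<in> vector_fields A" and g: "smooth_fun A g"
  shows "lie_bracket A (fscale g X) Y =
    fadd (fscale g (lie_bracket A X Y)) (fscale (\<lambda>x. - Y x g) X)"
proof (intro ext)
  fix x and f :: "'m \<Rightarrow> real"
  show "lie_bracket A (fscale g X) Y x f =
    fadd (fscale g (lie_bracket A X Y)) (fscale (\<lambda>x. - Y x g) X) x f"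
  proof (cases "smooth_near A f x")
    case True
    then have "smooth_near A g x"
      using g smooth_near_carrier by (auto simp: smooth_fun_def)
    then show ?thesis
      using True assms vector_field_mult[OF assms(2) _ vector_field_smooth[OF assms(1) True]]
      by (simp add: lie_bracket_def fadd_def fscale_def algebra_simps)
  next
    case False
    then show ?thesis
      using assms by (simp add: lie_bracket_def fadd_def fscale_def vector_field_not_smooth)
  qed
qed

lemma skew_tensor_torsion:
  assumes D: "linear_connection A D"
  shows "skew_tensor A (torsion A D)"
proof -
  have DV: "D X Y \<in> vector_fields A" if "X \<in> vector_fields A" "Y \<in> vector_fields A" for X Y
    using D that by (simp add: linear_connection_def)
  \<comment> \<open>Expressed through \<open>fadd\<close> and \<open>fscale\<close>, the torsion is
    accessible to the closure rules for fields and to the linearity rules for \<open>D\<close> and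
    the bracket.\<close>
  have T: "torsion A D X Y = fadd (D X Y) (fscale (\<lambda>_. -1) (fadd (D Y X) (lie_bracket A X Y)))" for X Y
    by (simp add: torsion_def fadd_def fscale_def algebra_simps)
  show ?thesis
    unfolding skew_tensor_def
  proof (intro conjI ballI allI impI)
    fix X Y assume X: "X \<in> vector_fields A" and Y: "Y \<in> vector_fields A"
    show "torsion A D X Y \<in> vector_fields A"
      unfolding T by (intro vector_field_fadd vector_field_fscale smooth_fun_const DV X Y vector_field_lie_bracket)
    show "torsion A D X Y = fscale (\<lambda>_. -1) (torsion A D Y X)"
      by (simp add: fun_eq_iff torsion_def fscale_def lie_bracket_def)
  next
    fix X X' Y assume X: "X \<in> vector_fields A" "X' \<in> vector_fields A" "Y \<in> vector_fields A"
    have "D (fadd X X') Y = fadd (D X Y) (D X' Y)" "D Y (fadd X X') = fadd (D Y X) (D Y X')"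
      using D X by (simp_all add: linear_connection_def)
    then show "torsion A D (fadd X X') Y = fadd (torsion A D X Y) (torsion A D X' Y)"
      by (simp add: T lie_bracket_fadd_left[OF X]) (simp add: fadd_def fscale_def algebra_simps)
  next
    fix g X Y assume g: "smooth_fun A g" and X: "X \<in> vector_fields A" "Y \<in> vector_fields A"
    have "D (fscale g X) Y = fscale g (D X Y)"
      "D Y (fscale g X) = fadd (fscale (\<lambda>x. Y x g) X) (fscale g (D Y X))"
      using D X g by (simp_all add: linear_connection_def)
    then show "torsion A D (fscale g X) Y = fscale g (torsion A D X Y)"
      by (simp add: T lie_bracket_fscale_left[OF X g]) (simp add: fadd_def fscale_def algebra_simps)
  qed
qed

end

section \<open>Bump functions and extension by zero\<close>

context Hausdorff_atlas
begin

text \<open>The image of a compact set is compact, and in a Hausdorff space therefore closed. In a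
  space that is not Hausdorff a function extended by zero may fail to be smooth at a point outside
  the chart that cannot be separated from the support.\<close>

lemma compact_chart_closedin:
  assumes c: "c \<in> A" and K: "compact K" "K \<subseteq> snd c ` fst c"
  shows "closedin (manifold_topology A) (chart_inv c ` K)"
proof -
  have "continuous_map (top_of_set (snd c ` fst c)) (manifold_topology A) (chart_inv c)"
    unfolding continuous_map_def
  proof (intro conjI allI impI)
    show "chart_inv c \<in> topspace (top_of_set (snd c ` fst c)) \<rightarrow> topspace (manifold_topology A)"
      using c by (auto simp: topspace_manifold_topology carrier_def)
    fix W assume W: "openin (manifold_topology A) W"
    have "{u \<in> topspace (top_of_set (snd c ` fst c)). chart_inv c u \<in> W} = snd c ` (W \<inter> fst c)"
      using c by auto
    then show "openin (top_of_set (snd c ` fst c)) {u \<in> topspace (top_of_set (snd c ` fst c)). chart_inv c u \<in> W}"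
      using W c by (auto simp: openin_manifold_topology intro: open_openin_trans[OF open_chart_image])
  qed
  moreover have "compactin (top_of_set (snd c ` fst c)) K"
    using K by (simp add: compactin_subtopology)
  ultimately have "compactin (manifold_topology A) (chart_inv c ` K)"
    by (rule image_compactin[rotated])
  then show ?thesis
    using Hausdorff by (rule compactin_imp_closedin[rotated])
qed

lemma eventually_notin_closed:
  assumes "closedin (manifold_topology A) K" "x \<notin> K" "c \<in> A" "x \<in> fst c"
  shows "eventually (\<lambda>u. chart_inv c u \<notin> K) (nhds (snd c x))"
proof -
  have "openin (manifold_topology A) (carrier A - K)"
    using assms(1) by (simp add: closedin_def topspace_manifold_topology)
  moreover have "x \<in> carrier A - K"
    using assms by (auto simp: carrier_def)
  ultimately have "eventually (\<lambda>u. chart_inv c u \<in> carrier A - K) (nhds (snd c x))"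
    using openin_imp_eventually assms by blast
  then show ?thesis
    by eventually_elim simp
qed

text \<open>Points of \<open>K\<close> lie in the chart, where smoothness is assumed; every other
  point has a neighbourhood that misses the closed set \<open>K\<close>, and there the function is
  zero.\<close>

lemma smooth_fun_closed_support:
  assumes c: "c \<in> A" and K: "closedin (manifold_topology A) K" "K \<subseteq> fst c"
    and g: "\<And>y. y \<in> fst c \<Longrightarrow> smooth_near A g y" "\<And>y. y \<notin> K \<Longrightarrow> g y = 0"
  shows "smooth_fun A g"
  unfolding smooth_fun_def
proof
  fix x assume x: "x \<in> carrier A"
  show "smooth_near A g x"
  proof (cases "x \<in> K")
    case False
    obtain c' where c': "c' \<in> A" "x \<in> fst c'"
      using x by (rule carrierE)
    have "eventually (\<lambda>u. g (chart_inv c' u) = 0) (nhds (snd c' x))"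
      using eventually_notin_closed[OF K(1) False c'] by eventually_elim (simp add: g(2))
    then show ?thesis
      using smooth_near_cong[OF c', of g "\<lambda>_. 0"] smooth_near_const[OF x] by simp
  qed (use g(1) K(2) in auto)
qed

lemma vector_field_closed_support:
  assumes c: "c \<in> A" and K: "closedin (manifold_topology A) K" "K \<subseteq> fst c"
    and X: "\<And>y. y \<in> fst c \<Longrightarrow> \<exists>a. local_rep c y X a" "\<And>y. y \<notin> K \<Longrightarrow> X y = (\<lambda>f. 0)"
  shows "X \<in> vector_fields A"
proof (rule vector_fieldI)
  fix x assume "x \<notin> carrier A"
  then show "X x = (\<lambda>f. 0)"
    using c K by (intro X(2)) (auto simp: carrier_def)
next
  fix x assume x: "x \<in> carrier A"
  show "\<exists>c\<in>A. x \<in> fst c \<and> (\<exists>a. local_rep c x X a)"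
  proof (cases "x \<in> K")
    case True
    then show ?thesis
      using X(1) K(2) c by blast
  next
    case False
    obtain c' where c': "c' \<in> A" "x \<in> fst c'"
      using x by (rule carrierE)
    have "local_rep c' x X (\<lambda>u. 0)"
      unfolding local_rep_def
    proof
      show "eventually (\<lambda>u. X (chart_inv c' u) = dir_vec A c' 0 (chart_inv c' u)) (nhds (snd c' x))"
        using eventually_notin_closed[OF K(1) False c'] eventually_chart[OF c']
        by eventually_elim (use c' in \<open>auto simp: X(2) linear_0[OF linear_dir_vec]\<close>)
    qed (rule smooth_at_const)
    then show ?thesis
      using c' by blast
  qed
qed

lemma bump_function:
  assumes c: "c \<in> A" "x \<in> fst c"
  obtains \<psi> K where "smooth_fun A \<psi>" "closedin (manifold_topology A) K" "K \<subseteq> fst c"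
    "\<And>y. y \<notin> K \<Longrightarrow> \<psi> y = 0" "eventually (\<lambda>u. \<psi> (chart_inv c u) = 1) (nhds (snd c x))"
proof -
  have "snd c x \<in> snd c ` fst c"
    using c by simp
  then obtain r where r: "r > 0" "cball (snd c x) r \<subseteq> snd c ` fst c"
    using open_chart_image[OF c(1)] open_contains_cball by metis
  \<comment> \<open>Half the radius, because the Euclidean bump for \<open>r / 2\<close> may be
    nonzero up to distance \<open>r\<close>, and the closed ball of that radius still lies in the
    chart image.\<close>
  then have "r / 2 > 0"
    by simp
  then obtain \<rho> :: "'v \<Rightarrow> real" where \<rho>: "\<And>y. smooth_at \<rho> y"
    "\<And>y. y \<in> ball (snd c x) (r / 2) \<Longrightarrow> \<rho> y = 1" "\<And>y. y \<notin> cball (snd c x) (2 * (r / 2)) \<Longrightarrow> \<rho> y = 0"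
    by (rule smooth_bump_euclidean[of "r / 2" "snd c x"]) blast
  define K where "K = chart_inv c ` cball (snd c x) r"
  define \<psi> where "\<psi> y = (if y \<in> fst c then \<rho> (snd c y) else 0)" for y
  have K: "closedin (manifold_topology A) K"
    unfolding K_def by (rule compact_chart_closedin[OF c(1) compact_cball r(2)])
  have Kc: "K \<subseteq> fst c"
    using r(2) c(1) by (auto simp: K_def subset_iff)
  have supp: "\<psi> y = 0" if "y \<notin> K" for y
  proof (cases "y \<in> fst c \<and> snd c y \<in> cball (snd c x) r")
    case True
    then have "y \<in> K"
      unfolding K_def using c(1) by (intro image_eqI[where x = "snd c y"]) auto
    then show ?thesis
      using that by simp
  qed (use \<rho>(3) in \<open>auto simp: \<psi>_def\<close>)
  have "smooth_near A \<psi> y" if y: "y \<in> fst c" for y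
    unfolding smooth_near_iff[OF c(1) y]
    by (rule smooth_at_cong[OF _ \<rho>(1)], rule eventually_mono[OF eventually_chart[OF c(1) y]])
      (simp add: \<psi>_def)
  then have "smooth_fun A \<psi>"
    by (rule smooth_fun_closed_support[OF c(1) K Kc]) (simp_all add: supp)
  moreover have "eventually (\<lambda>u. u \<in> ball (snd c x) (r / 2)) (nhds (snd c x))"
    using r(1) by (intro eventually_nhds_in_open) auto
  then have "eventually (\<lambda>u. \<psi> (chart_inv c u) = 1) (nhds (snd c x))"
    using eventually_chart[OF c] by eventually_elim (simp add: \<psi>_def \<rho>(2))
  ultimately show ?thesis
    using that K Kc supp by blast
qed

lemma smooth_fun_cutoff:
  assumes "smooth_fun A \<psi>" "closedin (manifold_topology A) K" "K \<subseteq> fst c" "c \<in> A"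
    and "\<And>y. y \<notin> K \<Longrightarrow> \<psi> y = 0" and g: "\<And>y. y \<in> fst c \<Longrightarrow> smooth_near A g y"
  shows "smooth_fun A (\<lambda>y. \<psi> y * g y)"
  by (rule smooth_fun_closed_support[OF assms(4,2,3)])
    (use assms in \<open>auto simp: smooth_fun_def carrier_def intro!: smooth_near_mult\<close>)

lemma vector_field_cutoff:
  assumes "smooth_fun A \<psi>" "closedin (manifold_topology A) K" "K \<subseteq> fst c" "c \<in> A"
    and "\<And>y. y \<notin> K \<Longrightarrow> \<psi> y = 0" and X: "\<And>y. y \<in> fst c \<Longrightarrow> \<exists>a. local_rep c y X a"
  shows "fscale \<psi> X \<in> vector_fields A"
proof (rule vector_field_closed_support[OF assms(4,2,3)])
  fix y assume y: "y \<in> fst c"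
  then have "smooth_near A \<psi> y"
    using assms(1,4) by (auto simp: smooth_fun_def carrier_def)
  then show "\<exists>a. local_rep c y (fscale \<psi> X) a"
    using X[OF y] local_rep_fscale[OF assms(4) y] by blast
qed (simp add: fscale_def assms(5))

lemma extend_local_field:
  assumes c: "c \<in> A" "x \<in> fst c" and X: "\<And>y. y \<in> fst c \<Longrightarrow> \<exists>a. local_rep c y X a"
  shows "\<exists>Y\<in>vector_fields A. agree_near A x Y X"
proof -
  obtain \<psi> K where \<psi>: "smooth_fun A \<psi>" "closedin (manifold_topology A) K" "K \<subseteq> fst c"
    "\<And>y. y \<notin> K \<Longrightarrow> \<psi> y = 0" "eventually (\<lambda>u. \<psi> (chart_inv c u) = 1) (nhds (snd c x))"
    using bump_function[OF c] by metis
  have "fscale \<psi> X \<in> vector_fields A"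
    by (rule vector_field_cutoff[OF \<psi>(1-3) c(1) \<psi>(4) X])
  moreover have "agree_near A x (fscale \<psi> X) X"
    by (rule eventually_imp_agree_near[OF c], rule eventually_mono[OF \<psi>(5)]) (simp add: fscale_def)
  ultimately show ?thesis
    by blast
qed

section \<open>Tensors depend only on pointwise values\<close>

definition field_sum :: "'i set \<Rightarrow> ('i \<Rightarrow> 'm field) \<Rightarrow> 'm field" where
  "field_sum I Z = (\<lambda>x f. \<Sum>i\<in>I. Z i x f)"

definition field_linear :: "('m field \<Rightarrow> 'm field) \<Rightarrow> bool" where
  "field_linear F \<longleftrightarrow>
     (\<forall>X\<in>vector_fields A. \<forall>Y\<in>vector_fields A. F (fadd X Y) = fadd (F X) (F Y)) \<and>
     (\<forall>g. smooth_fun A g \<longrightarrow> (\<forall>X\<in>vector_fields A. F (fscale g X) = fscale g (F X)))"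

lemma zero_vector_field: "(\<lambda>x f. 0) \<in> vector_fields A"
proof (rule vector_fieldI)
  fix x assume "x \<in> carrier A"
  then obtain c where c: "c \<in> A" "x \<in> fst c"
    by (rule carrierE)
  have "local_rep c x (\<lambda>x f. 0) (\<lambda>u. 0)"
    unfolding local_rep_def using eventually_chart[OF c] smooth_at_const c
    by (auto simp: linear_0[OF linear_dir_vec] elim!: eventually_mono)
  then show "\<exists>c\<in>A. x \<in> fst c \<and> (\<exists>a. local_rep c x (\<lambda>x f. 0) a)"
    using c by blast
qed simp

lemma field_linear_sum:
  assumes F: "field_linear F" and "finite I" and "\<And>i. i \<in> I \<Longrightarrow> Z i \<in> vector_fields A"
  shows "field_sum I Z \<in> vector_fields A \<and> F (field_sum I Z) = field_sum I (\<lambda>i. F (Z i))"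
  using assms(2,3)
proof (induction I rule: finite_induct)
  case empty
  \<comment> \<open>The zero field is \<open>0\<close> times itself, so homogeneity alone forces
    \<open>F\<close> to send it to zero.\<close>
  have "F (fscale (\<lambda>_. 0) (\<lambda>x f. 0)) = fscale (\<lambda>_. 0) (F (\<lambda>x f. 0))"
    using F zero_vector_field smooth_fun_const[of 0] unfolding field_linear_def by blast
  then show ?case
    using zero_vector_field by (simp add: field_sum_def fscale_def)
next
  case (insert i I)
  have e: "field_sum (insert i I) Z' = fadd (Z' i) (field_sum I Z')" for Z' :: "_ \<Rightarrow> 'm field"
    using insert.hyps by (simp add: field_sum_def fadd_def)
  show ?case
    unfolding e using insert F by (simp add: field_linear_def vector_field_fadd)
qed

text \<open>On the support of a bump function \<open>\<psi>\<close> a field is a combination of coordinate fields, so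
  \<open>\<psi>\<^sup>2 X = \<Sum> (\<psi> a\<^sub>b) (\<psi> \<partial>\<^sub>b)\<close> with global factors and \<open>a\<^sub>b = 0\<close> at the zeros of \<open>X\<close>.\<close>

lemma field_linear_vanishes:
  assumes F: "field_linear F" and X: "X \<in> vector_fields A" and x: "x \<in> carrier A" "X x = (\<lambda>f. 0)"
  shows "F X x = (\<lambda>f. 0)"
proof -
  obtain c where c: "c \<in> A" "x \<in> fst c"
    using x(1) by (rule carrierE)
  obtain \<psi> K where \<psi>: "smooth_fun A \<psi>" "closedin (manifold_topology A) K" "K \<subseteq> fst c"
    "\<And>y. y \<notin> K \<Longrightarrow> \<psi> y = 0" "eventually (\<lambda>u. \<psi> (chart_inv c u) = 1) (nhds (snd c x))"
    using bump_function[OF c] by metis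
  have one: "\<psi> x = 1"
    using eventually_nhds_x_imp_x[OF \<psi>(5)] c by simp
  define h where "h b y = \<psi> y * (components c (X y) \<bullet> b)" for b y
  define E where "E b = fscale \<psi> (dir_vec A c b)" for b
  have h: "smooth_fun A (h b)" for b
    unfolding h_def
  proof (rule smooth_fun_cutoff[OF \<psi>(1-3) c(1) \<psi>(4)])
    fix y assume y: "y \<in> fst c"
    have "smooth_at (\<lambda>u. components c (X (chart_inv c u)) \<bullet> b) (snd c y)"
      by (rule smooth_at_linear_compose[OF bounded_linear.linear[OF bounded_linear_inner_left]])
        (use vector_field_local_rep[OF X c(1) y] in \<open>simp add: local_rep_def\<close>)
    then show "smooth_near A (\<lambda>y. components c (X y) \<bullet> b) y"
      using c(1) y by (simp add: smooth_near_iff o_def)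
  qed
  have E: "E b \<in> vector_fields A" for b
    unfolding E_def
    by (rule vector_field_cutoff[OF \<psi>(1-3) c(1) \<psi>(4)]) (auto intro: local_rep_dir_vec smooth_at_const)
  have XE: "fscale (\<lambda>y. \<psi> y * \<psi> y) X = field_sum Basis (\<lambda>b. fscale (h b) (E b))"
  proof (intro ext)
    fix y and f :: "'m \<Rightarrow> real"
    show "fscale (\<lambda>y. \<psi> y * \<psi> y) X y f = field_sum Basis (\<lambda>b. fscale (h b) (E b)) y f"
    proof (cases "y \<in> K")
      case True
      then have y: "y \<in> fst c"
        using \<psi>(3) by auto
      have "X y \<in> tangent_space A y"
        using X c(1) y by (auto simp: vector_fields_def carrier_def)
      then have "X y f = dir_vec A c (components c (X y)) y f"
        using dir_vec_components[OF c(1) y] by simp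
      also have "\<dots> = (\<Sum>b\<in>Basis. (components c (X y) \<bullet> b) * dir_vec A c b y f)"
        by (subst (1) euclidean_representation[of "components c (X y)", symmetric])
          (simp add: linear_sum[OF linear_dir_vec[OF c(1) y]] linear_cmul[OF linear_dir_vec[OF c(1) y]])
      finally show ?thesis
        by (simp add: fscale_def field_sum_def h_def E_def sum_distrib_left ac_simps)
    qed (simp add: fscale_def field_sum_def h_def E_def \<psi>(4))
  qed
  have \<psi>2: "smooth_fun A (\<lambda>y. \<psi> y * \<psi> y)"
    using \<psi>(1) by (auto simp: smooth_fun_def intro: smooth_near_mult)
  have "F (fscale (\<lambda>y. \<psi> y * \<psi> y) X) = field_sum Basis (\<lambda>b. F (fscale (h b) (E b)))"
    unfolding XE
    using field_linear_sum[OF F finite_Basis, of "\<lambda>b. fscale (h b) (E b)"] vector_field_fscale[OF E h]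
    by blast
  moreover have "F (fscale (\<lambda>y. \<psi> y * \<psi> y) X) = fscale (\<lambda>y. \<psi> y * \<psi> y) (F X)"
    using F X \<psi>2 by (simp add: field_linear_def)
  moreover have "F (fscale (h b) (E b)) = fscale (h b) (F (E b))" for b
    using F E h by (simp add: field_linear_def)
  moreover have "h b x = 0" for b
    by (simp add: h_def x(2) components_def)
  ultimately show ?thesis
    using one by (auto simp: fun_eq_iff fscale_def field_sum_def dest!: spec[of _ x])
qed

text \<open>The coefficients are the constants \<open>r i\<close>, so \<open>X\<close> minus the
  combination of the \<open>Z i\<close> is a global field that vanishes at \<open>x\<close>, and
  \<open>field_linear_vanishes\<close> applies to it.\<close>

lemma field_linear_expand:
  assumes F: "field_linear F" and X: "X \<in> vector_fields A" and x: "x \<in> carrier A"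
    and I: "finite I" and Z: "\<And>i. i \<in> I \<Longrightarrow> Z i \<in> vector_fields A"
    and e: "X x = (\<lambda>f. \<Sum>i\<in>I. r i * Z i x f)"
  shows "F X x f = (\<Sum>i\<in>I. r i * F (Z i) x f)"
proof -
  define W where "W = field_sum I (\<lambda>i. fscale (\<lambda>_. - r i) (Z i))"
  have Zr: "fscale (\<lambda>_. - r i) (Z i) \<in> vector_fields A" if "i \<in> I" for i
    by (rule vector_field_fscale[OF Z[OF that] smooth_fun_const])
  have "W \<in> vector_fields A \<and> F W = field_sum I (\<lambda>i. F (fscale (\<lambda>_. - r i) (Z i)))"
    unfolding W_def by (rule field_linear_sum[OF F I]) (rule Zr)
  then have W: "W \<in> vector_fields A" "F W = field_sum I (\<lambda>i. F (fscale (\<lambda>_. - r i) (Z i)))"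
    by auto
  have Fi: "F (fscale (\<lambda>_. - r i) (Z i)) = fscale (\<lambda>_. - r i) (F (Z i))" if "i \<in> I" for i
    using F Z[OF that] smooth_fun_const by (simp add: field_linear_def)
  have "F (fadd X W) x = (\<lambda>f. 0)"
    by (rule field_linear_vanishes[OF F vector_field_fadd[OF X W(1)] x])
      (simp add: fadd_def W_def field_sum_def fscale_def e sum_negf)
  then have "F X x f + F W x f = 0"
    using F X W(1) by (simp add: field_linear_def fadd_def fun_eq_iff)
  then show ?thesis
    unfolding W(2) field_sum_def using Fi by (simp add: fscale_def[of _ "F _"] sum_negf cong: sum.cong)
qed

lemma skew_tensor_field_linear:
  assumes "skew_tensor A S" "Y \<in> vector_fields A"
  shows "field_linear (\<lambda>X. S X Y)"
  unfolding field_linear_def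
proof (intro conjI ballI allI impI)
  fix X X' assume "X \<in> vector_fields A" "X' \<in> vector_fields A"
  then show "S (fadd X X') Y = fadd (S X Y) (S X' Y)"
    using assms unfolding skew_tensor_def by meson
next
  fix g X assume "smooth_fun A g" "X \<in> vector_fields A"
  then show "S (fscale g X) Y = fscale g (S X Y)"
    using assms unfolding skew_tensor_def by meson
qed

lemma skew_tensor_swap:
  assumes "skew_tensor A S" "X \<in> vector_fields A" "Y \<in> vector_fields A"
  shows "S X Y x f = - S Y X x f"
proof -
  have "S X Y = fscale (\<lambda>_. -1) (S Y X)"
    using assms unfolding skew_tensor_def by meson
  from fun_cong[OF fun_cong[OF this]] show ?thesis
    by (simp add: fscale_def)
qed

text \<open>\<open>skew_tensor\<close> states linearity over functions in the first argument. Skew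
  symmetry moves the second argument there, and two expansions over the frame express either tensor
  by its values on pairs of frame fields.\<close>

lemma skew_tensor_eqI:
  assumes S: "skew_tensor A S" "skew_tensor A S'" and x: "x \<in> carrier A"
    and I: "finite I" and Z: "\<And>i. i \<in> I \<Longrightarrow> Z i \<in> vector_fields A"
    and span: "\<And>X. X \<in> vector_fields A \<Longrightarrow> \<exists>r. X x = (\<lambda>f. \<Sum>i\<in>I. r i * Z i x f)"
    and eq: "\<And>i j. i \<in> I \<Longrightarrow> j \<in> I \<Longrightarrow> S (Z i) (Z j) x = S' (Z i) (Z j) x"
    and X: "X \<in> vector_fields A" and Y: "Y \<in> vector_fields A"
  shows "S X Y x = S' X Y x"
proof
  fix f :: "'m \<Rightarrow> real"
  obtain r where r: "X x = (\<lambda>f. \<Sum>i\<in>I. r i * Z i x f)"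
    using span[OF X] by blast
  obtain s where s: "Y x = (\<lambda>f. \<Sum>i\<in>I. s i * Z i x f)"
    using span[OF Y] by blast
  have e: "Q X Y x f = (\<Sum>i\<in>I. r i * - (\<Sum>j\<in>I. s j * Q (Z j) (Z i) x f))"
    if Q: "skew_tensor A Q" for Q
  proof -
    have "Q X Y x f = (\<Sum>i\<in>I. r i * Q (Z i) Y x f)"
      by (rule field_linear_expand[OF skew_tensor_field_linear[OF Q Y] X x I Z r])
    also have "\<dots> = (\<Sum>i\<in>I. r i * - Q Y (Z i) x f)"
      by (rule sum.cong) (use skew_tensor_swap[OF Q Z Y] in simp_all)
    also have "\<dots> = (\<Sum>i\<in>I. r i * - (\<Sum>j\<in>I. s j * Q (Z j) (Z i) x f))"
    proof (rule sum.cong[OF refl])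
      fix i assume "i \<in> I"
      note i = skew_tensor_field_linear[OF Q Z[OF this]]
      show "r i * - Q Y (Z i) x f = r i * - (\<Sum>j\<in>I. s j * Q (Z j) (Z i) x f)"
        using field_linear_expand[OF i Y x I Z s] by simp
    qed
    finally show ?thesis .
  qed
  show "S X Y x f = S' X Y x f"
    unfolding e[OF S(1)] e[OF S(2)] by (simp add: eq cong: sum.cong)
qed

end

section \<open>The jet atlas\<close>

context smooth_atlas
begin

lemma openin_chart_preimage:
  assumes c: "c \<in> A" and "open W"
  shows "openin (manifold_topology A) {x \<in> fst c. snd c x \<in> W}"
proof (rule openin_manifold_topologyI)
  show "{x \<in> fst c. snd c x \<in> W} \<subseteq> carrier A"
    using c by (auto simp: carrier_def)
next
  fix x assume x: "x \<in> {x \<in> fst c. snd c x \<in> W}"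
  then have "eventually (\<lambda>u. u \<in> W) (nhds (snd c x))"
    using \<open>open W\<close> by (intro eventually_nhds_in_open) auto
  moreover have "eventually (\<lambda>u. chart_inv c u \<in> fst c \<and> snd c (chart_inv c u) = u) (nhds (snd c x))"
    using eventually_chart[OF c] x by auto
  ultimately have "eventually (\<lambda>u. chart_inv c u \<in> {x \<in> fst c. snd c x \<in> W}) (nhds (snd c x))"
    by eventually_elim auto
  then show "\<exists>c'\<in>A. x \<in> fst c' \<and> eventually (\<lambda>u. chart_inv c' u \<in> {x \<in> fst c. snd c x \<in> W}) (nhds (snd c' x))"
    using x c by blast
qed

lemma eventually_chart_image:
  assumes "c \<in> A" "u \<in> snd c ` fst c"
  shows "eventually (\<lambda>v. chart_inv c v \<in> fst c \<and> snd c (chart_inv c v) = v) (nhds u)"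
  using eventually_chart[of c "chart_inv c u"] assms by auto

end

locale jet_space = T: Hausdorff_atlas AT + M: Hausdorff_atlas AM
  for AT :: "('a, real^'p::finite) chart set" and AM :: "('b, real^'n::finite) chart set"
begin

abbreviation smooth_map :: "('a \<Rightarrow> 'b) \<Rightarrow> 'a \<Rightarrow> bool" where
  "smooth_map \<equiv> smooth_map_near AT AM"

abbreviation in_charts :: "('a, real^'p) chart \<Rightarrow> ('b, real^'n) chart \<Rightarrow> ('a \<Rightarrow> 'b) \<Rightarrow> real^'p \<Rightarrow> real^'n" where
  "in_charts c d f \<equiv> snd d \<circ> f \<circ> chart_inv c"

text \<open>As \<open>snd d\<close> is arbitrary off \<open>fst d\<close>, smoothness of
  \<open>in_charts c d f\<close> does not tell where \<open>f\<close> lands; the information that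
  \<open>f\<close> stays in \<open>fst d\<close> near \<open>t\<close> is therefore carried along.
  The derivative formula is the chain rule through both transition maps.\<close>

lemma in_charts_change:
  assumes c: "c \<in> AT" "t \<in> fst c" "c' \<in> AT" "t \<in> fst c'" and d: "d \<in> AM" "f t \<in> fst d" "d' \<in> AM" "f t \<in> fst d'"
    and dom: "eventually (\<lambda>u. f (chart_inv c u) \<in> fst d) (nhds (snd c t))"
    and f: "smooth_at (in_charts c d f) (snd c t)"
  shows "eventually (\<lambda>u. f (chart_inv c' u) \<in> fst d') (nhds (snd c' t))"
    and "smooth_at (in_charts c' d' f) (snd c' t)"
    and "frechet_derivative (in_charts c' d' f) (at (snd c' t)) =
      frechet_derivative (snd d' \<circ> chart_inv d) (at (snd d (f t))) \<circ>
      (frechet_derivative (in_charts c d f) (at (snd c t)) \<circ>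
      frechet_derivative (snd c \<circ> chart_inv c') (at (snd c' t)))"
proof -
  have "filterlim (in_charts c d f) (nhds (snd d (f t))) (nhds (snd c t))"
    using smooth_at_continuous[OF f] c unfolding continuous_at tendsto_at_iff_tendsto_nhds by simp
  from eventually_compose_filterlim[OF M.eventually_overlap[OF d(1,3,2,4)] this]
  have "eventually (\<lambda>u. f (chart_inv c u) \<in> fst d') (nhds (snd c t))"
    using dom by eventually_elim (use d in auto)
  from T.eventually_change_chart[OF c(1,3,2,4) this]
  show "eventually (\<lambda>u. f (chart_inv c' u) \<in> fst d') (nhds (snd c' t))" .
  let ?g = "\<lambda>u. (snd d' \<circ> chart_inv d) (in_charts c d f ((snd c \<circ> chart_inv c') u))"
  have ev: "eventually (\<lambda>u. ?g u = in_charts c' d' f u) (nhds (snd c' t))"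
    using T.eventually_change_chart[OF c(1,3,2,4) dom] T.eventually_overlap[OF c(3,1,4,2)]
    by eventually_elim (use c d in auto)
  have 1: "smooth_at (snd c \<circ> chart_inv c') (snd c' t)"
    by (rule T.smooth_transition[OF c(3,1,4,2)])
  have 2: "smooth_at (in_charts c d f) ((snd c \<circ> chart_inv c') (snd c' t))"
    using f c by simp
  have 3: "smooth_at (snd d' \<circ> chart_inv d) (in_charts c d f ((snd c \<circ> chart_inv c') (snd c' t)))"
    using M.smooth_transition[OF d(1,3,2,4)] c by simp
  show "smooth_at (in_charts c' d' f) (snd c' t)"
    by (rule smooth_at_cong[OF ev], rule smooth_at_compose[OF smooth_at_compose[OF 1 2] 3])
  have "(?g has_derivative (\<lambda>v. frechet_derivative (snd d' \<circ> chart_inv d) (at (snd d (f t)))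
      (frechet_derivative (in_charts c d f) (at (snd c t))
        (frechet_derivative (snd c \<circ> chart_inv c') (at (snd c' t)) v)))) (at (snd c' t))"
    using has_derivative_compose[OF has_derivative_compose[OF smooth_at_has_derivative[OF 1]
          smooth_at_has_derivative[OF 2]] smooth_at_has_derivative[OF 3]] c by simp
  from frechet_derivative_eq[OF this] frechet_derivative_cong_eventually[OF ev]
  show "frechet_derivative (in_charts c' d' f) (at (snd c' t)) =
      frechet_derivative (snd d' \<circ> chart_inv d) (at (snd d (f t))) \<circ>
      (frechet_derivative (in_charts c d f) (at (snd c t)) \<circ>
      frechet_derivative (snd c \<circ> chart_inv c') (at (snd c' t)))"
    by (simp add: o_def)
qed

lemma smooth_map_in_charts:
  assumes "c \<in> AT" "t \<in> fst c" "d \<in> AM" "f t \<in> fst d" and "smooth_map f t"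
  shows "eventually (\<lambda>u. f (chart_inv c u) \<in> fst d) (nhds (snd c t))"
    and "smooth_at (in_charts c d f) (snd c t)"
proof -
  obtain W where W: "open W" "snd c t \<in> W" "f ` chart_inv c ` W \<subseteq> fst d" "smooth_on W (in_charts c d f)"
    using assms unfolding smooth_map_near_def by blast
  show "eventually (\<lambda>u. f (chart_inv c u) \<in> fst d) (nhds (snd c t))"
    using W(1-3) by (auto simp: eventually_nhds)
  show "smooth_at (in_charts c d f) (snd c t)"
    using W by (auto simp: smooth_at_def)
qed

lemma smooth_mapI:
  assumes c: "c \<in> AT" "t \<in> fst c" and d: "d \<in> AM" "f t \<in> fst d"
    and dom: "eventually (\<lambda>u. f (chart_inv c u) \<in> fst d) (nhds (snd c t))"
    and f: "smooth_at (in_charts c d f) (snd c t)"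
  shows "smooth_map f t"
  unfolding smooth_map_near_def
proof (intro conjI ballI impI)
  show "t \<in> carrier AT" "f t \<in> carrier AM"
    using c d by (auto simp: carrier_def)
  fix c' d' assume c': "c' \<in> AT" "t \<in> fst c'" and d': "d' \<in> AM" "f t \<in> fst d'"
  note h = in_charts_change[OF c c' d d' dom f]
  obtain W where W: "open W" "snd c' t \<in> W" "smooth_on W (in_charts c' d' f)"
    using h(2) by (auto simp: smooth_at_def)
  obtain V where V: "open V" "snd c' t \<in> V" "\<forall>u\<in>V. f (chart_inv c' u) \<in> fst d'"
    using h(1) by (auto simp: eventually_nhds)
  have "W \<inter> V \<inter> snd c' ` fst c' \<subseteq> W"
    by auto
  from smooth_on_subset[OF W(3) this]
  show "\<exists>W. open W \<and> snd c' t \<in> W \<and> W \<subseteq> snd c' ` fst c' \<and> f ` chart_inv c' ` W \<subseteq> fst d' \<and>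
      smooth_on W (in_charts c' d' f)"
    using W V c' T.open_chart_image[OF c'(1)]
    by (intro exI[of _ "W \<inter> V \<inter> snd c' ` fst c'"]) auto
qed

text \<open>Two maps with the same value at \<open>t\<close> have derivatives that transform by the
  same formula under a change of charts, so agreement in one pair of charts implies agreement in
  all.\<close>

lemma jet_equiv_iff:
  assumes c: "c \<in> AT" "t \<in> fst c" and d: "d \<in> AM" "f t \<in> fst d" and f: "smooth_map f t" and g: "smooth_map g t"
  shows "jet_equiv AT AM t f g \<longleftrightarrow> f t = g t \<and>
    frechet_derivative (in_charts c d f) (at (snd c t)) = frechet_derivative (in_charts c d g) (at (snd c t))"
proof
  assume "jet_equiv AT AM t f g"
  then show "f t = g t \<and>
    frechet_derivative (in_charts c d f) (at (snd c t)) = frechet_derivative (in_charts c d g) (at (snd c t))"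
    using c d unfolding jet_equiv_def by blast
next
  assume h: "f t = g t \<and>
    frechet_derivative (in_charts c d f) (at (snd c t)) = frechet_derivative (in_charts c d g) (at (snd c t))"
  then have gd: "g t \<in> fst d"
    using d by simp
  show "jet_equiv AT AM t f g"
    unfolding jet_equiv_def
  proof (intro conjI ballI impI)
    fix c' d' assume c': "c' \<in> AT" "t \<in> fst c'" and d': "d' \<in> AM" "f t \<in> fst d'"
    then have gd': "g t \<in> fst d'"
      using h by simp
    show "frechet_derivative (in_charts c' d' f) (at (snd c' t)) = frechet_derivative (in_charts c' d' g) (at (snd c' t))"
      using h in_charts_change(3)[OF c c' d d' smooth_map_in_charts[OF c d f]]
        in_charts_change(3)[OF c c' d(1) gd d'(1) gd' smooth_map_in_charts[OF c d(1) gd g]]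
      by simp
  qed (use h in simp)
qed

lemma jet_of_eq_iff:
  assumes "smooth_map f t" "smooth_map g t"
  shows "jet_of AT AM f t = jet_of AT AM g t \<longleftrightarrow> jet_equiv AT AM t f g"
proof
  assume "jet_of AT AM f t = jet_of AT AM g t"
  moreover have "jet_equiv AT AM t g g"
    by (simp add: jet_equiv_def)
  ultimately show "jet_equiv AT AM t f g"
    using assms(2) unfolding jet_of_def by blast
next
  assume h: "jet_equiv AT AM t f g"
  then have "jet_equiv AT AM t f k \<longleftrightarrow> jet_equiv AT AM t g k" for k
    unfolding jet_equiv_def by auto
  then show "jet_of AT AM f t = jet_of AT AM g t"
    by (simp add: jet_of_def)
qed

text \<open>The representative is an arbitrary choice, but it shares value and first derivatives
  with \<open>f\<close> at \<open>t\<close>, which is all that the jet coordinates see.\<close>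

lemma jet_rep_jet_of:
  assumes "smooth_map f t"
  shows "smooth_map (jet_rep (jet_of AT AM f t)) t" "jet_equiv AT AM t f (jet_rep (jet_of AT AM f t))"
proof -
  have "f \<in> snd (jet_of AT AM f t)"
    using assms by (simp add: jet_of_def jet_equiv_def)
  then have "jet_rep (jet_of AT AM f t) \<in> snd (jet_of AT AM f t)"
    unfolding jet_rep_def by (rule someI[of "\<lambda>g. g \<in> snd (jet_of AT AM f t)"])
  then show "smooth_map (jet_rep (jet_of AT AM f t)) t" "jet_equiv AT AM t f (jet_rep (jet_of AT AM f t))"
    by (auto simp: jet_of_def)
qed

lemma fst_jet_of [simp]: "fst (jet_of AT AM f t) = t"
  by (simp add: jet_of_def)

lemma jet_target_jet_of: "smooth_map f t \<Longrightarrow> jet_target (jet_of AT AM f t) = f t"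
  using jet_rep_jet_of[of f t] by (simp add: jet_target_def jet_equiv_def)

lemma jet_rep_jet:
  assumes "e \<in> jets AT AM"
  shows "smooth_map (jet_rep e) (fst e)" "jet_of AT AM (jet_rep e) (fst e) = e"
proof -
  obtain f t where f: "smooth_map f t" "e = jet_of AT AM f t"
    using assms by (auto simp: jets_def)
  show "smooth_map (jet_rep e) (fst e)"
    using jet_rep_jet_of[OF f(1)] by (simp add: f(2))
  show "jet_of AT AM (jet_rep e) (fst e) = e"
    using jet_of_eq_iff[OF f(1) jet_rep_jet_of(1)[OF f(1)]] jet_rep_jet_of(2)[OF f(1)] by (simp add: f(2))
qed

lemma jet_of_in_jets: "smooth_map f t \<Longrightarrow> jet_of AT AM f t \<in> jets AT AM"
  by (auto simp: jets_def)

section \<open>Jet charts and their transition maps\<close>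

abbreviation jet_deriv :: "('a, real^'p) chart \<Rightarrow> ('b, real^'n) chart \<Rightarrow> ('a, 'b) jet \<Rightarrow> real^'p \<Rightarrow> real^'n" where
  "jet_deriv c d e \<equiv> frechet_derivative (in_charts c d (jet_rep e)) (at (snd c (fst e)))"

abbreviation JC :: "('a, real^'p) chart \<Rightarrow> ('b, real^'n) chart \<Rightarrow> (('a, 'b) jet, ('p, 'n) jet_coords) chart" where
  "JC \<equiv> jet_chart AT AM"

abbreviation E :: "(('a, 'b) jet, ('p, 'n) jet_coords) chart set" where
  "E \<equiv> jet_atlas AT AM"

lemma jet_dom_iff: "e \<in> fst (JC c d) \<longleftrightarrow> e \<in> jets AT AM \<and> fst e \<in> fst c \<and> jet_target e \<in> fst d"
  by (auto simp: jet_chart_def)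

lemma jet_chart_apply: "snd (JC c d) e = (snd c (fst e), snd d (jet_target e), matrix (jet_deriv c d e))"
  by (simp add: jet_chart_def matrix_def)

lemma jet_atlasI [intro]: "c \<in> AT \<Longrightarrow> d \<in> AM \<Longrightarrow> JC c d \<in> E"
  unfolding jet_atlas_def by blast

lemma jet_atlasE:
  assumes "K \<in> E"
  obtains c d where "c \<in> AT" "d \<in> AM" "K = JC c d"
  using assms by (auto simp: jet_atlas_def)

lemma carrier_jet_atlas: "carrier E = jets AT AM"
proof
  show "carrier E \<subseteq> jets AT AM"
    by (auto simp: carrier_def jet_dom_iff elim!: jet_atlasE)
  show "jets AT AM \<subseteq> carrier E"
  proof
    fix e assume e: "e \<in> jets AT AM"
    then have "fst e \<in> carrier AT" "jet_target e \<in> carrier AM"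
      using jet_rep_jet(1)[OF e] by (auto simp: smooth_map_near_def jet_target_def)
    then obtain c d where "c \<in> AT" "fst e \<in> fst c" "d \<in> AM" "jet_target e \<in> fst d"
      by (auto simp: carrier_def)
    then show "e \<in> carrier E"
      using e unfolding carrier_def by (auto intro!: bexI[of _ "JC c d"] simp: jet_dom_iff)
  qed
qed

lemma jet_deriv_smooth:
  assumes "c \<in> AT" "d \<in> AM" "e \<in> fst (JC c d)"
  shows "smooth_at (in_charts c d (jet_rep e)) (snd c (fst e))"
  using assms by (intro smooth_map_in_charts(2) jet_rep_jet(1)) (auto simp: jet_dom_iff jet_target_def)

lemma jet_deriv_linear:
  "c \<in> AT \<Longrightarrow> d \<in> AM \<Longrightarrow> e \<in> fst (JC c d) \<Longrightarrow> linear (jet_deriv c d e)"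
  by (intro smooth_at_linear_frechet jet_deriv_smooth)

text \<open>Source and target are fixed by injectivity of \<open>c\<close> and \<open>d\<close>. The
  matrix fixes the derivative because the derivative is linear, and a jet is determined by these
  three data.\<close>

lemma jet_chart_inj:
  assumes c: "c \<in> AT" and d: "d \<in> AM"
  shows "inj_on (snd (JC c d)) (fst (JC c d))"
proof (rule inj_onI)
  fix e e' assume e: "e \<in> fst (JC c d)" and e': "e' \<in> fst (JC c d)" and eq: "snd (JC c d) e = snd (JC c d) e'"
  have t: "fst e = fst e'"
    using eq e e' T.chart_inj[OF c] by (auto simp: jet_chart_apply jet_dom_iff dest: inj_onD)
  have x: "jet_target e = jet_target e'"
    using eq e e' M.chart_inj[OF d] by (auto simp: jet_chart_apply jet_dom_iff dest: inj_onD)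
  have "matrix (jet_deriv c d e) = matrix (jet_deriv c d e')"
    using eq unfolding jet_chart_apply by blast
  then have "jet_deriv c d e = jet_deriv c d e'"
    using jet_deriv_linear[OF c d e] jet_deriv_linear[OF c d e'] by (metis matrix_vector_mul(2))
  moreover have r: "smooth_map (jet_rep e) (fst e)" "smooth_map (jet_rep e') (fst e)"
    using jet_rep_jet(1)[of e] jet_rep_jet(1)[of e'] e e' t by (auto simp: jet_dom_iff)
  ultimately have "jet_equiv AT AM (fst e) (jet_rep e) (jet_rep e')"
    using e x t by (subst jet_equiv_iff[OF c _ d]) (auto simp: jet_dom_iff jet_target_def)
  then have "jet_of AT AM (jet_rep e) (fst e) = jet_of AT AM (jet_rep e') (fst e)"
    using jet_of_eq_iff[OF r] by simp
  moreover have "jet_of AT AM (jet_rep e) (fst e) = e"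
    using e by (intro jet_rep_jet(2)) (simp add: jet_dom_iff)
  moreover have "jet_of AT AM (jet_rep e') (fst e) = e'"
    unfolding t using e' by (intro jet_rep_jet(2)) (simp add: jet_dom_iff)
  ultimately show "e = e'"
    by (simp only:)
qed

text \<open>Every matrix occurs as a derivative, so the image of a jet chart has the full matrix
  space as its fibre; openness of chart images and overlaps follows from this.\<close>

lemma jet_with_coordinates:
  assumes c: "c \<in> AT" and d: "d \<in> AM" and u: "u \<in> snd c ` fst c" and w: "w \<in> snd d ` fst d"
  obtains e where "e \<in> fst (JC c d)" "snd (JC c d) e = (u, w, y)" "fst e = chart_inv c u" "jet_target e = chart_inv d w"
proof -
  define t where "t = chart_inv c u"
  have t: "t \<in> fst c" "snd c t = u"
    using u c by (auto simp: t_def)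
  \<comment> \<open>The map that is affine in the two charts, with value \<open>w\<close> and
    derivative \<open>y\<close> at \<open>u\<close>. Its affine values may leave the image of
    \<open>d\<close> away from \<open>u\<close>, so the formula is exploited only near
    \<open>u\<close>.\<close>
  define f where "f s = chart_inv d (w + y *v (snd c s - u))" for s
  have ft: "f t = chart_inv d w"
    by (simp add: f_def t)
  then have ftd: "f t \<in> fst d"
    using w d by auto
  have sm: "smooth_at (\<lambda>v. w + y *v (v - u)) u"
    by (intro smooth_at_add smooth_at_const smooth_at_linear_compose[of "\<lambda>v. y *v v"] smooth_at_diff smooth_at_ident)
      (rule matrix_vector_mul_linear)
  have "filterlim (\<lambda>v. w + y *v (v - u)) (nhds (w + y *v (u - u))) (nhds u)"
    by (rule isContD[OF smooth_at_continuous[OF sm], THEN tendsto_at_iff_tendsto_nhds[THEN iffD1]])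
  then have "filterlim (\<lambda>v. w + y *v (v - u)) (nhds w) (nhds u)"
    by simp
  from eventually_compose_filterlim[OF M.eventually_chart_image[OF d w] this]
  have ev: "eventually (\<lambda>v. f (chart_inv c v) \<in> fst d \<and> in_charts c d f v = w + y *v (v - u)) (nhds u)"
    using T.eventually_chart_image[OF c u] by eventually_elim (simp add: f_def)
  have 1: "eventually (\<lambda>v. f (chart_inv c v) \<in> fst d) (nhds (snd c t))"
    using ev unfolding t by (auto elim: eventually_mono)
  have ev2: "eventually (\<lambda>v. w + y *v (v - u) = in_charts c d f v) (nhds u)"
    using ev by (auto elim: eventually_mono)
  have 2: "smooth_at (in_charts c d f) (snd c t)"
    unfolding t by (rule smooth_at_cong[OF ev2 sm])
  have f: "smooth_map f t"
    by (rule smooth_mapI[OF c t(1) d ftd 1 2])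
  have "((\<lambda>v. w + y *v (v - u)) has_derivative (\<lambda>v. y *v v)) (at u)"
    using linear_diff[OF matrix_vector_mul_linear[of y]]
    by (auto intro!: derivative_eq_intros linear_imp_has_derivative matrix_vector_mul_linear)
  from frechet_derivative_eq[OF this] frechet_derivative_cong_eventually[OF ev2]
  have fd: "frechet_derivative (in_charts c d f) (at u) = (\<lambda>v. y *v v)"
    by (simp only:)
  define e where "e = jet_of AT AM f t"
  have fe: "fst e = t" "jet_target e = f t" "e \<in> jets AT AM"
    using jet_target_jet_of[OF f] jet_of_in_jets[OF f] by (simp_all add: e_def)
  have "frechet_derivative (in_charts c d f) (at (snd c t)) =
      frechet_derivative (in_charts c d (jet_rep e)) (at (snd c t))"
    using jet_rep_jet_of[OF f] jet_equiv_iff[OF c t(1) d ftd f jet_rep_jet_of(1)[OF f]]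
    by (simp add: e_def)
  then have "jet_deriv c d e = (\<lambda>v. y *v v)"
    using fd unfolding t(2) fe(1) by (rule trans[OF sym])
  then have "matrix (jet_deriv c d e) = y"
    by (simp only: matrix_of_matrix_vector_mul)
  then have "snd (JC c d) e = (u, w, y)"
    using w d by (auto simp: jet_chart_apply fe ft t)
  moreover have "e \<in> fst (JC c d)"
    using fe t ftd by (simp add: jet_dom_iff)
  ultimately show ?thesis
    using that[of e] fe(1,2) ft t_def by simp
qed

text \<open>Stated for subsets \<open>P\<close> and \<open>Q\<close> so that one product formula
  serves chart images, overlaps and preimages of open sets under the projections to \<open>T\<close>
  and \<open>M\<close>.\<close>

lemma jet_chart_image:
  assumes c: "c \<in> AT" and d: "d \<in> AM" and "P \<subseteq> fst c" "Q \<subseteq> fst d"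
  shows "snd (JC c d) ` {e \<in> jets AT AM. fst e \<in> P \<and> jet_target e \<in> Q} = (snd c ` P) \<times> (snd d ` Q) \<times> UNIV"
proof
  show "(snd c ` P) \<times> (snd d ` Q) \<times> UNIV \<subseteq> snd (JC c d) ` {e \<in> jets AT AM. fst e \<in> P \<and> jet_target e \<in> Q}"
  proof
    fix z assume "z \<in> (snd c ` P) \<times> (snd d ` Q) \<times> (UNIV :: (real^'p^'n) set)"
    then obtain s x y where z: "z = (snd c s, snd d x, y)" "s \<in> P" "x \<in> Q"
      by auto
    then have "snd c s \<in> snd c ` fst c" "snd d x \<in> snd d ` fst d"
      using assms by auto
    then obtain e where "e \<in> fst (JC c d)" "snd (JC c d) e = (snd c s, snd d x, y)"
      "fst e = chart_inv c (snd c s)" "jet_target e = chart_inv d (snd d x)"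
      using jet_with_coordinates[OF c d] by metis
    moreover have "s \<in> fst c" "x \<in> fst d"
      using z assms by auto
    ultimately show "z \<in> snd (JC c d) ` {e \<in> jets AT AM. fst e \<in> P \<and> jet_target e \<in> Q}"
      using z c d by (intro image_eqI[of _ _ e]) (auto simp: jet_dom_iff)
  qed
qed (auto simp: jet_chart_apply)

text \<open>The third component is the coordinate rule for first derivatives: \<open>y\<close> is
  preceded by the derivative of the inverse transition on \<open>T\<close>, taken at the new base
  point, and followed by the derivative of the transition on \<open>M\<close>.\<close>

abbreviation jet_trans :: "('a, real^'p) chart \<Rightarrow> ('b, real^'n) chart \<Rightarrow> ('a, real^'p) chart \<Rightarrow> ('b, real^'n) chart
    \<Rightarrow> ('p, 'n) jet_coords \<Rightarrow> ('p, 'n) jet_coords" where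
  "jet_trans c d c' d' \<equiv> \<lambda>(u, w, y). ((snd c' \<circ> chart_inv c) u, (snd d' \<circ> chart_inv d) w,
     \<chi> j \<beta>. frechet_derivative (snd d' \<circ> chart_inv d) (at w)
       (y *v frechet_derivative (snd c \<circ> chart_inv c') (at ((snd c' \<circ> chart_inv c) u)) (axis \<beta> 1)) $ j)"

lemma jet_chart_change:
  assumes c: "c \<in> AT" "c' \<in> AT" and d: "d \<in> AM" "d' \<in> AM" and e: "e \<in> fst (JC c d)" "e \<in> fst (JC c' d')"
  shows "snd (JC c' d') e = jet_trans c d c' d' (snd (JC c d) e)"
proof -
  have t: "fst e \<in> fst c" "fst e \<in> fst c'" and x: "jet_rep e (fst e) \<in> fst d" "jet_rep e (fst e) \<in> fst d'"
    and f: "smooth_map (jet_rep e) (fst e)"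
    using e jet_rep_jet(1) by (auto simp: jet_dom_iff jet_target_def)
  show ?thesis
    using c d t x in_charts_change(3)[OF c(1) t(1) c(2) t(2) d(1) x(1) d(2) x(2) smooth_map_in_charts[OF c(1) t(1) d(1) x(1) f]]
    by (simp add: jet_chart_apply matrix_def[of "_ \<circ> _"]
        matrix_vector_mul(2)[OF jet_deriv_linear[OF c(1) d(1) e(1)], THEN fun_cong] jet_target_def vec_eq_iff)
qed

lemma smooth_at_jet_trans:
  assumes c: "c \<in> AT" "c' \<in> AT" "t \<in> fst c" "t \<in> fst c'" and d: "d \<in> AM" "d' \<in> AM" "x \<in> fst d" "x \<in> fst d'"
  shows "smooth_at (jet_trans c d c' d') (snd c t, snd d x, y)"
proof -
  let ?z = "(snd c t, snd d x, y)"
  have 1: "smooth_at (\<lambda>z. fst z) ?z" "smooth_at (\<lambda>z. fst (snd z)) ?z" "smooth_at (\<lambda>z. snd (snd z)) ?z"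
    by (intro smooth_at_linear linearI; simp)+
  have 2: "smooth_at (\<lambda>z. (snd c' \<circ> chart_inv c) (fst z)) ?z"
    by (rule smooth_at_compose[OF 1(1), where g = "snd c' \<circ> chart_inv c"]) (use T.smooth_transition[OF c] in simp)
  have 3: "smooth_at (\<lambda>z. (snd d' \<circ> chart_inv d) (fst (snd z))) ?z"
    by (rule smooth_at_compose[OF 1(2), where g = "snd d' \<circ> chart_inv d"]) (use M.smooth_transition[OF d] in simp)
  have 4: "smooth_at (\<lambda>z. frechet_derivative (snd c \<circ> chart_inv c') (at ((snd c' \<circ> chart_inv c) (fst z))) (axis \<beta> 1)) ?z" for \<beta>
    by (rule smooth_at_frechet_derivative_compose[OF _ 2 smooth_at_const])
      (use T.smooth_transition[OF c(2,1,4,3)] c in simp)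
  have "bilinear ((*v) :: real^'p^'n \<Rightarrow> real^'p \<Rightarrow> real^'n)"
    unfolding bilinear_def
    by (auto intro!: linearI simp: matrix_vector_mult_add_rdistrib matrix_vector_right_distrib
        scaleR_matrix_vector_assoc matrix_vector_mult_scaleR)
  then have bl: "bounded_bilinear ((*v) :: real^'p^'n \<Rightarrow> real^'p \<Rightarrow> real^'n)"
    by (simp add: bilinear_conv_bounded_bilinear)
  have 5: "smooth_at (\<lambda>z. frechet_derivative (snd d' \<circ> chart_inv d) (at (fst (snd z)))
       (snd (snd z) *v frechet_derivative (snd c \<circ> chart_inv c') (at ((snd c' \<circ> chart_inv c) (fst z))) (axis \<beta> 1)) $ j) ?z" for \<beta> j
    by (rule smooth_at_linear_compose[OF _ smooth_at_frechet_derivative_compose[OF _ 1(2) smooth_at_bilinear[OF bl 1(3) 4]], of "\<lambda>v. v $ j"])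
      (use M.smooth_transition[OF d] in \<open>auto intro!: linearI\<close>)
  show ?thesis
    unfolding split_def by (intro smooth_at_Pair 2 3 smooth_at_vec_lambda 5)
qed

lemma jet_dom_overlap:
  "fst (JC c d) \<inter> fst (JC c' d') = {e \<in> jets AT AM. fst e \<in> fst c \<inter> fst c' \<and> jet_target e \<in> fst d \<inter> fst d'}"
  by (auto simp: jet_dom_iff)

lemma smooth_atlas_jet_atlas: "smooth_atlas E"
proof
  fix K K' :: "(('a, 'b) jet, ('p, 'n) jet_coords) chart" and e
  assume "K \<in> E"
  then obtain c d where c: "c \<in> AT" and d: "d \<in> AM" and K: "K = JC c d"
    by (rule jet_atlasE)
  show inj: "inj_on (snd K) (fst K)"
    unfolding K by (rule jet_chart_inj[OF c d])
  show "open (snd K ` fst K)"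
    using jet_chart_image[OF c d, of "fst c" "fst d"] jet_dom_overlap[of c d c d]
    by (simp add: K open_Times T.open_chart_image[OF c] M.open_chart_image[OF d])
  assume "K' \<in> E"
  then obtain c' d' where c': "c' \<in> AT" and d': "d' \<in> AM" and K': "K' = JC c' d'"
    by (rule jet_atlasE)
  show op: "open (snd K ` (fst K \<inter> fst K'))"
    using jet_chart_image[OF c d, of "fst c \<inter> fst c'" "fst d \<inter> fst d'"] jet_dom_overlap[of c d c' d']
    by (simp add: K K' open_Times T.open_overlap[OF c c'] M.open_overlap[OF d d'])
  assume e: "e \<in> fst K" "e \<in> fst K'"
  have "eventually (\<lambda>z. z \<in> snd K ` (fst K \<inter> fst K')) (nhds (snd K e))"
    using e by (intro eventually_nhds_in_open op) auto
  then have "eventually (\<lambda>z. jet_trans c d c' d' z = (snd K' \<circ> chart_inv K) z) (nhds (snd K e))"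
  proof eventually_elim
    case (elim z)
    then obtain e' where e': "e' \<in> fst K" "e' \<in> fst K'" "z = snd K e'"
      by auto
    then have "chart_inv K z = e'"
      using inj by (simp add: chart_inv_def)
    then show ?case
      using jet_chart_change[OF c c' d d'] e' by (simp add: K K')
  qed
  then show "smooth_at (snd K' \<circ> chart_inv K) (snd K e)"
    by (rule smooth_at_cong)
      (use e smooth_at_jet_trans[OF c c' _ _ d d'] in \<open>simp add: K K' jet_dom_iff jet_chart_apply del: split_conv\<close>)
qed

text \<open>Jets with different source or target are separated by preimages of open sets of
  \<open>T\<close> or \<open>M\<close>. Jets over the same pair of points share a jet chart and are
  separated by their coordinates there.\<close>

lemma Hausdorff_jet_atlas: "Hausdorff_space (manifold_topology E)"
proof -
  interpret J: smooth_atlas E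
    by (rule smooth_atlas_jet_atlas)
  have pre: "openin (manifold_topology E) {e \<in> jets AT AM. fst e \<in> P \<and> jet_target e \<in> Q}"
    if P: "openin (manifold_topology AT) P" and Q: "openin (manifold_topology AM) Q" for P Q
    unfolding J.openin_manifold_topology
  proof (intro conjI ballI)
    show "{e \<in> jets AT AM. fst e \<in> P \<and> jet_target e \<in> Q} \<subseteq> carrier E"
      by (auto simp: carrier_jet_atlas)
    fix K assume "K \<in> E"
    then obtain c d where c: "c \<in> AT" and d: "d \<in> AM" and K: "K = JC c d"
      by (rule jet_atlasE)
    have "{e \<in> jets AT AM. fst e \<in> P \<and> jet_target e \<in> Q} \<inter> fst K =
        {e \<in> jets AT AM. fst e \<in> P \<inter> fst c \<and> jet_target e \<in> Q \<inter> fst d}"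
      by (auto simp: K jet_dom_iff)
    then show "open (snd K ` ({e \<in> jets AT AM. fst e \<in> P \<and> jet_target e \<in> Q} \<inter> fst K))"
      using P Q c d jet_chart_image[OF c d, of "P \<inter> fst c" "Q \<inter> fst d"]
      by (simp add: K open_Times T.openin_manifold_topology M.openin_manifold_topology)
  qed
  show ?thesis
    unfolding Hausdorff_space_def J.topspace_manifold_topology carrier_jet_atlas
  proof (intro allI impI, elim conjE)
    fix e e' assume e: "e \<in> jets AT AM" "e' \<in> jets AT AM" "e \<noteq> e'"
    have cT: "fst x \<in> carrier AT" "jet_target x \<in> carrier AM" if "x \<in> jets AT AM" for x
      using jet_rep_jet(1)[OF that] by (auto simp: smooth_map_near_def jet_target_def)
    have oT: "openin (manifold_topology AT) (carrier AT)"
      using openin_topspace[of "manifold_topology AT"] by (simp add: T.topspace_manifold_topology)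
    have oM: "openin (manifold_topology AM) (carrier AM)"
      using openin_topspace[of "manifold_topology AM"] by (simp add: M.topspace_manifold_topology)
    consider "fst e \<noteq> fst e'" | "jet_target e \<noteq> jet_target e'"
      | "fst e = fst e'" "jet_target e = jet_target e'"
      by blast
    then show "\<exists>U V. openin (manifold_topology E) U \<and> openin (manifold_topology E) V \<and> e \<in> U \<and> e' \<in> V \<and> disjnt U V"
    proof cases
      case 1
      then obtain U V where U: "openin (manifold_topology AT) U" "openin (manifold_topology AT) V"
        "fst e \<in> U" "fst e' \<in> V" "disjnt U V"
        using T.Hausdorff e cT unfolding Hausdorff_space_def T.topspace_manifold_topology by metis
      show ?thesis
        using pre[OF U(1) oM] pre[OF U(2) oM] U(3-5) e cT
        by (intro exI[of _ "{e \<in> jets AT AM. fst e \<in> U \<and> jet_target e \<in> carrier AM}"]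
            exI[of _ "{e \<in> jets AT AM. fst e \<in> V \<and> jet_target e \<in> carrier AM}"])
          (auto simp: disjnt_iff)
    next
      case 2
      then obtain U V where U: "openin (manifold_topology AM) U" "openin (manifold_topology AM) V"
        "jet_target e \<in> U" "jet_target e' \<in> V" "disjnt U V"
        using M.Hausdorff e cT unfolding Hausdorff_space_def M.topspace_manifold_topology by metis
      show ?thesis
        using pre[OF oT U(1)] pre[OF oT U(2)] U(3-5) e cT
        by (intro exI[of _ "{e \<in> jets AT AM. fst e \<in> carrier AT \<and> jet_target e \<in> U}"]
            exI[of _ "{e \<in> jets AT AM. fst e \<in> carrier AT \<and> jet_target e \<in> V}"])
          (auto simp: disjnt_iff)
    next
      case 3
      obtain c d where c: "c \<in> AT" "fst e \<in> fst c" and d: "d \<in> AM" "jet_target e \<in> fst d"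
        using cT[OF e(1)] by (auto simp: carrier_def)
      have dom: "e \<in> fst (JC c d)" "e' \<in> fst (JC c d)"
        using e c d 3 by (auto simp: jet_dom_iff)
      then have "snd (JC c d) e \<noteq> snd (JC c d) e'"
        using e(3) jet_chart_inj[OF c(1) d(1)] by (auto dest: inj_onD)
      then obtain U V where U: "open U" "open V" "snd (JC c d) e \<in> U" "snd (JC c d) e' \<in> V" "U \<inter> V = {}"
        using hausdorff by metis
      show ?thesis
        using J.openin_chart_preimage[OF jet_atlasI[OF c(1) d(1)] U(1)]
          J.openin_chart_preimage[OF jet_atlasI[OF c(1) d(1)] U(2)] U(3-5) dom
        by (intro exI[of _ "{x \<in> fst (JC c d). snd (JC c d) x \<in> U}"]
            exI[of _ "{x \<in> fst (JC c d). snd (JC c d) x \<in> V}"])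
          (auto simp: disjnt_iff)
    qed
  qed
qed

sublocale J: Hausdorff_atlas E
  by (intro Hausdorff_atlas.intro Hausdorff_atlas_axioms.intro smooth_atlas_jet_atlas Hausdorff_jet_atlas)

end

section \<open>The adapted frame\<close>

lemma frechet_derivative_linear_compose:
  fixes L :: "'v::euclidean_space \<Rightarrow> 'w::real_normed_vector" and f :: "'u::real_normed_vector \<Rightarrow> 'v"
  assumes "linear L" and "smooth_at f x"
  shows "frechet_derivative (\<lambda>y. L (f y)) (at x) = (\<lambda>v. L (frechet_derivative f (at x) v))"
proof -
  have "bounded_linear L"
    using assms(1) by (simp add: linear_conv_bounded_linear)
  from frechet_derivative_eq[OF bounded_linear.has_derivative[OF this smooth_at_has_derivative[OF assms(2)]]]
  show ?thesis .
qed

lemma linear_axis_expand: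
  fixes f :: "real^'k::finite \<Rightarrow> real^'l::finite"
  assumes "linear f"
  shows "f v $ j = (\<Sum>k\<in>UNIV. v $ k * f (axis k 1) $ j)"
proof -
  have "f v = matrix f *v v"
    using fun_cong[OF matrix_vector_mul(2)[OF assms], of v] by simp
  then show ?thesis
    by (simp add: matrix_vector_mult_def matrix_def mult.commute)
qed

lemma matrix_axis_expand:
  fixes z :: "real^'p::finite^'n::finite"
  shows "z = (\<Sum>j\<in>UNIV. \<Sum>\<beta>\<in>UNIV. z $ j $ \<beta> *\<^sub>R axis j (axis \<beta> 1))"
proof -
  have "(\<Sum>j\<in>UNIV. \<Sum>\<beta>\<in>UNIV. z $ j $ \<beta> *\<^sub>R axis j (axis \<beta> 1)) $ i $ \<alpha> =
      (\<Sum>j\<in>UNIV. if j = i then \<Sum>\<beta>\<in>UNIV. if \<beta> = \<alpha> then z $ j $ \<beta> else 0 else 0)" for i \<alpha>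
    unfolding sum_component
  proof (rule sum.cong[OF refl])
    fix j
    show "(\<Sum>\<beta>\<in>UNIV. (z $ j $ \<beta> *\<^sub>R axis j (axis \<beta> 1)) $ i $ \<alpha>) =
        (if j = i then \<Sum>\<beta>\<in>UNIV. if \<beta> = \<alpha> then z $ j $ \<beta> else 0 else 0)"
      by (cases "j = i") (simp_all add: axis_def if_distrib cong: if_cong)
  qed
  then show ?thesis
    by (simp add: vec_eq_iff)
qed

lemma (in smooth_atlas) dir_vec_zero_fun: "c \<in> A \<Longrightarrow> x \<in> fst c \<Longrightarrow> dir_vec A c b x (\<lambda>y. 0) = 0"
  by (simp add: dir_vec_def comp_def)

context jet_space
begin

section \<open>The Jacobian of a change of jet coordinates\<close>

abbreviation jet_jac :: "('a, real^'p) chart \<Rightarrow> ('b, real^'n) chart \<Rightarrow> ('a, real^'p) chart \<Rightarrow> ('b, real^'n) chart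
    \<Rightarrow> ('a, 'b) jet \<Rightarrow> ('p, 'n) jet_coords \<Rightarrow> ('p, 'n) jet_coords" where
  "jet_jac c d c' d' e \<equiv> frechet_derivative (snd (JC c' d') \<circ> chart_inv (JC c d)) (at (snd (JC c d) e))"

lemma jet_trans_eventually:
  assumes c: "c \<in> AT" "c' \<in> AT" and d: "d \<in> AM" "d' \<in> AM" and e: "e \<in> fst (JC c d)" "e \<in> fst (JC c' d')"
  shows "eventually (\<lambda>z. (snd (JC c' d') \<circ> chart_inv (JC c d)) z = jet_trans c d c' d' z) (nhds (snd (JC c d) e))"
  using J.eventually_overlap[OF jet_atlasI[OF c(1) d(1)] jet_atlasI[OF c(2) d(2)] e]
  by eventually_elim (use jet_chart_change[OF c d] in \<open>simp del: split_conv\<close>)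

text \<open>Block triangular form: source and target coordinates transform among themselves, and the
  vertical block is explicit. The remaining entries of the last row stay implicit; they occur in the
  rules of \<Gamma> as derivatives of \<open>coord_v\<close>.\<close>

lemma jet_jac:
  assumes c: "c \<in> AT" "c' \<in> AT" and d: "d \<in> AM" "d' \<in> AM" and e: "e \<in> fst (JC c d)" "e \<in> fst (JC c' d')"
  defines "D\<phi> \<equiv> frechet_derivative (snd c' \<circ> chart_inv c) (at (snd c (fst e)))"
    and "D\<psi> \<equiv> frechet_derivative (snd d' \<circ> chart_inv d) (at (snd d (jet_target e)))"
    and "D\<theta> \<equiv> frechet_derivative (snd c \<circ> chart_inv c') (at (snd c' (fst e)))"
  shows "linear (jet_jac c d c' d' e)"
    and "linear D\<phi>" and "linear D\<psi>"
    and "fst (jet_jac c d c' d' e v) = D\<phi> (fst v)"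
    and "fst (snd (jet_jac c d c' d' e v)) = D\<psi> (fst (snd v))"
    and "snd (snd (jet_jac c d c' d' e (0, 0, z))) $ j $ \<beta> =
      (\<Sum>k\<in>UNIV. \<Sum>\<gamma>\<in>UNIV. z $ k $ \<gamma> * D\<psi> (axis k 1) $ j * D\<theta> (axis \<beta> 1) $ \<gamma>)"
proof -
  have t: "fst e \<in> fst c" "fst e \<in> fst c'" and x: "jet_target e \<in> fst d" "jet_target e \<in> fst d'"
    using e by (auto simp: jet_dom_iff)
  let ?K = "JC c d" and ?F = "snd (JC c' d') \<circ> chart_inv (JC c d)" and ?z = "snd (JC c d) e"
  let ?D = "jet_jac c d c' d' e"
  have sF: "smooth_at ?F ?z"
    by (rule J.smooth_transition[OF jet_atlasI[OF c(1) d(1)] jet_atlasI[OF c(2) d(2)] e])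
  show "linear ?D"
    by (rule smooth_at_linear_frechet[OF sF])
  have s\<phi>: "smooth_at (snd c' \<circ> chart_inv c) (snd c (fst e))"
    by (rule T.smooth_transition[OF c t])
  have s\<psi>: "smooth_at (snd d' \<circ> chart_inv d) (snd d (jet_target e))"
    by (rule M.smooth_transition[OF d x])
  show l\<phi>: "linear D\<phi>" and l\<psi>: "linear D\<psi>"
    unfolding D\<phi>_def D\<psi>_def by (intro smooth_at_linear_frechet s\<phi> s\<psi>)+
  note dF = smooth_at_has_derivative[OF sF]
  note ev = jet_trans_eventually[OF c d e]
  have dfst: "((\<lambda>z. (snd c' \<circ> chart_inv c) (fst z)) has_derivative (\<lambda>v. D\<phi> (fst v))) (at ?z)"
    by (rule has_derivative_compose[OF has_derivative_fst[OF has_derivative_ident]])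
      (use smooth_at_has_derivative[OF s\<phi>] in \<open>simp only: D\<phi>_def jet_chart_apply fst_conv\<close>)
  have "eventually (\<lambda>z. fst (?F z) = (snd c' \<circ> chart_inv c) (fst z)) (nhds ?z)"
    using ev by eventually_elim (simp add: split_def)
  with dfst have "((\<lambda>z. fst (?F z)) has_derivative (\<lambda>v. D\<phi> (fst v))) (at ?z)"
    by (simp only: has_derivative_cong_eventually)
  from has_derivative_unique[OF has_derivative_fst[OF dF] this]
  show "fst (?D v) = D\<phi> (fst v)"
    by (rule fun_cong)
  have dsnd: "((\<lambda>z. (snd d' \<circ> chart_inv d) (fst (snd z))) has_derivative (\<lambda>v. D\<psi> (fst (snd v)))) (at ?z)"
    by (rule has_derivative_compose[OF has_derivative_fst[OF has_derivative_snd[OF has_derivative_ident]]])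
      (use smooth_at_has_derivative[OF s\<psi>] in \<open>simp only: D\<psi>_def jet_chart_apply fst_conv snd_conv\<close>)
  have "eventually (\<lambda>z. fst (snd (?F z)) = (snd d' \<circ> chart_inv d) (fst (snd z))) (nhds ?z)"
    using ev by eventually_elim (simp add: split_def)
  with dsnd have "((\<lambda>z. fst (snd (?F z))) has_derivative (\<lambda>v. D\<psi> (fst (snd v)))) (at ?z)"
    by (simp only: has_derivative_cong_eventually)
  from has_derivative_unique[OF has_derivative_fst[OF has_derivative_snd[OF dF]] this]
  show "fst (snd (?D v)) = D\<psi> (fst (snd v))"
    by (rule fun_cong)
  \<comment> \<open>With source and target coordinates held fixed, the last component of the
    transition is the linear map \<open>L\<close> of \<open>y\<close>, so its derivative along the
    fibre is \<open>L\<close> itself.\<close>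
  define L where "L y = (\<chi> j \<beta>. D\<psi> (y *v D\<theta> (axis \<beta> 1)) $ j)" for y :: "real^'p^'n"
  let ?y = "matrix (jet_deriv c d e)"
  let ?i = "\<lambda>y. (snd c (fst e), snd d (jet_target e), y :: real^'p^'n)"
  have L: "linear L"
    by (rule linearI)
      (simp_all add: L_def vec_eq_iff matrix_vector_mult_add_rdistrib linear_add[OF l\<psi>]
        scaleR_matrix_vector_assoc[symmetric] linear_cmul[OF l\<psi>])
  have di: "(?i has_derivative (\<lambda>y. (0, 0, y))) (at ?y)"
    by (auto intro!: derivative_eq_intros)
  have "(?F has_derivative ?D) (at (?i ?y))"
    using dF by (simp add: jet_chart_apply)
  from has_derivative_snd[OF has_derivative_snd[OF has_derivative_compose[OF di this]]]
  have d1: "((\<lambda>y. snd (snd (?F (?i y)))) has_derivative (\<lambda>y. snd (snd (?D (0, 0, y))))) (at ?y)" .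
  have "isCont ?i ?y"
    using di by (rule has_derivative_continuous)
  then have "filterlim ?i (nhds (?i ?y)) (nhds ?y)"
    by (rule isContD[THEN tendsto_at_iff_tendsto_nhds[THEN iffD1]])
  then have "filterlim ?i (nhds ?z) (nhds ?y)"
    by (simp only: jet_chart_apply)
  from eventually_compose_filterlim[OF ev this]
  have "eventually (\<lambda>y. snd (snd (?F (?i y))) = L y) (nhds ?y)"
    by eventually_elim (use c t in \<open>simp add: L_def D\<psi>_def D\<theta>_def\<close>)
  moreover have "(L has_derivative L) (at ?y)"
    by (rule linear_imp_has_derivative[OF L])
  ultimately have d2: "((\<lambda>y. snd (snd (?F (?i y)))) has_derivative L) (at ?y)"
    by (simp only: has_derivative_cong_eventually)
  have "snd (snd (?D (0, 0, z))) = L z"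
    using fun_cong[OF has_derivative_unique[OF d1 d2]] .
  then have "snd (snd (?D (0, 0, z))) $ j $ \<beta> = D\<psi> (z *v D\<theta> (axis \<beta> 1)) $ j"
    by (simp add: L_def)
  also have "\<dots> = (\<Sum>k\<in>UNIV. (z *v D\<theta> (axis \<beta> 1)) $ k * D\<psi> (axis k 1) $ j)"
    by (rule linear_axis_expand[OF l\<psi>])
  finally show "snd (snd (?D (0, 0, z))) $ j $ \<beta> =
      (\<Sum>k\<in>UNIV. \<Sum>\<gamma>\<in>UNIV. z $ k $ \<gamma> * D\<psi> (axis k 1) $ j * D\<theta> (axis \<beta> 1) $ \<gamma>)"
    by (simp add: matrix_vector_mult_def sum_distrib_left sum_distrib_right ac_simps)
qed

text \<open>Links the Jacobian entries in \<open>nonlinear_connection\<close>, written there as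
  derivatives of coordinate functions on \<open>E\<close>, to the entries of
  \<open>jet_jac\<close>.\<close>

lemma partial_coordinates:
  assumes c: "c \<in> AT" "c' \<in> AT" and d: "d \<in> AM" "d' \<in> AM" and e: "e \<in> fst (JC c d)" "e \<in> fst (JC c' d')"
  shows "dir_vec E (JC c d) b e (coord_t AT AM c' d' \<mu>) = fst (jet_jac c d c' d' e b) $ \<mu>"
    and "dir_vec E (JC c d) b e (coord_x AT AM c' d' i) = fst (snd (jet_jac c d c' d' e b)) $ i"
    and "dir_vec E (JC c d) b e (coord_v AT AM c' d' i \<mu>) = snd (snd (jet_jac c d c' d' e b)) $ i $ \<mu>"
proof -
  have *: "dir_vec E (JC c d) b e (\<lambda>y. snd (JC c' d') y \<bullet> w) = jet_jac c d c' d' e b \<bullet> w" for w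
    unfolding J.dir_vec_change_chart[OF jet_atlasI[OF c(1) d(1)] jet_atlasI[OF c(2) d(2)] e]
    by (rule J.smooth_near_coordinate(2)[OF jet_atlasI[OF c(2) d(2)] e(2)])
  show "dir_vec E (JC c d) b e (coord_t AT AM c' d' \<mu>) = fst (jet_jac c d c' d' e b) $ \<mu>"
    using *[of "(axis \<mu> 1, 0, 0)"] by (simp add: coord_t_def[abs_def] inner_prod_def inner_axis)
  show "dir_vec E (JC c d) b e (coord_x AT AM c' d' i) = fst (snd (jet_jac c d c' d' e b)) $ i"
    using *[of "(0, axis i 1, 0)"] by (simp add: coord_x_def[abs_def] inner_prod_def inner_axis)
  show "dir_vec E (JC c d) b e (coord_v AT AM c' d' i \<mu>) = snd (snd (jet_jac c d c' d' e b)) $ i $ \<mu>"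
    using *[of "(0, 0, axis i (axis \<mu> 1))"] by (simp add: coord_v_def[abs_def] inner_prod_def inner_axis)
qed

lemma sum_partial_v:
  assumes c: "c \<in> AT" and d: "d \<in> AM" and e: "e \<in> fst (JC c d)"
  shows "(\<Sum>j\<in>UNIV. \<Sum>\<beta>\<in>UNIV. a j \<beta> * partial_v AT AM c d j \<beta> e f) =
    dir_vec E (JC c d) (0, 0, \<chi> j \<beta>. a j \<beta>) e f"
proof -
  have l: "linear (\<lambda>b. dir_vec E (JC c d) b e f)"
    by (rule J.linear_dir_vec[OF jet_atlasI[OF c d] e])
  have "linear (\<lambda>z. dir_vec E (JC c d) (0, 0, z) e f)"
    using linear_compose[OF _ l, of "\<lambda>z. (0, 0, z)"] by (simp add: o_def linear_iff)
  note l = linear_sum[OF this] linear_cmul[OF this]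
  show ?thesis
    by (subst matrix_axis_expand[of "\<chi> j \<beta>. a j \<beta>"]) (simp add: l partial_v_def)
qed

section \<open>Horizontal lifts, the three distributions and their projections\<close>

definition lift_t :: "('a, 'b, 'p, 'n) M_family \<Rightarrow> ('a, real^'p) chart \<Rightarrow> ('b, real^'n) chart \<Rightarrow> ('a, 'b) jet
    \<Rightarrow> real^'p \<Rightarrow> ('p, 'n) jet_coords" where
  "lift_t M c d e a = (a, 0, - (\<chi> j \<beta>. \<Sum>\<alpha>\<in>UNIV. a $ \<alpha> * M c d j \<beta> \<alpha> e))"

definition lift_x :: "('a, 'b, 'p, 'n) N_family \<Rightarrow> ('a, real^'p) chart \<Rightarrow> ('b, real^'n) chart \<Rightarrow> ('a, 'b) jet
    \<Rightarrow> real^'n \<Rightarrow> ('p, 'n) jet_coords" where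
  "lift_x N c d e b = (0, b, - (\<chi> j \<beta>. \<Sum>i\<in>UNIV. b $ i * N c d j \<beta> i e))"

lemma linear_lift_t: "linear (lift_t M c d e)"
  by (rule linearI)
    (simp_all add: lift_t_def vec_eq_iff distrib_right sum.distrib sum_distrib_left mult.assoc)

lemma linear_lift_x: "linear (lift_x N c d e)"
  by (rule linearI)
    (simp_all add: lift_x_def vec_eq_iff distrib_right sum.distrib sum_distrib_left mult.assoc)

lemma sum_axis_mult: "(\<Sum>\<alpha>\<in>UNIV. axis \<beta> (1::real) $ \<alpha> * g \<alpha>) = g \<beta>"
  by (simp add: axis_def if_distrib[of "\<lambda>x. x * _"] cong: if_cong)

text \<open>Two forms for two purposes: the first separates the constant part of the field, as the
  bracket computation requires; the second is linear in the basis vector, as the description of the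
  span requires.\<close>

lemma delta_t_eq:
  assumes "c \<in> AT" "d \<in> AM" "e \<in> fst (JC c d)"
  shows "delta_t AT AM M c d \<alpha> e = dir_vec E (JC c d) ((axis \<alpha> 1, 0, 0) - (0, 0, \<chi> j \<beta>. M c d j \<beta> \<alpha> e)) e"
    and "delta_t AT AM M c d \<alpha> e = dir_vec E (JC c d) (lift_t M c d e (axis \<alpha> 1)) e"
proof -
  show 1: "delta_t AT AM M c d \<alpha> e = dir_vec E (JC c d) ((axis \<alpha> 1, 0, 0) - (0, 0, \<chi> j \<beta>. M c d j \<beta> \<alpha> e)) e"
    unfolding fun_eq_iff linear_diff[OF J.linear_dir_vec[OF jet_atlasI[OF assms(1,2)] assms(3)]]
    by (simp add: delta_t_def sum_partial_v[OF assms] partial_t_def)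
  have "lift_t M c d e (axis \<alpha> 1) = (axis \<alpha> 1, 0, 0) - (0, 0, \<chi> j \<beta>. M c d j \<beta> \<alpha> e)"
    by (simp add: lift_t_def sum_axis_mult)
  then show "delta_t AT AM M c d \<alpha> e = dir_vec E (JC c d) (lift_t M c d e (axis \<alpha> 1)) e"
    using 1 by simp
qed

lemma delta_x_eq:
  assumes "c \<in> AT" "d \<in> AM" "e \<in> fst (JC c d)"
  shows "delta_x AT AM N c d i e = dir_vec E (JC c d) ((0, axis i 1, 0) - (0, 0, \<chi> j \<beta>. N c d j \<beta> i e)) e"
    and "delta_x AT AM N c d i e = dir_vec E (JC c d) (lift_x N c d e (axis i 1)) e"
proof -
  show 1: "delta_x AT AM N c d i e = dir_vec E (JC c d) ((0, axis i 1, 0) - (0, 0, \<chi> j \<beta>. N c d j \<beta> i e)) e"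
    unfolding fun_eq_iff linear_diff[OF J.linear_dir_vec[OF jet_atlasI[OF assms(1,2)] assms(3)]]
    by (simp add: delta_x_def sum_partial_v[OF assms] partial_x_def)
  have "lift_x N c d e (axis i 1) = (0, axis i 1, 0) - (0, 0, \<chi> j \<beta>. N c d j \<beta> i e)"
    by (simp add: lift_x_def sum_axis_mult)
  then show "delta_x AT AM N c d i e = dir_vec E (JC c d) (lift_x N c d e (axis i 1)) e"
    using 1 by simp
qed

lemma linear_sum_axis:
  fixes g :: "real^'k::finite \<Rightarrow> real"
  assumes "linear g"
  shows "(\<Sum>\<alpha>\<in>UNIV. a \<alpha> * g (axis \<alpha> 1)) = g (\<chi> \<alpha>. a \<alpha>)"
proof -
  have "(\<chi> \<alpha>. a \<alpha>) = (\<Sum>\<alpha>\<in>UNIV. a \<alpha> *\<^sub>R axis \<alpha> 1)"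
    by (simp add: vec_eq_iff axis_def if_distrib cong: if_cong)
  then show ?thesis
    by (simp add: linear_sum[OF assms] linear_cmul[OF assms])
qed

lemma sum_delta_t:
  assumes "c \<in> AT" "d \<in> AM" "e \<in> fst (JC c d)"
  shows "(\<Sum>\<alpha>\<in>UNIV. a \<alpha> * delta_t AT AM M c d \<alpha> e f) = dir_vec E (JC c d) (lift_t M c d e (\<chi> \<alpha>. a \<alpha>)) e f"
  unfolding delta_t_eq(2)[OF assms]
  by (rule linear_sum_axis, rule linear_compose[OF linear_lift_t J.linear_dir_vec[OF jet_atlasI[OF assms(1,2)] assms(3)], unfolded o_def])

lemma sum_delta_x:
  assumes "c \<in> AT" "d \<in> AM" "e \<in> fst (JC c d)"
  shows "(\<Sum>i\<in>UNIV. a i * delta_x AT AM N c d i e f) = dir_vec E (JC c d) (lift_x N c d e (\<chi> i. a i)) e f"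
  unfolding delta_x_eq(2)[OF assms]
  by (rule linear_sum_axis, rule linear_compose[OF linear_lift_x J.linear_dir_vec[OF jet_atlasI[OF assms(1,2)] assms(3)], unfolded o_def])

lemma linear_eq_axis:
  fixes f g :: "real^'k::finite \<Rightarrow> 'w::real_vector"
  assumes "linear f" "linear g" "\<And>\<alpha>. f (axis \<alpha> 1) = g (axis \<alpha> 1)"
  shows "f = g"
  by (rule linear_eq_stdbasis[OF assms(1,2)]) (use assms(3) in \<open>auto simp: Basis_vec_def\<close>)

text \<open>Both sides are linear in \<open>a\<close>, so axis vectors suffice. There the last
  component of the equation is the transformation rule of \<open>M\<close> with its terms regrouped,
  and the other components follow from the block form of the Jacobian.\<close>

lemma jet_jac_lift_t:
  assumes c: "c \<in> AT" "c' \<in> AT" and d: "d \<in> AM" "d' \<in> AM" and e: "e \<in> fst (JC c d)" "e \<in> fst (JC c' d')"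
    and NC: "nonlinear_connection AT AM M N"
  shows "jet_jac c d c' d' e (lift_t M c d e a) =
    lift_t M c' d' e (frechet_derivative (snd c' \<circ> chart_inv c) (at (snd c (fst e))) a)"
proof -
  let ?D = "jet_jac c d c' d' e" and ?\<phi> = "frechet_derivative (snd c' \<circ> chart_inv c) (at (snd c (fst e)))"
  note J1 = jet_jac[OF c d e] and J2 = jet_jac[OF c(2,1) d(2,1) e(2,1)]
  have "(\<lambda>a. ?D (lift_t M c d e a)) = (\<lambda>a. lift_t M c' d' e (?\<phi> a))"
  proof (rule linear_eq_axis)
    show "linear (\<lambda>a. ?D (lift_t M c d e a))"
      using linear_compose[OF linear_lift_t J1(1)] by (simp add: o_def)
    show "linear (\<lambda>a. lift_t M c' d' e (?\<phi> a))"
      using linear_compose[OF J1(2) linear_lift_t] by (simp add: o_def)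
    fix \<alpha> :: 'p
    let ?m = "\<chi> j \<beta>. M c d j \<beta> \<alpha> e"
    have l: "lift_t M c d e (axis \<alpha> 1) = (axis \<alpha> 1, 0, 0) - (0, 0, ?m)"
      by (simp add: lift_t_def sum_axis_mult)
    have D: "?D (lift_t M c d e (axis \<alpha> 1)) = ?D (axis \<alpha> 1, 0, 0) - ?D (0, 0, ?m)"
      unfolding l by (rule linear_diff[OF J1(1)])
    have "(\<Sum>\<mu>\<in>UNIV. M c' d' j \<beta> \<mu> e * partial_t AT AM c d \<alpha> e (coord_t AT AM c' d' \<mu>)) =
             (\<Sum>k\<in>UNIV. \<Sum>\<gamma>\<in>UNIV. M c d k \<gamma> \<alpha> e
                * partial_x AT AM c d k e (coord_x AT AM c' d' j)
                * partial_t AT AM c' d' \<beta> e (coord_t AT AM c d \<gamma>))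
             - partial_t AT AM c d \<alpha> e (coord_v AT AM c' d' j \<beta>)" for j \<beta>
      using NC c d e unfolding nonlinear_connection_def by blast
    then have "(\<Sum>\<mu>\<in>UNIV. M c' d' j \<beta> \<mu> e * ?\<phi> (axis \<alpha> 1) $ \<mu>) =
        snd (snd (?D (0, 0, ?m))) $ j $ \<beta> - snd (snd (?D (axis \<alpha> 1, 0, 0))) $ j $ \<beta>" for j \<beta>
      by (simp add: partial_t_def partial_x_def partial_coordinates[OF c d e]
          partial_coordinates[OF c(2,1) d(2,1) e(2,1)] J1 J2)
    then show "?D (lift_t M c d e (axis \<alpha> 1)) = lift_t M c' d' e (?\<phi> (axis \<alpha> 1))"
      unfolding D by (simp add: prod_eq_iff lift_t_def J1 linear_0[OF J1(2)] linear_0[OF J1(3)] vec_eq_iff mult.commute)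
  qed
  then show ?thesis
    by (rule fun_cong)
qed

lemma jet_jac_lift_x:
  assumes c: "c \<in> AT" "c' \<in> AT" and d: "d \<in> AM" "d' \<in> AM" and e: "e \<in> fst (JC c d)" "e \<in> fst (JC c' d')"
    and NC: "nonlinear_connection AT AM M N"
  shows "jet_jac c d c' d' e (lift_x N c d e a) =
    lift_x N c' d' e (frechet_derivative (snd d' \<circ> chart_inv d) (at (snd d (jet_target e))) a)"
proof -
  let ?D = "jet_jac c d c' d' e" and ?\<psi> = "frechet_derivative (snd d' \<circ> chart_inv d) (at (snd d (jet_target e)))"
  note J1 = jet_jac[OF c d e] and J2 = jet_jac[OF c(2,1) d(2,1) e(2,1)]
  have "(\<lambda>a. ?D (lift_x N c d e a)) = (\<lambda>a. lift_x N c' d' e (?\<psi> a))"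
  proof (rule linear_eq_axis)
    show "linear (\<lambda>a. ?D (lift_x N c d e a))"
      using linear_compose[OF linear_lift_x J1(1)] by (simp add: o_def)
    show "linear (\<lambda>a. lift_x N c' d' e (?\<psi> a))"
      using linear_compose[OF J1(3) linear_lift_x] by (simp add: o_def)
    fix i :: 'n
    let ?m = "\<chi> j \<beta>. N c d j \<beta> i e"
    have l: "lift_x N c d e (axis i 1) = (0, axis i 1, 0) - (0, 0, ?m)"
      by (simp add: lift_x_def sum_axis_mult)
    have D: "?D (lift_x N c d e (axis i 1)) = ?D (0, axis i 1, 0) - ?D (0, 0, ?m)"
      unfolding l by (rule linear_diff[OF J1(1)])
    have "(\<Sum>k\<in>UNIV. N c' d' j \<beta> k e * partial_x AT AM c d i e (coord_x AT AM c' d' k)) =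
             (\<Sum>k\<in>UNIV. \<Sum>\<gamma>\<in>UNIV. N c d k \<gamma> i e
                * partial_x AT AM c d k e (coord_x AT AM c' d' j)
                * partial_t AT AM c' d' \<beta> e (coord_t AT AM c d \<gamma>))
             - partial_x AT AM c d i e (coord_v AT AM c' d' j \<beta>)" for j \<beta>
      using NC c d e unfolding nonlinear_connection_def by blast
    then have "(\<Sum>k\<in>UNIV. N c' d' j \<beta> k e * ?\<psi> (axis i 1) $ k) =
        snd (snd (?D (0, 0, ?m))) $ j $ \<beta> - snd (snd (?D (0, axis i 1, 0))) $ j $ \<beta>" for j \<beta>
      by (simp add: partial_t_def partial_x_def partial_coordinates[OF c d e]
          partial_coordinates[OF c(2,1) d(2,1) e(2,1)] J1 J2)
    then show "?D (lift_x N c d e (axis i 1)) = lift_x N c' d' e (?\<psi> (axis i 1))"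
      unfolding D by (simp add: prod_eq_iff lift_x_def J1 linear_0[OF J1(2)] linear_0[OF J1(3)] vec_eq_iff mult.commute)
  qed
  then show ?thesis
    by (rule fun_cong)
qed

text \<open>\<open>dist_T\<close> collects combinations from all charts at \<open>e\<close>;
  \<open>jet_jac_lift_t\<close> rewrites each of them as a lift in the chosen chart.\<close>

lemma dist_T_eq:
  assumes c: "c \<in> AT" and d: "d \<in> AM" and e: "e \<in> fst (JC c d)" and NC: "nonlinear_connection AT AM M N"
  shows "dist_T AT AM M e = range (\<lambda>a. dir_vec E (JC c d) (lift_t M c d e a) e)"
proof
  show "range (\<lambda>a. dir_vec E (JC c d) (lift_t M c d e a) e) \<subseteq> dist_T AT AM M e"
  proof
    fix v assume "v \<in> range (\<lambda>a. dir_vec E (JC c d) (lift_t M c d e a) e)"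
    then obtain a where "v = dir_vec E (JC c d) (lift_t M c d e a) e"
      by auto
    then have "v = (\<lambda>f. \<Sum>\<alpha>\<in>UNIV. a $ \<alpha> * delta_t AT AM M c d \<alpha> e f)"
      by (simp add: sum_delta_t[OF c d e])
    then show "v \<in> dist_T AT AM M e"
      unfolding dist_T_def using c d e by blast
  qed
  show "dist_T AT AM M e \<subseteq> range (\<lambda>a. dir_vec E (JC c d) (lift_t M c d e a) e)"
  proof
    fix v assume "v \<in> dist_T AT AM M e"
    then obtain c' d' a where v: "v = (\<lambda>f. \<Sum>\<alpha>\<in>UNIV. a \<alpha> * delta_t AT AM M c' d' \<alpha> e f)"
      and c': "c' \<in> AT" and d': "d' \<in> AM" and e': "e \<in> fst (JC c' d')"
      unfolding dist_T_def by blast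
    have "v = dir_vec E (JC c' d') (lift_t M c' d' e (\<chi> \<alpha>. a \<alpha>)) e"
      by (simp add: v sum_delta_t[OF c' d' e'] fun_eq_iff)
    then show "v \<in> range (\<lambda>a. dir_vec E (JC c d) (lift_t M c d e a) e)"
      by (simp add: J.dir_vec_change_chart[OF jet_atlasI[OF c' d'] jet_atlasI[OF c d] e' e]
          jet_jac_lift_t[OF c' c d' d e' e NC])
  qed
qed

lemma dist_M_eq:
  assumes c: "c \<in> AT" and d: "d \<in> AM" and e: "e \<in> fst (JC c d)" and NC: "nonlinear_connection AT AM M N"
  shows "dist_M AT AM N e = range (\<lambda>a. dir_vec E (JC c d) (lift_x N c d e a) e)"
proof
  show "range (\<lambda>a. dir_vec E (JC c d) (lift_x N c d e a) e) \<subseteq> dist_M AT AM N e"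
  proof
    fix v assume "v \<in> range (\<lambda>a. dir_vec E (JC c d) (lift_x N c d e a) e)"
    then obtain a where "v = dir_vec E (JC c d) (lift_x N c d e a) e"
      by auto
    then have "v = (\<lambda>f. \<Sum>\<alpha>\<in>UNIV. a $ \<alpha> * delta_x AT AM N c d \<alpha> e f)"
      by (simp add: sum_delta_x[OF c d e])
    then show "v \<in> dist_M AT AM N e"
      unfolding dist_M_def using c d e by blast
  qed
  show "dist_M AT AM N e \<subseteq> range (\<lambda>a. dir_vec E (JC c d) (lift_x N c d e a) e)"
  proof
    fix v assume "v \<in> dist_M AT AM N e"
    then obtain c' d' a where v: "v = (\<lambda>f. \<Sum>\<alpha>\<in>UNIV. a \<alpha> * delta_x AT AM N c' d' \<alpha> e f)"
      and c': "c' \<in> AT" and d': "d' \<in> AM" and e': "e \<in> fst (JC c' d')"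
      unfolding dist_M_def by blast
    have "v = dir_vec E (JC c' d') (lift_x N c' d' e (\<chi> \<alpha>. a \<alpha>)) e"
      by (simp add: v sum_delta_x[OF c' d' e'] fun_eq_iff)
    then show "v \<in> range (\<lambda>a. dir_vec E (JC c d) (lift_x N c d e a) e)"
      by (simp add: J.dir_vec_change_chart[OF jet_atlasI[OF c' d'] jet_atlasI[OF c d] e' e]
          jet_jac_lift_x[OF c' c d' d e' e NC])
  qed
qed

lemma dist_V_eq:
  assumes c: "c \<in> AT" and d: "d \<in> AM" and e: "e \<in> fst (JC c d)"
  shows "dist_V AT AM e = range (\<lambda>z. dir_vec E (JC c d) (0, 0, z) e)"
proof
  show "range (\<lambda>z. dir_vec E (JC c d) (0, 0, z) e) \<subseteq> dist_V AT AM e"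
  proof
    fix v assume "v \<in> range (\<lambda>z. dir_vec E (JC c d) (0, 0, z) e)"
    then obtain z where "v = dir_vec E (JC c d) (0, 0, z) e"
      by auto
    then have "v = (\<lambda>f. \<Sum>j\<in>UNIV. \<Sum>\<beta>\<in>UNIV. z $ j $ \<beta> * partial_v AT AM c d j \<beta> e f)"
      by (simp add: sum_partial_v[OF c d e])
    then show "v \<in> dist_V AT AM e"
      unfolding dist_V_def using c d e
      by (intro CollectI exI[of _ c] exI[of _ d] exI[of _ "\<lambda>j \<beta>. z $ j $ \<beta>"] conjI)
  qed
  show "dist_V AT AM e \<subseteq> range (\<lambda>z. dir_vec E (JC c d) (0, 0, z) e)"
  proof
    fix v assume "v \<in> dist_V AT AM e"
    then obtain c' d' a where v: "v = (\<lambda>f. \<Sum>i\<in>UNIV. \<Sum>\<alpha>\<in>UNIV. a i \<alpha> * partial_v AT AM c' d' i \<alpha> e f)"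
      and c': "c' \<in> AT" and d': "d' \<in> AM" and e': "e \<in> fst (JC c' d')"
      unfolding dist_V_def by blast
    note J1 = jet_jac[OF c' c d' d e' e]
    let ?z = "\<chi> i \<alpha>. a i \<alpha>"
    \<comment> \<open>The first two components of the Jacobian depend only on the first two
      components of the vector, so verticality is preserved without reference to \<Gamma>.\<close>
    have h: "jet_jac c' d' c d e (0, 0, ?z) = (0, 0, snd (snd (jet_jac c' d' c d e (0, 0, ?z))))"
      by (simp add: prod_eq_iff J1(4,5) linear_0[OF J1(2)] linear_0[OF J1(3)])
    have v': "v = dir_vec E (JC c d) (jet_jac c' d' c d e (0, 0, ?z)) e"
      unfolding J.dir_vec_change_chart[OF jet_atlasI[OF c' d'] jet_atlasI[OF c d] e' e, symmetric]
      by (simp add: v sum_partial_v[OF c' d' e'] fun_eq_iff)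
    show "v \<in> range (\<lambda>z. dir_vec E (JC c d) (0, 0, z) e)"
      unfolding v' by (subst h) (rule rangeI)
  qed
qed

text \<open>\<open>proj_along\<close> is a definite description: the first premises exhibit a
  decomposition, and the last one asserts that its component in \<open>P\<close> is unique.\<close>

lemma proj_along_eqI:
  assumes "u \<in> P" "w \<in> Q" "z \<in> R" "v = (\<lambda>f. u f + w f + z f)"
    and "\<And>u' w' z'. u' \<in> P \<Longrightarrow> w' \<in> Q \<Longrightarrow> z' \<in> R \<Longrightarrow> (\<lambda>f. u' f + w' f + z' f) = v \<Longrightarrow> u' = u"
  shows "proj_along P Q R v = u"
  unfolding proj_along_def
proof (rule the_equality)
  show "u \<in> P \<and> (\<exists>w\<in>Q. \<exists>z\<in>R. v = (\<lambda>f. u f + w f + z f))"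
    using assms(1-4) by blast
next
  fix u' assume "u' \<in> P \<and> (\<exists>w\<in>Q. \<exists>z\<in>R. v = (\<lambda>f. u' f + w f + z f))"
  then obtain w' z' where "u' \<in> P" "w' \<in> Q" "z' \<in> R" "v = (\<lambda>f. u' f + w' f + z' f)"
    by blast
  then show "u' = u"
    using assms(5)[of u' w' z'] by simp
qed

text \<open>The sum of the distributions is direct because the first two components of the total
  coordinate vector are \<open>a\<close> and \<open>b\<close>, after which the vertical part
  determines \<open>z\<close>.\<close>

lemma proj_adapted:
  assumes c: "c \<in> AT" and d: "d \<in> AM" and e: "e \<in> fst (JC c d)" and NC: "nonlinear_connection AT AM M N"
    and X: "X e = (\<lambda>f. (\<Sum>\<alpha>\<in>UNIV. a \<alpha> * delta_t AT AM M c d \<alpha> e f) +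
      (\<Sum>i\<in>UNIV. b i * delta_x AT AM N c d i e f) +
      (\<Sum>i\<in>UNIV. \<Sum>\<alpha>\<in>UNIV. z i \<alpha> * partial_v AT AM c d i \<alpha> e f))"
  shows "proj_T AT AM M N X e = (\<lambda>f. \<Sum>\<alpha>\<in>UNIV. a \<alpha> * delta_t AT AM M c d \<alpha> e f)"
    and "proj_M AT AM M N X e = (\<lambda>f. \<Sum>i\<in>UNIV. b i * delta_x AT AM N c d i e f)"
    and "proj_V AT AM M N X e = (\<lambda>f. \<Sum>i\<in>UNIV. \<Sum>\<alpha>\<in>UNIV. z i \<alpha> * partial_v AT AM c d i \<alpha> e f)"
proof -
  let ?t = "\<lambda>a. dir_vec E (JC c d) (lift_t M c d e a) e" and ?x = "\<lambda>b. dir_vec E (JC c d) (lift_x N c d e b) e"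
    and ?v = "\<lambda>z. dir_vec E (JC c d) (0, 0, z) e"
  have K: "JC c d \<in> E"
    using c d by (rule jet_atlasI)
  have sum: "(\<lambda>f. ?t a f + ?x b f + ?v z f) = dir_vec E (JC c d) (lift_t M c d e a + lift_x N c d e b + (0, 0, z)) e" for a b z
    unfolding fun_eq_iff linear_add[OF J.linear_dir_vec[OF K e]] by simp
  have inj: "a = a' \<and> b = b' \<and> z = z'"
    if "(\<lambda>f. ?t a f + ?x b f + ?v z f) = (\<lambda>f. ?t a' f + ?x b' f + ?v z' f)" for a b z a' b' z'
    using that unfolding sum J.dir_vec_eq_iff[OF K e] by (auto simp: lift_t_def lift_x_def)
  note dist = dist_T_eq[OF c d e NC] dist_M_eq[OF c d e NC] dist_V_eq[OF c d e]
  let ?a = "\<chi> \<alpha>. a \<alpha>" and ?b = "\<chi> i. b i" and ?z = "\<chi> i \<alpha>. z i \<alpha>"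
  have X': "X e = (\<lambda>f. ?t ?a f + ?x ?b f + ?v ?z f)"
    unfolding X sum_delta_t[OF c d e] sum_delta_x[OF c d e] sum_partial_v[OF c d e] ..
  have jet: "e \<in> jets AT AM"
    using e by (simp add: jet_dom_iff)
  have "proj_T AT AM M N X e = ?t ?a"
    unfolding proj_T_def dist if_P[OF jet]
  proof (rule proj_along_eqI[where u = "?t ?a" and w = "?x ?b" and z = "?v ?z", OF _ _ _ X'])
    fix u' w' z'
    assume "u' \<in> range ?t" "w' \<in> range ?x" "z' \<in> range ?v" and eq: "(\<lambda>f. u' f + w' f + z' f) = X e"
    then obtain a' b' y' where "u' = ?t a'" "w' = ?x b'" "z' = ?v y'"
      by auto
    then show "u' = ?t ?a"
      using eq inj[of a' b' y' ?a ?b ?z] unfolding X' by simp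
  qed (rule rangeI)+
  then show "proj_T AT AM M N X e = (\<lambda>f. \<Sum>\<alpha>\<in>UNIV. a \<alpha> * delta_t AT AM M c d \<alpha> e f)"
    unfolding sum_delta_t[OF c d e] .
  have "proj_M AT AM M N X e = ?x ?b"
    unfolding proj_M_def dist if_P[OF jet]
  proof (rule proj_along_eqI[where u = "?x ?b" and w = "?t ?a" and z = "?v ?z"])
    show "X e = (\<lambda>f. ?x ?b f + ?t ?a f + ?v ?z f)"
      unfolding X' by (simp add: add.commute)
    fix u' w' z'
    assume "u' \<in> range ?x" "w' \<in> range ?t" "z' \<in> range ?v" and eq: "(\<lambda>f. u' f + w' f + z' f) = X e"
    then obtain a' b' y' where u': "u' = ?x b'" "w' = ?t a'" "z' = ?v y'"
      by auto
    then have "(\<lambda>f. ?t a' f + ?x b' f + ?v y' f) = X e"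
      using eq by (simp add: add.commute)
    then show "u' = ?x ?b"
      using inj[of a' b' y' ?a ?b ?z] u' unfolding X' by simp
  qed (rule rangeI)+
  then show "proj_M AT AM M N X e = (\<lambda>f. \<Sum>i\<in>UNIV. b i * delta_x AT AM N c d i e f)"
    unfolding sum_delta_x[OF c d e] .
  have "proj_V AT AM M N X e = ?v ?z"
    unfolding proj_V_def dist if_P[OF jet]
  proof (rule proj_along_eqI[where u = "?v ?z" and w = "?t ?a" and z = "?x ?b"])
    show "X e = (\<lambda>f. ?v ?z f + ?t ?a f + ?x ?b f)"
      unfolding X' by (simp add: ac_simps)
    fix u' w' z'
    assume "u' \<in> range ?v" "w' \<in> range ?t" "z' \<in> range ?x" and eq: "(\<lambda>f. u' f + w' f + z' f) = X e"
    then obtain a' b' y' where u': "u' = ?v y'" "w' = ?t a'" "z' = ?x b'"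
      by auto
    then have "(\<lambda>f. ?t a' f + ?x b' f + ?v y' f) = X e"
      using eq by (simp add: ac_simps)
    then show "u' = ?v ?z"
      using inj[of a' b' y' ?a ?b ?z] u' unfolding X' by simp
  qed (rule rangeI)+
  then show "proj_V AT AM M N X e = (\<lambda>f. \<Sum>i\<in>UNIV. \<Sum>\<alpha>\<in>UNIV. z i \<alpha> * partial_v AT AM c d i \<alpha> e f)"
    unfolding sum_partial_v[OF c d e] .
qed

end

section \<open>Brackets of adapted fields\<close>

context jet_space
begin

text \<open>Common shape of all three kinds of basis fields, with \<open>m = 0\<close> for the
  vertical ones, so that a single bracket formula covers all pairs.\<close>

definition vertical_perturbation :: "('p, 'n) jet_coords \<Rightarrow> ('n \<Rightarrow> 'p \<Rightarrow> ('a, 'b) jet \<Rightarrow> real) \<Rightarrow> ('a, 'b) jet \<Rightarrow> ('p, 'n) jet_coords" where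
  "vertical_perturbation k m e = k - (0, 0, \<chi> j \<beta>. m j \<beta> e)"

lemma local_rep_vertical_perturbation:
  assumes c: "c \<in> AT" and d: "d \<in> AM" and e: "e \<in> fst (JC c d)" and m: "\<And>j \<beta>. smooth_near E (m j \<beta>) e"
    and X: "eventually (\<lambda>u. X (chart_inv (JC c d) u) = dir_vec E (JC c d)
      (vertical_perturbation k m (chart_inv (JC c d) u)) (chart_inv (JC c d) u)) (nhds (snd (JC c d) e))"
  shows "J.local_rep (JC c d) e X (\<lambda>u. vertical_perturbation k m (chart_inv (JC c d) u))"
  unfolding J.local_rep_def
proof (rule conjI[OF _ X])
  show "smooth_at (\<lambda>u. vertical_perturbation k m (chart_inv (JC c d) u)) (snd (JC c d) e)"
    unfolding vertical_perturbation_def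
    by (intro smooth_at_diff smooth_at_const smooth_at_Pair smooth_at_vec_lambda)
      (use m J.smooth_near_iff[OF jet_atlasI[OF c d] e] in \<open>simp add: o_def\<close>)
qed

text \<open>The constants \<open>k\<close> and \<open>k'\<close> disappear under differentiation, so
  only derivatives of the coefficients survive. The minus signs in front of \<open>m\<close> and
  \<open>m'\<close> reverse the usual order and give Y(m) - X(m').\<close>

lemma lie_bracket_vertical_perturbation:
  assumes c: "c \<in> AT" and d: "d \<in> AM" and e: "e \<in> fst (JC c d)"
    and m: "\<And>j \<beta>. smooth_near E (m j \<beta>) e" and m': "\<And>j \<beta>. smooth_near E (m' j \<beta>) e"
    and X: "eventually (\<lambda>u. X (chart_inv (JC c d) u) = dir_vec E (JC c d)
      (vertical_perturbation k m (chart_inv (JC c d) u)) (chart_inv (JC c d) u)) (nhds (snd (JC c d) e))"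
    and Y: "eventually (\<lambda>u. Y (chart_inv (JC c d) u) = dir_vec E (JC c d)
      (vertical_perturbation k' m' (chart_inv (JC c d) u)) (chart_inv (JC c d) u)) (nhds (snd (JC c d) e))"
  shows "lie_bracket E X Y e f =
    (\<Sum>j\<in>UNIV. \<Sum>\<beta>\<in>UNIV. (Y e (m j \<beta>) - X e (m' j \<beta>)) * partial_v AT AM c d j \<beta> e f)"
proof -
  let ?K = "JC c d"
  let ?z = "snd ?K e"
  have K: "?K \<in> E"
    using c d by (rule jet_atlasI)
  \<comment> \<open>Derivative of one coordinate expression along a field \<open>Z\<close> with
    components \<open>a\<close>: only the matrix part varies with the point. The claim is used once
    for each of the two terms of the bracket.\<close>
  have D: "frechet_derivative (\<lambda>u. vertical_perturbation k m (chart_inv ?K u)) (at ?z) (a ?z) =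
      (0, 0, - (\<chi> j \<beta>. Z e (m j \<beta>)))"
    if m: "\<And>j \<beta>. smooth_near E (m j \<beta>) e" and Z: "J.local_rep ?K e Z a" for k m Z a
  proof -
    let ?V = "\<lambda>u. vertical_perturbation k m (chart_inv ?K u)"
    have V: "smooth_at ?V ?z"
      using local_rep_vertical_perturbation[OF c d e m, of "\<lambda>y. dir_vec E ?K (vertical_perturbation k m y) y" k]
      by (simp add: J.local_rep_def)
    have L: "L (frechet_derivative ?V (at ?z) v) = frechet_derivative (\<lambda>u. L (?V u)) (at ?z) v"
      if "linear L" for v and L :: "_ \<Rightarrow> real"
      using fun_cong[OF frechet_derivative_linear_compose[OF that V], of v] by simp
    have Lx: "linear (\<lambda>z :: ('p, 'n) jet_coords. fst z $ \<alpha>)" "linear (\<lambda>z :: ('p, 'n) jet_coords. fst (snd z) $ i)"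
      "linear (\<lambda>z :: ('p, 'n) jet_coords. snd (snd z) $ i $ \<alpha>)" for i \<alpha>
      by (auto intro!: linearI)
    have "fst (frechet_derivative ?V (at ?z) v) $ \<alpha> = 0" for v \<alpha>
      unfolding L[OF Lx(1)] by (simp add: vertical_perturbation_def)
    moreover have "fst (snd (frechet_derivative ?V (at ?z) v)) $ i = 0" for v i
      unfolding L[OF Lx(2)] by (simp add: vertical_perturbation_def)
    moreover have "snd (snd (frechet_derivative ?V (at ?z) (a ?z))) $ j $ \<beta> = - Z e (m j \<beta>)" for j \<beta>
    proof -
      have s: "smooth_at (m j \<beta> \<circ> chart_inv ?K) ?z"
        using m J.smooth_near_iff[OF K e] by simp
      have "((\<lambda>u. snd (snd k) $ j $ \<beta> - (m j \<beta> \<circ> chart_inv ?K) u) has_derivative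
          (\<lambda>v. 0 - frechet_derivative (m j \<beta> \<circ> chart_inv ?K) (at ?z) v)) (at ?z)"
        by (intro has_derivative_diff has_derivative_const smooth_at_has_derivative s)
      from frechet_derivative_eq[OF this]
      have "snd (snd (frechet_derivative ?V (at ?z) (a ?z))) $ j $ \<beta> =
          - frechet_derivative (m j \<beta> \<circ> chart_inv ?K) (at ?z) (a ?z)"
        unfolding L[OF Lx(3)] by (simp add: vertical_perturbation_def)
      then show ?thesis
        using J.local_rep_at[OF K e Z] J.dir_vec_smooth[OF m] by simp
    qed
    ultimately show ?thesis
      by (simp add: prod_eq_iff vec_eq_iff)
  qed
  note X' = local_rep_vertical_perturbation[OF c d e m X] and Y' = local_rep_vertical_perturbation[OF c d e m' Y]
  have "lie_bracket E X Y e = dir_vec E ?K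
      ((0, 0, - (\<chi> j \<beta>. X e (m' j \<beta>))) - (0, 0, - (\<chi> j \<beta>. Y e (m j \<beta>)))) e"
    unfolding J.lie_bracket_local_rep_at[OF K e X' Y'] D[OF m' X'] D[OF m Y'] ..
  also have "((0, 0, - (\<chi> j \<beta>. X e (m' j \<beta>))) - (0, 0, - (\<chi> j \<beta>. Y e (m j \<beta>)))) =
      ((0, 0, \<chi> j \<beta>. Y e (m j \<beta>) - X e (m' j \<beta>)) :: ('p, 'n) jet_coords)"
    by (simp add: vec_eq_iff)
  finally show ?thesis
    by (simp add: sum_partial_v[OF c d e])
qed

lemma delta_t_vertical_perturbation:
  assumes "c \<in> AT" "d \<in> AM" "e \<in> fst (JC c d)"
  shows "delta_t AT AM M c d \<alpha> e =
    dir_vec E (JC c d) (vertical_perturbation (axis \<alpha> 1, 0, 0) (\<lambda>j \<beta>. M c d j \<beta> \<alpha>) e) e"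
  using delta_t_eq(1)[OF assms] by (simp add: vertical_perturbation_def)

lemma delta_x_vertical_perturbation:
  assumes "c \<in> AT" "d \<in> AM" "e \<in> fst (JC c d)"
  shows "delta_x AT AM N c d i e =
    dir_vec E (JC c d) (vertical_perturbation (0, axis i 1, 0) (\<lambda>j \<beta>. N c d j \<beta> i) e) e"
  using delta_x_eq(1)[OF assms] by (simp add: vertical_perturbation_def)

lemma partial_v_eq: "partial_v AT AM c d i \<alpha> e =
    dir_vec E (JC c d) (vertical_perturbation (0, 0, axis i (axis \<alpha> 1)) (\<lambda>j \<beta> e. 0) e) e"
  by (simp add: partial_v_def vertical_perturbation_def zero_vec_def[symmetric])

lemma adapted_frame_smooth:
  assumes NC: "nonlinear_connection AT AM M N" and c: "c \<in> AT" and d: "d \<in> AM" and e: "e \<in> fst (JC c d)"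
  shows "smooth_near E (M c d j \<beta> \<alpha>) e" and "smooth_near E (N c d j \<beta> i) e" and "smooth_near E (\<lambda>e. 0) e"
  using assms unfolding nonlinear_connection_def
  by (auto intro!: J.smooth_near_const simp: carrier_jet_atlas jet_dom_iff)

lemma adapted_frame_rep:
  assumes c: "c \<in> AT" and d: "d \<in> AM" and e: "e \<in> fst (JC c d)"
    and ext: "extends_adapted_basis AT AM M N c d e Xt Xx Xv"
  shows "eventually (\<lambda>u. Xt \<alpha> (chart_inv (JC c d) u) = dir_vec E (JC c d)
      (vertical_perturbation (axis \<alpha> 1, 0, 0) (\<lambda>j \<beta>. M c d j \<beta> \<alpha>) (chart_inv (JC c d) u)) (chart_inv (JC c d) u))
      (nhds (snd (JC c d) e))"
    and "eventually (\<lambda>u. Xx i (chart_inv (JC c d) u) = dir_vec E (JC c d)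
      (vertical_perturbation (0, axis i 1, 0) (\<lambda>j \<beta>. N c d j \<beta> i) (chart_inv (JC c d) u)) (chart_inv (JC c d) u))
      (nhds (snd (JC c d) e))"
    and "eventually (\<lambda>u. Xv i \<alpha> (chart_inv (JC c d) u) = dir_vec E (JC c d)
      (vertical_perturbation (0, 0, axis i (axis \<alpha> 1)) (\<lambda>j \<beta> e. 0) (chart_inv (JC c d) u)) (chart_inv (JC c d) u))
      (nhds (snd (JC c d) e))"
proof -
  have K: "JC c d \<in> E"
    using c d by (rule jet_atlasI)
  note dom = J.eventually_chart[OF K e]
  have "eventually (\<lambda>u. Xt \<alpha> (chart_inv (JC c d) u) = delta_t AT AM M c d \<alpha> (chart_inv (JC c d) u)) (nhds (snd (JC c d) e))"
    using ext unfolding extends_adapted_basis_def by (intro J.agree_near_imp_eventually K e) blast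
  with dom show "eventually (\<lambda>u. Xt \<alpha> (chart_inv (JC c d) u) = dir_vec E (JC c d)
      (vertical_perturbation (axis \<alpha> 1, 0, 0) (\<lambda>j \<beta>. M c d j \<beta> \<alpha>) (chart_inv (JC c d) u)) (chart_inv (JC c d) u))
      (nhds (snd (JC c d) e))"
    by eventually_elim (simp add: delta_t_vertical_perturbation[OF c d])
  have "eventually (\<lambda>u. Xx i (chart_inv (JC c d) u) = delta_x AT AM N c d i (chart_inv (JC c d) u)) (nhds (snd (JC c d) e))"
    using ext unfolding extends_adapted_basis_def by (intro J.agree_near_imp_eventually K e) blast
  with dom show "eventually (\<lambda>u. Xx i (chart_inv (JC c d) u) = dir_vec E (JC c d)
      (vertical_perturbation (0, axis i 1, 0) (\<lambda>j \<beta>. N c d j \<beta> i) (chart_inv (JC c d) u)) (chart_inv (JC c d) u))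
      (nhds (snd (JC c d) e))"
    by eventually_elim (simp add: delta_x_vertical_perturbation[OF c d])
  have "eventually (\<lambda>u. Xv i \<alpha> (chart_inv (JC c d) u) = partial_v AT AM c d i \<alpha> (chart_inv (JC c d) u)) (nhds (snd (JC c d) e))"
    using ext unfolding extends_adapted_basis_def by (intro J.agree_near_imp_eventually K e) blast
  then show "eventually (\<lambda>u. Xv i \<alpha> (chart_inv (JC c d) u) = dir_vec E (JC c d)
      (vertical_perturbation (0, 0, axis i (axis \<alpha> 1)) (\<lambda>j \<beta> e. 0) (chart_inv (JC c d) u)) (chart_inv (JC c d) u))
      (nhds (snd (JC c d) e))"
    by (simp only: partial_v_eq)
qed

lemma adapted_frame_at:
  assumes c: "c \<in> AT" and d: "d \<in> AM" and e: "e \<in> fst (JC c d)"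
    and ext: "extends_adapted_basis AT AM M N c d e Xt Xx Xv"
  shows "Xt \<alpha> e = delta_t AT AM M c d \<alpha> e" and "Xx i e = delta_x AT AM N c d i e"
    and "Xv i \<alpha> e = partial_v AT AM c d i \<alpha> e"
  using ext unfolding extends_adapted_basis_def agree_near_def by blast+

text \<open>Statements that quantify over extensions of the adapted basis would be vacuous at
  \<open>e\<close> without such an extension. The coefficients are smooth on the whole chart domain,
  so a bump function turns the basis into global fields.\<close>

lemma adapted_frame_extension:
  assumes NC: "nonlinear_connection AT AM M N" and c: "c \<in> AT" and d: "d \<in> AM" and e: "e \<in> fst (JC c d)"
  obtains Xt Xx Xv where "extends_adapted_basis AT AM M N c d e Xt Xx Xv"
proof -
  have K: "JC c d \<in> E"
    using c d by (rule jet_atlasI)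
  have extend: "\<exists>Y\<in>vector_fields E. agree_near E e Y X"
    if m: "\<And>e j \<beta>. e \<in> fst (JC c d) \<Longrightarrow> smooth_near E (m j \<beta>) e"
      and X: "\<And>e. e \<in> fst (JC c d) \<Longrightarrow> X e = dir_vec E (JC c d) (vertical_perturbation k m e) e" for X k m
  proof (rule J.extend_local_field[OF K e])
    fix y assume y: "y \<in> fst (JC c d)"
    have "J.local_rep (JC c d) y X (\<lambda>u. vertical_perturbation k m (chart_inv (JC c d) u))"
      by (rule local_rep_vertical_perturbation[OF c d y m[OF y]], rule eventually_mono[OF J.eventually_chart[OF K y]])
        (use X in simp)
    then show "\<exists>a. J.local_rep (JC c d) y X a"
      by blast
  qed
  note sm = adapted_frame_smooth[OF NC c d]
  have "\<exists>Y\<in>vector_fields E. agree_near E e Y (delta_t AT AM M c d \<alpha>)" for \<alpha>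
    by (rule extend[OF _ delta_t_vertical_perturbation[OF c d]]) (rule sm)
  then obtain Xt where Xt: "\<forall>\<alpha>. Xt \<alpha> \<in> vector_fields E \<and> agree_near E e (Xt \<alpha>) (delta_t AT AM M c d \<alpha>)"
    by metis
  have "\<exists>Y\<in>vector_fields E. agree_near E e Y (delta_x AT AM N c d i)" for i
    by (rule extend[OF _ delta_x_vertical_perturbation[OF c d]]) (rule sm)
  then obtain Xx where Xx: "\<forall>i. Xx i \<in> vector_fields E \<and> agree_near E e (Xx i) (delta_x AT AM N c d i)"
    by metis
  have "\<forall>i \<alpha>. \<exists>Y\<in>vector_fields E. agree_near E e Y (partial_v AT AM c d i \<alpha>)"
    by (intro allI extend[OF sm(3) partial_v_eq])
  then obtain Xv where Xv: "\<forall>i \<alpha>. Xv i \<alpha> \<in> vector_fields E \<and> agree_near E e (Xv i \<alpha>) (partial_v AT AM c d i \<alpha>)"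
    by metis
  have "extends_adapted_basis AT AM M N c d e Xt Xx Xv"
    unfolding extends_adapted_basis_def using Xt Xx Xv by blast
  then show ?thesis
    by (rule that)
qed

lemma adapted_frame_spans:
  assumes c: "c \<in> AT" and d: "d \<in> AM" and e: "e \<in> fst (JC c d)" and v: "v \<in> tangent_space E e"
  obtains a b z where "v = (\<lambda>f. (\<Sum>\<alpha>\<in>UNIV. a \<alpha> * delta_t AT AM M c d \<alpha> e f) +
      (\<Sum>i\<in>UNIV. b i * delta_x AT AM N c d i e f) +
      (\<Sum>i\<in>UNIV. \<Sum>\<alpha>\<in>UNIV. z i \<alpha> * partial_v AT AM c d i \<alpha> e f))"
proof -
  have K: "JC c d \<in> E"
    using c d by (rule jet_atlasI)
  obtain w where w: "v = dir_vec E (JC c d) w e"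
    using v unfolding J.tangent_space_eq_range[OF K e] by blast
  obtain a b y where aby: "w = (a, b, y)"
    by (cases w)
  \<comment> \<open>The lifts of \<open>a\<close> and \<open>b\<close> have vertical parts of their
    own; removing them from \<open>y\<close> leaves what the vertical basis has to supply.\<close>
  let ?z = "y - snd (snd (lift_t M c d e a)) - snd (snd (lift_x N c d e b))"
  have "w = lift_t M c d e a + lift_x N c d e b + (0, 0, ?z)"
    by (simp add: aby lift_t_def lift_x_def)
  then have "v = (\<lambda>f. dir_vec E (JC c d) (lift_t M c d e a) e f + dir_vec E (JC c d) (lift_x N c d e b) e f +
      dir_vec E (JC c d) (0, 0, ?z) e f)"
    unfolding w fun_eq_iff by (simp only: linear_add[OF J.linear_dir_vec[OF K e]]) simp
  moreover have "(\<chi> \<alpha>. a $ \<alpha>) = a" "(\<chi> i. b $ i) = b" "(\<chi> i \<alpha>. ?z $ i $ \<alpha>) = ?z"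
    by (simp_all add: vec_eq_iff)
  ultimately show ?thesis
    using that[of "\<lambda>\<alpha>. a $ \<alpha>" "\<lambda>i. b $ i" "\<lambda>i \<alpha>. ?z $ i $ \<alpha>"]
    by (simp only: sum_delta_t[OF c d e] sum_delta_x[OF c d e] sum_partial_v[OF c d e])
qed

text \<open>The hypotheses cover six of the nine pairings between the three kinds of basis fields;
  skew symmetry of both tensors supplies the other three.\<close>

lemma skew_tensor_eq_on_adapted_frame:
  assumes NC: "nonlinear_connection AT AM M N" and S: "skew_tensor E S" "skew_tensor E S'"
    and c: "c \<in> AT" and d: "d \<in> AM" and e: "e \<in> fst (JC c d)"
    and ext: "extends_adapted_basis AT AM M N c d e Xt Xx Xv"
    and eq: "\<And>\<alpha> \<beta>. S (Xt \<beta>) (Xt \<alpha>) e = S' (Xt \<beta>) (Xt \<alpha>) e"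
      "\<And>j \<alpha>. S (Xx j) (Xt \<alpha>) e = S' (Xx j) (Xt \<alpha>) e"
      "\<And>i j. S (Xx j) (Xx i) e = S' (Xx j) (Xx i) e"
      "\<And>j \<beta> \<alpha>. S (Xv j \<beta>) (Xt \<alpha>) e = S' (Xv j \<beta>) (Xt \<alpha>) e"
      "\<And>j \<beta> i. S (Xv j \<beta>) (Xx i) e = S' (Xv j \<beta>) (Xx i) e"
      "\<And>j \<beta> i \<alpha>. S (Xv j \<beta>) (Xv i \<alpha>) e = S' (Xv j \<beta>) (Xv i \<alpha>) e"
    and X: "X \<in> vector_fields E" and Y: "Y \<in> vector_fields E"
  shows "S X Y e = S' X Y e"
proof -
  \<comment> \<open>A single frame over the disjoint sum of the three index sets, so that the
    criterion for one finite frame applies.\<close>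
  define Z where "Z = case_sum Xt (case_sum Xx (\<lambda>(i, \<alpha>). Xv i \<alpha>))"
  have VF: "Xt \<alpha> \<in> vector_fields E" "Xx i \<in> vector_fields E" "Xv i \<alpha> \<in> vector_fields E" for \<alpha> i
    using ext by (simp_all add: extends_adapted_basis_def)
  have Z: "Z s \<in> vector_fields E" for s
    using VF by (auto simp: Z_def split: sum.split)
  have swap: "S V W e = S' V W e"
    if "V \<in> vector_fields E" "W \<in> vector_fields E" "S W V e = S' W V e" for V W
    using J.skew_tensor_swap[OF S(1) that(1,2), of e] J.skew_tensor_swap[OF S(2) that(1,2), of e] that(3)
    by (simp add: fun_eq_iff)
  have ec: "e \<in> carrier E"
    using e by (simp add: carrier_jet_atlas jet_dom_iff)
  show ?thesis
  proof (rule J.skew_tensor_eqI[OF S ec finite_class.finite_UNIV Z _ _ X Y])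
    fix s t
    show "S (Z s) (Z t) e = S' (Z s) (Z t) e"
      using eq VF by (cases s; cases t; auto simp: Z_def split: sum.split intro: swap)
  next
    fix V assume "V \<in> vector_fields E"
    then have "V e \<in> tangent_space E e"
      using ec by (simp add: vector_fields_def)
    then obtain a b z where abz: "V e = (\<lambda>f. (\<Sum>\<alpha>\<in>UNIV. a \<alpha> * delta_t AT AM M c d \<alpha> e f) +
      (\<Sum>i\<in>UNIV. b i * delta_x AT AM N c d i e f) +
      (\<Sum>i\<in>UNIV. \<Sum>\<alpha>\<in>UNIV. z i \<alpha> * partial_v AT AM c d i \<alpha> e f))"
      by (rule adapted_frame_spans[OF c d e])
    define r where "r = case_sum a (case_sum b (\<lambda>(i, \<alpha>). z i \<alpha>))"
    have "V e = (\<lambda>f. \<Sum>s\<in>UNIV. r s * Z s e f)"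
      unfolding abz adapted_frame_at[OF c d e ext, symmetric]
      by (simp add: r_def Z_def UNIV_Plus_UNIV[symmetric] sum.Plus UNIV_Times_UNIV[symmetric]
          sum.cartesian_product split_def add.assoc del: UNIV_Plus_UNIV UNIV_Times_UNIV)
    then show "\<exists>r. V e = (\<lambda>f. \<Sum>s\<in>UNIV. r s * Z s e f)"
      by blast
  qed
qed

end

section \<open>The torsion on the adapted basis\<close>

context jet_space
begin

lemma torsion_components:
  assumes NC: "nonlinear_connection AT AM M N"
    and comps: "local_components AT AM M N D Gb G Gv Lb L Lv Cb C Cv"
    and c: "c \<in> AT" and d: "d \<in> AM" and e: "e \<in> fst (JC c d)"
    and basis: "extends_adapted_basis AT AM M N c d e Xt Xx Xv"
  shows "proj_T AT AM M N (torsion E D (Xt \<beta>) (Xt \<alpha>)) e =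
        (\<lambda>f. \<Sum>\<mu>\<in>UNIV. (Gb c d \<mu> \<alpha> \<beta> e - Gb c d \<mu> \<beta> \<alpha> e) * delta_t AT AM M c d \<mu> e f)"
    and "proj_M AT AM M N (torsion E D (Xt \<beta>) (Xt \<alpha>)) e = (\<lambda>f. 0)"
    and "proj_V AT AM M N (torsion E D (Xt \<beta>) (Xt \<alpha>)) e =
        (\<lambda>f. \<Sum>m\<in>UNIV. \<Sum>\<mu>\<in>UNIV.
        (delta_t AT AM M c d \<beta> e (M c d m \<mu> \<alpha>) - delta_t AT AM M c d \<alpha> e (M c d m \<mu> \<beta>)) * partial_v AT AM c d m \<mu> e f)"
    and "proj_T AT AM M N (torsion E D (Xx j) (Xt \<alpha>)) e = (\<lambda>f. \<Sum>\<mu>\<in>UNIV. Lb c d \<mu> \<alpha> j e * delta_t AT AM M c d \<mu> e f)"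
    and "proj_M AT AM M N (torsion E D (Xx j) (Xt \<alpha>)) e = (\<lambda>f. \<Sum>m\<in>UNIV. (- G c d m j \<alpha> e) * delta_x AT AM N c d m e f)"
    and "proj_V AT AM M N (torsion E D (Xx j) (Xt \<alpha>)) e =
        (\<lambda>f. \<Sum>m\<in>UNIV. \<Sum>\<mu>\<in>UNIV.
        (delta_x AT AM N c d j e (M c d m \<mu> \<alpha>) - delta_t AT AM M c d \<alpha> e (N c d m \<mu> j)) * partial_v AT AM c d m \<mu> e f)"
    and "proj_T AT AM M N (torsion E D (Xx j) (Xx i)) e = (\<lambda>f. 0)"
    and "proj_M AT AM M N (torsion E D (Xx j) (Xx i)) e =
        (\<lambda>f. \<Sum>m\<in>UNIV. (L c d m i j e - L c d m j i e) * delta_x AT AM N c d m e f)"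
    and "proj_V AT AM M N (torsion E D (Xx j) (Xx i)) e =
        (\<lambda>f. \<Sum>m\<in>UNIV. \<Sum>\<mu>\<in>UNIV.
        (delta_x AT AM N c d j e (N c d m \<mu> i) - delta_x AT AM N c d i e (N c d m \<mu> j)) * partial_v AT AM c d m \<mu> e f)"
    and "proj_T AT AM M N (torsion E D (Xv j \<beta>) (Xt \<alpha>)) e = (\<lambda>f. \<Sum>\<mu>\<in>UNIV. Cb c d \<mu> \<alpha> j \<beta> e * delta_t AT AM M c d \<mu> e f)"
    and "proj_M AT AM M N (torsion E D (Xv j \<beta>) (Xt \<alpha>)) e = (\<lambda>f. 0)"
    and "proj_V AT AM M N (torsion E D (Xv j \<beta>) (Xt \<alpha>)) e =
        (\<lambda>f. \<Sum>m\<in>UNIV. \<Sum>\<mu>\<in>UNIV.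
        (partial_v AT AM c d j \<beta> e (M c d m \<mu> \<alpha>) - Gv c d m \<mu> j \<beta> \<alpha> e) * partial_v AT AM c d m \<mu> e f)"
    and "proj_T AT AM M N (torsion E D (Xv j \<beta>) (Xx i)) e = (\<lambda>f. 0)"
    and "proj_M AT AM M N (torsion E D (Xv j \<beta>) (Xx i)) e = (\<lambda>f. \<Sum>m\<in>UNIV. C c d m i j \<beta> e * delta_x AT AM N c d m e f)"
    and "proj_V AT AM M N (torsion E D (Xv j \<beta>) (Xx i)) e =
        (\<lambda>f. \<Sum>m\<in>UNIV. \<Sum>\<mu>\<in>UNIV.
        (partial_v AT AM c d j \<beta> e (N c d m \<mu> i) - Lv c d m \<mu> j \<beta> i e) * partial_v AT AM c d m \<mu> e f)"
    and "proj_T AT AM M N (torsion E D (Xv j \<beta>) (Xv i \<alpha>)) e = (\<lambda>f. 0)"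
    and "proj_M AT AM M N (torsion E D (Xv j \<beta>) (Xv i \<alpha>)) e = (\<lambda>f. 0)"
    and "proj_V AT AM M N (torsion E D (Xv j \<beta>) (Xv i \<alpha>)) e =
        (\<lambda>f. \<Sum>m\<in>UNIV. \<Sum>\<mu>\<in>UNIV.
        (Cv c d m \<mu> i \<alpha> j \<beta> e - Cv c d m \<mu> j \<beta> i \<alpha> e) * partial_v AT AM c d m \<mu> e f)"
proof -
  have LC: "\<forall>\<beta> \<gamma> i j.
        D (Xt \<gamma>) (Xt \<beta>) e = (\<lambda>f. \<Sum>\<alpha>\<in>UNIV. Gb c d \<alpha> \<beta> \<gamma> e * delta_t AT AM M c d \<alpha> e f) \<and>
        D (Xt \<gamma>) (Xx i) e = (\<lambda>f. \<Sum>k\<in>UNIV. G c d k i \<gamma> e * delta_x AT AM N c d k e f) \<and>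
        D (Xt \<gamma>) (Xv i \<beta>) e =
          (\<lambda>f. \<Sum>k\<in>UNIV. \<Sum>\<alpha>\<in>UNIV. Gv c d k \<alpha> i \<beta> \<gamma> e * partial_v AT AM c d k \<alpha> e f) \<and>
        D (Xx j) (Xt \<beta>) e = (\<lambda>f. \<Sum>\<alpha>\<in>UNIV. Lb c d \<alpha> \<beta> j e * delta_t AT AM M c d \<alpha> e f) \<and>
        D (Xx j) (Xx i) e = (\<lambda>f. \<Sum>k\<in>UNIV. L c d k i j e * delta_x AT AM N c d k e f) \<and>
        D (Xx j) (Xv i \<beta>) e =
          (\<lambda>f. \<Sum>k\<in>UNIV. \<Sum>\<alpha>\<in>UNIV. Lv c d k \<alpha> i \<beta> j e * partial_v AT AM c d k \<alpha> e f) \<and>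
        D (Xv j \<gamma>) (Xt \<beta>) e = (\<lambda>f. \<Sum>\<alpha>\<in>UNIV. Cb c d \<alpha> \<beta> j \<gamma> e * delta_t AT AM M c d \<alpha> e f) \<and>
        D (Xv j \<gamma>) (Xx i) e = (\<lambda>f. \<Sum>k\<in>UNIV. C c d k i j \<gamma> e * delta_x AT AM N c d k e f) \<and>
        D (Xv j \<gamma>) (Xv i \<beta>) e =
          (\<lambda>f. \<Sum>k\<in>UNIV. \<Sum>\<alpha>\<in>UNIV. Cv c d k \<alpha> i \<beta> j \<gamma> e * partial_v AT AM c d k \<alpha> e f)"
    using comps c d e basis unfolding local_components_def by blast
  note sm = adapted_frame_smooth[OF NC c d e] and fr = adapted_frame_rep[OF c d e basis]
    and at = adapted_frame_at[OF c d e basis] and br = lie_bracket_vertical_perturbation[OF c d e]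
  \<comment> \<open>The vertical basis fields have the zero function as coefficient, so these
    derivatives remove its contributions to the brackets.\<close>
  have zero: "delta_t AT AM M c d \<alpha> e (\<lambda>e. 0) = 0" "delta_x AT AM N c d i e (\<lambda>e. 0) = 0"
    "partial_v AT AM c d i \<alpha> e (\<lambda>e. 0) = 0" for \<alpha> i
    by (simp_all add: delta_t_eq(2)[OF c d e] delta_x_eq(2)[OF c d e] partial_v_def
        J.dir_vec_zero_fun[OF jet_atlasI[OF c d] e])
  \<comment> \<open>The bracket contributes the derivative of the first field's coefficient along
    the second minus the reverse, and the torsion subtracts it, which gives the curvature terms
    their sign. Absent components are written as sums with coefficient \<open>0\<close> to fit
    \<open>proj_adapted\<close>; the other five pairs follow the same pattern.\<close>
  have t1: "torsion E D (Xt \<beta>) (Xt \<alpha>) e = (\<lambda>f. (\<Sum>\<mu>\<in>UNIV. (Gb c d \<mu> \<alpha> \<beta> e - Gb c d \<mu> \<beta> \<alpha> e) * delta_t AT AM M c d \<mu> e f) +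
      (\<Sum>m\<in>UNIV. 0 * delta_x AT AM N c d m e f) +
      (\<Sum>m\<in>UNIV. \<Sum>\<mu>\<in>UNIV. (delta_t AT AM M c d \<beta> e (M c d m \<mu> \<alpha>) - delta_t AT AM M c d \<alpha> e (M c d m \<mu> \<beta>)) * partial_v AT AM c d m \<mu> e f))"
    by (rule ext) (simp add: torsion_def LC br[OF sm(1) sm(1) fr(1) fr(1)] at zero left_diff_distrib
        sum_subtractf sum_negf algebra_simps)
  note p1 = proj_adapted[where X = "torsion E D (Xt \<beta>) (Xt \<alpha>)",
      OF c d e NC t1]
  have t2: "torsion E D (Xx j) (Xt \<alpha>) e = (\<lambda>f. (\<Sum>\<mu>\<in>UNIV. (Lb c d \<mu> \<alpha> j e) * delta_t AT AM M c d \<mu> e f) +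
      (\<Sum>m\<in>UNIV. (- G c d m j \<alpha> e) * delta_x AT AM N c d m e f) +
      (\<Sum>m\<in>UNIV. \<Sum>\<mu>\<in>UNIV. (delta_x AT AM N c d j e (M c d m \<mu> \<alpha>) - delta_t AT AM M c d \<alpha> e (N c d m \<mu> j)) * partial_v AT AM c d m \<mu> e f))"
    by (rule ext) (simp add: torsion_def LC br[OF sm(2) sm(1) fr(2) fr(1)] at zero left_diff_distrib
        sum_subtractf sum_negf algebra_simps)
  note p2 = proj_adapted[where X = "torsion E D (Xx j) (Xt \<alpha>)",
      OF c d e NC t2]
  have t3: "torsion E D (Xx j) (Xx i) e = (\<lambda>f. (\<Sum>\<mu>\<in>UNIV. 0 * delta_t AT AM M c d \<mu> e f) +
      (\<Sum>m\<in>UNIV. (L c d m i j e - L c d m j i e) * delta_x AT AM N c d m e f) +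
      (\<Sum>m\<in>UNIV. \<Sum>\<mu>\<in>UNIV. (delta_x AT AM N c d j e (N c d m \<mu> i) - delta_x AT AM N c d i e (N c d m \<mu> j)) * partial_v AT AM c d m \<mu> e f))"
    by (rule ext) (simp add: torsion_def LC br[OF sm(2) sm(2) fr(2) fr(2)] at zero left_diff_distrib
        sum_subtractf sum_negf algebra_simps)
  note p3 = proj_adapted[where X = "torsion E D (Xx j) (Xx i)",
      OF c d e NC t3]
  have t4: "torsion E D (Xv j \<beta>) (Xt \<alpha>) e = (\<lambda>f. (\<Sum>\<mu>\<in>UNIV. (Cb c d \<mu> \<alpha> j \<beta> e) * delta_t AT AM M c d \<mu> e f) +
      (\<Sum>m\<in>UNIV. 0 * delta_x AT AM N c d m e f) +
      (\<Sum>m\<in>UNIV. \<Sum>\<mu>\<in>UNIV. (partial_v AT AM c d j \<beta> e (M c d m \<mu> \<alpha>) - Gv c d m \<mu> j \<beta> \<alpha> e) * partial_v AT AM c d m \<mu> e f))"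
    by (rule ext) (simp add: torsion_def LC br[OF sm(3) sm(1) fr(3) fr(1)] at zero left_diff_distrib
        sum_subtractf sum_negf algebra_simps)
  note p4 = proj_adapted[where X = "torsion E D (Xv j \<beta>) (Xt \<alpha>)",
      OF c d e NC t4]
  have t5: "torsion E D (Xv j \<beta>) (Xx i) e = (\<lambda>f. (\<Sum>\<mu>\<in>UNIV. 0 * delta_t AT AM M c d \<mu> e f) +
      (\<Sum>m\<in>UNIV. (C c d m i j \<beta> e) * delta_x AT AM N c d m e f) +
      (\<Sum>m\<in>UNIV. \<Sum>\<mu>\<in>UNIV. (partial_v AT AM c d j \<beta> e (N c d m \<mu> i) - Lv c d m \<mu> j \<beta> i e) * partial_v AT AM c d m \<mu> e f))"
    by (rule ext) (simp add: torsion_def LC br[OF sm(3) sm(2) fr(3) fr(2)] at zero left_diff_distrib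
        sum_subtractf sum_negf algebra_simps)
  note p5 = proj_adapted[where X = "torsion E D (Xv j \<beta>) (Xx i)",
      OF c d e NC t5]
  have t6: "torsion E D (Xv j \<beta>) (Xv i \<alpha>) e = (\<lambda>f. (\<Sum>\<mu>\<in>UNIV. 0 * delta_t AT AM M c d \<mu> e f) +
      (\<Sum>m\<in>UNIV. 0 * delta_x AT AM N c d m e f) +
      (\<Sum>m\<in>UNIV. \<Sum>\<mu>\<in>UNIV. (Cv c d m \<mu> i \<alpha> j \<beta> e - Cv c d m \<mu> j \<beta> i \<alpha> e) * partial_v AT AM c d m \<mu> e f))"
    by (rule ext) (simp add: torsion_def LC br[OF sm(3) sm(3) fr(3) fr(3)] at zero left_diff_distrib
        sum_subtractf sum_negf algebra_simps)
  note p6 = proj_adapted[where X = "torsion E D (Xv j \<beta>) (Xv i \<alpha>)",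
      OF c d e NC t6]
  show "proj_T AT AM M N (torsion E D (Xt \<beta>) (Xt \<alpha>)) e =
        (\<lambda>f. \<Sum>\<mu>\<in>UNIV. (Gb c d \<mu> \<alpha> \<beta> e - Gb c d \<mu> \<beta> \<alpha> e) * delta_t AT AM M c d \<mu> e f)"
    using p1(1) by simp
  show "proj_M AT AM M N (torsion E D (Xt \<beta>) (Xt \<alpha>)) e = (\<lambda>f. 0)"
    using p1(2) by simp
  show "proj_V AT AM M N (torsion E D (Xt \<beta>) (Xt \<alpha>)) e =
        (\<lambda>f. \<Sum>m\<in>UNIV. \<Sum>\<mu>\<in>UNIV.
        (delta_t AT AM M c d \<beta> e (M c d m \<mu> \<alpha>) - delta_t AT AM M c d \<alpha> e (M c d m \<mu> \<beta>)) * partial_v AT AM c d m \<mu> e f)"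
    using p1(3) by simp
  show "proj_T AT AM M N (torsion E D (Xx j) (Xt \<alpha>)) e = (\<lambda>f. \<Sum>\<mu>\<in>UNIV. Lb c d \<mu> \<alpha> j e * delta_t AT AM M c d \<mu> e f)"
    using p2(1) by simp
  show "proj_M AT AM M N (torsion E D (Xx j) (Xt \<alpha>)) e = (\<lambda>f. \<Sum>m\<in>UNIV. (- G c d m j \<alpha> e) * delta_x AT AM N c d m e f)"
    using p2(2) by simp
  show "proj_V AT AM M N (torsion E D (Xx j) (Xt \<alpha>)) e =
        (\<lambda>f. \<Sum>m\<in>UNIV. \<Sum>\<mu>\<in>UNIV.
        (delta_x AT AM N c d j e (M c d m \<mu> \<alpha>) - delta_t AT AM M c d \<alpha> e (N c d m \<mu> j)) * partial_v AT AM c d m \<mu> e f)"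
    using p2(3) by simp
  show "proj_T AT AM M N (torsion E D (Xx j) (Xx i)) e = (\<lambda>f. 0)"
    using p3(1) by simp
  show "proj_M AT AM M N (torsion E D (Xx j) (Xx i)) e =
        (\<lambda>f. \<Sum>m\<in>UNIV. (L c d m i j e - L c d m j i e) * delta_x AT AM N c d m e f)"
    using p3(2) by simp
  show "proj_V AT AM M N (torsion E D (Xx j) (Xx i)) e =
        (\<lambda>f. \<Sum>m\<in>UNIV. \<Sum>\<mu>\<in>UNIV.
        (delta_x AT AM N c d j e (N c d m \<mu> i) - delta_x AT AM N c d i e (N c d m \<mu> j)) * partial_v AT AM c d m \<mu> e f)"
    using p3(3) by simp
  show "proj_T AT AM M N (torsion E D (Xv j \<beta>) (Xt \<alpha>)) e = (\<lambda>f. \<Sum>\<mu>\<in>UNIV. Cb c d \<mu> \<alpha> j \<beta> e * delta_t AT AM M c d \<mu> e f)"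
    using p4(1) by simp
  show "proj_M AT AM M N (torsion E D (Xv j \<beta>) (Xt \<alpha>)) e = (\<lambda>f. 0)"
    using p4(2) by simp
  show "proj_V AT AM M N (torsion E D (Xv j \<beta>) (Xt \<alpha>)) e =
        (\<lambda>f. \<Sum>m\<in>UNIV. \<Sum>\<mu>\<in>UNIV.
        (partial_v AT AM c d j \<beta> e (M c d m \<mu> \<alpha>) - Gv c d m \<mu> j \<beta> \<alpha> e) * partial_v AT AM c d m \<mu> e f)"
    using p4(3) by simp
  show "proj_T AT AM M N (torsion E D (Xv j \<beta>) (Xx i)) e = (\<lambda>f. 0)"
    using p5(1) by simp
  show "proj_M AT AM M N (torsion E D (Xv j \<beta>) (Xx i)) e = (\<lambda>f. \<Sum>m\<in>UNIV. C c d m i j \<beta> e * delta_x AT AM N c d m e f)"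
    using p5(2) by simp
  show "proj_V AT AM M N (torsion E D (Xv j \<beta>) (Xx i)) e =
        (\<lambda>f. \<Sum>m\<in>UNIV. \<Sum>\<mu>\<in>UNIV.
        (partial_v AT AM c d j \<beta> e (N c d m \<mu> i) - Lv c d m \<mu> j \<beta> i e) * partial_v AT AM c d m \<mu> e f)"
    using p5(3) by simp
  show "proj_T AT AM M N (torsion E D (Xv j \<beta>) (Xv i \<alpha>)) e = (\<lambda>f. 0)"
    using p6(1) by simp
  show "proj_M AT AM M N (torsion E D (Xv j \<beta>) (Xv i \<alpha>)) e = (\<lambda>f. 0)"
    using p6(2) by simp
  show "proj_V AT AM M N (torsion E D (Xv j \<beta>) (Xv i \<alpha>)) e =
        (\<lambda>f. \<Sum>m\<in>UNIV. \<Sum>\<mu>\<in>UNIV.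
        (Cv c d m \<mu> i \<alpha> j \<beta> e - Cv c d m \<mu> j \<beta> i \<alpha> e) * partial_v AT AM c d m \<mu> e f)"
    using p6(3) by simp
qed

end

text \<open>Local expressions can determine the torsion only because it is a tensor; therefore the
  conclusion contains \<open>skew_tensor\<close> and a uniqueness clause in addition to the eighteen
  components.\<close>

theorem theorem2p2:
  fixes AT :: "('a, real^'p::finite) chart set" and AM :: "('b, real^'n::finite) chart set"
    and D :: "('a, 'b) jet field \<Rightarrow> ('a, 'b) jet field \<Rightarrow> ('a, 'b) jet field"
  assumes "smooth_manifold AT" and "smooth_manifold AM"
    and "nonlinear_connection AT AM M N"
    and "Gamma_linear_connection AT AM M N D"
    and "local_components AT AM M N D Gb G Gv Lb L Lv Cb C Cv"
  shows
    "let E = jet_atlas AT AM; Tor = torsion E D;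
         hT = proj_T AT AM M N; hM = proj_M AT AM M N; v = proj_V AT AM M N;
         dt = delta_t AT AM M; dx = delta_x AT AM N; dv = partial_v AT AM
     in
       (\<forall>c\<in>AT. \<forall>d\<in>AM. \<forall>e\<in>jet_dom AT AM c d. \<forall>Xt Xx Xv.
          extends_adapted_basis AT AM M N c d e Xt Xx Xv \<longrightarrow> (\<forall>\<alpha> \<beta> i j.
          hT (Tor (Xt \<beta>) (Xt \<alpha>)) e =
            (\<lambda>f. \<Sum>\<mu>\<in>UNIV. (Gb c d \<mu> \<alpha> \<beta> e - Gb c d \<mu> \<beta> \<alpha> e) * dt c d \<mu> e f) \<and>
          hM (Tor (Xt \<beta>) (Xt \<alpha>)) e = (\<lambda>f. 0) \<and>
          v (Tor (Xt \<beta>) (Xt \<alpha>)) e =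
            (\<lambda>f. \<Sum>m\<in>UNIV. \<Sum>\<mu>\<in>UNIV.
               (dt c d \<beta> e (M c d m \<mu> \<alpha>) - dt c d \<alpha> e (M c d m \<mu> \<beta>)) * dv c d m \<mu> e f) \<and>

          hT (Tor (Xx j) (Xt \<alpha>)) e = (\<lambda>f. \<Sum>\<mu>\<in>UNIV. Lb c d \<mu> \<alpha> j e * dt c d \<mu> e f) \<and>
          hM (Tor (Xx j) (Xt \<alpha>)) e = (\<lambda>f. \<Sum>m\<in>UNIV. (- G c d m j \<alpha> e) * dx c d m e f) \<and>
          v (Tor (Xx j) (Xt \<alpha>)) e =
            (\<lambda>f. \<Sum>m\<in>UNIV. \<Sum>\<mu>\<in>UNIV.
               (dx c d j e (M c d m \<mu> \<alpha>) - dt c d \<alpha> e (N c d m \<mu> j)) * dv c d m \<mu> e f) \<and>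

          hT (Tor (Xx j) (Xx i)) e = (\<lambda>f. 0) \<and>
          hM (Tor (Xx j) (Xx i)) e =
            (\<lambda>f. \<Sum>m\<in>UNIV. (L c d m i j e - L c d m j i e) * dx c d m e f) \<and>
          v (Tor (Xx j) (Xx i)) e =
            (\<lambda>f. \<Sum>m\<in>UNIV. \<Sum>\<mu>\<in>UNIV.
               (dx c d j e (N c d m \<mu> i) - dx c d i e (N c d m \<mu> j)) * dv c d m \<mu> e f) \<and>

          hT (Tor (Xv j \<beta>) (Xt \<alpha>)) e = (\<lambda>f. \<Sum>\<mu>\<in>UNIV. Cb c d \<mu> \<alpha> j \<beta> e * dt c d \<mu> e f) \<and>
          hM (Tor (Xv j \<beta>) (Xt \<alpha>)) e = (\<lambda>f. 0) \<and>
          v (Tor (Xv j \<beta>) (Xt \<alpha>)) e =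
            (\<lambda>f. \<Sum>m\<in>UNIV. \<Sum>\<mu>\<in>UNIV.
               (dv c d j \<beta> e (M c d m \<mu> \<alpha>) - Gv c d m \<mu> j \<beta> \<alpha> e) * dv c d m \<mu> e f) \<and>

          hT (Tor (Xv j \<beta>) (Xx i)) e = (\<lambda>f. 0) \<and>
          hM (Tor (Xv j \<beta>) (Xx i)) e = (\<lambda>f. \<Sum>m\<in>UNIV. C c d m i j \<beta> e * dx c d m e f) \<and>
          v (Tor (Xv j \<beta>) (Xx i)) e =
            (\<lambda>f. \<Sum>m\<in>UNIV. \<Sum>\<mu>\<in>UNIV.
               (dv c d j \<beta> e (N c d m \<mu> i) - Lv c d m \<mu> j \<beta> i e) * dv c d m \<mu> e f) \<and>

          hT (Tor (Xv j \<beta>) (Xv i \<alpha>)) e = (\<lambda>f. 0) \<and>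
          hM (Tor (Xv j \<beta>) (Xv i \<alpha>)) e = (\<lambda>f. 0) \<and>
          v (Tor (Xv j \<beta>) (Xv i \<alpha>)) e =
            (\<lambda>f. \<Sum>m\<in>UNIV. \<Sum>\<mu>\<in>UNIV.
               (Cv c d m \<mu> i \<alpha> j \<beta> e - Cv c d m \<mu> j \<beta> i \<alpha> e) * dv c d m \<mu> e f))) \<and>
       skew_tensor E Tor \<and>
       (\<forall>S. skew_tensor E S \<and>
          (\<forall>c\<in>AT. \<forall>d\<in>AM. \<forall>e\<in>jet_dom AT AM c d. \<forall>Xt Xx Xv.
             extends_adapted_basis AT AM M N c d e Xt Xx Xv \<longrightarrow> (\<forall>\<alpha> \<beta> i j.
             S (Xt \<beta>) (Xt \<alpha>) e = Tor (Xt \<beta>) (Xt \<alpha>) e \<and>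
             S (Xx j) (Xt \<alpha>) e = Tor (Xx j) (Xt \<alpha>) e \<and>
             S (Xx j) (Xx i) e = Tor (Xx j) (Xx i) e \<and>
             S (Xv j \<beta>) (Xt \<alpha>) e = Tor (Xv j \<beta>) (Xt \<alpha>) e \<and>
             S (Xv j \<beta>) (Xx i) e = Tor (Xv j \<beta>) (Xx i) e \<and>
             S (Xv j \<beta>) (Xv i \<alpha>) e = Tor (Xv j \<beta>) (Xv i \<alpha>) e))
          \<longrightarrow> (\<forall>X\<in>vector_fields E. \<forall>Y\<in>vector_fields E. S X Y = Tor X Y))"
proof -
  interpret jet_space AT AM
    using assms(1,2) by (intro jet_space.intro smooth_manifold_imp_Hausdorff_atlas)
  note NC = assms(3) and comps = assms(5)
  have "linear_connection E D"
    using assms(4) by (simp add: Gamma_linear_connection_def)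
  then have skew: "skew_tensor E (torsion E D)"
    by (rule J.skew_tensor_torsion)
  have unique: "S X Y = torsion E D X Y"
    if S: "skew_tensor E S" and eq: "\<forall>c\<in>AT. \<forall>d\<in>AM. \<forall>e\<in>jet_dom AT AM c d. \<forall>Xt Xx Xv.
             extends_adapted_basis AT AM M N c d e Xt Xx Xv \<longrightarrow> (\<forall>\<alpha> \<beta> i j.
             S (Xt \<beta>) (Xt \<alpha>) e = torsion E D (Xt \<beta>) (Xt \<alpha>) e \<and>
             S (Xx j) (Xt \<alpha>) e = torsion E D (Xx j) (Xt \<alpha>) e \<and>
             S (Xx j) (Xx i) e = torsion E D (Xx j) (Xx i) e \<and>
             S (Xv j \<beta>) (Xt \<alpha>) e = torsion E D (Xv j \<beta>) (Xt \<alpha>) e \<and>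
             S (Xv j \<beta>) (Xx i) e = torsion E D (Xv j \<beta>) (Xx i) e \<and>
             S (Xv j \<beta>) (Xv i \<alpha>) e = torsion E D (Xv j \<beta>) (Xv i \<alpha>) e)"
      and X: "X \<in> vector_fields E" and Y: "Y \<in> vector_fields E" for S X Y
  proof
    fix e
    show "S X Y e = torsion E D X Y e"
    proof (cases "e \<in> carrier E")
      case True
      then obtain K where "K \<in> E" "e \<in> fst K"
        by (rule J.carrierE)
      then obtain c d where c: "c \<in> AT" and d: "d \<in> AM" and e: "e \<in> jet_dom AT AM c d"
        by (auto elim: jet_atlasE)
      obtain Xt Xx Xv where ext: "extends_adapted_basis AT AM M N c d e Xt Xx Xv"
        by (rule adapted_frame_extension[OF NC c d e])
      have "\<forall>\<alpha> \<beta> i j.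
             S (Xt \<beta>) (Xt \<alpha>) e = torsion E D (Xt \<beta>) (Xt \<alpha>) e \<and>
             S (Xx j) (Xt \<alpha>) e = torsion E D (Xx j) (Xt \<alpha>) e \<and>
             S (Xx j) (Xx i) e = torsion E D (Xx j) (Xx i) e \<and>
             S (Xv j \<beta>) (Xt \<alpha>) e = torsion E D (Xv j \<beta>) (Xt \<alpha>) e \<and>
             S (Xv j \<beta>) (Xx i) e = torsion E D (Xv j \<beta>) (Xx i) e \<and>
             S (Xv j \<beta>) (Xv i \<alpha>) e = torsion E D (Xv j \<beta>) (Xv i \<alpha>) e"
        using eq c d e ext by blast
      then show ?thesis
        by (intro skew_tensor_eq_on_adapted_frame[OF NC S skew c d e ext _ _ _ _ _ _ X Y]) simp_all
    next
      case False
      \<comment> \<open>Vector fields are the zero operator off the underlying set, so the equality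
        of HOL functions holds at these points too.\<close>
      have "S X Y \<in> vector_fields E" "torsion E D X Y \<in> vector_fields E"
        using S skew X Y unfolding skew_tensor_def by meson+
      then show ?thesis
        using J.vector_field_off_carrier False by simp
    qed
  qed
  show ?thesis
    unfolding Let_def
    by (intro conjI ballI allI impI)
      ((rule torsion_components[OF NC comps], assumption, assumption, assumption, assumption)+,
        rule skew, elim conjE, rule unique)
qed

end
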